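(* Let $\Omega=B(0,1)\subset\mathbb R^3$. There exist a random potential $Q$ taking two values among smooth nonnegative real potentials on $\overline\Omega$, and a deterministic smooth nonnegative potential $q_*$ on $\overline\Omega$, such that \[ \mathbb E[\Lambda_Q]=\Lambda_{q_*}\qquad\text{while}\qquad q_*\neq\mathbb E Q. \]
   Context: For a bounded domain $\Omega\subset\mathbb R^n$ with smooth boundary and a nonnegative real potential $q\in C^\infty(\overline\Omega)$, the Schrödinger Dirichlet-to-Neumann map is $\Lambda_q f=\partial_\nu u_f|_{\partial\Omega}$, where $u_f$ is the unique solution of $(-\Delta+q)u_f=0$ in $\Omega$, $u_f|_{\partial\Omega}=f$, with $\nu$ the outer unit normal; it is a bounded operator $H^{1/2}(\partial\Omega)\to H^{-1/2}(\partial\Omega)$. For a random potential $Q$, the expectation $\mathbb E\Lambda_Q$ is defined weakly by $\langle(\mathbb E\Lambda_Q)f,g\rangle=\mathbb E\langle\Lambda_Qf,g\rangle$ for all $f,g\in H^{1/2}(\partial\Omega)$, and $\mathbb EQ$ is the pointwise mean. *)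

theory Defs
  imports "HOL-Analysis.Analysis" "HOL-Probability.Probability"
begin

section \<open>Smooth functions\<close>

definition partial_deriv ::
  "'a::euclidean_space \<Rightarrow> ('a \<Rightarrow> 'b::real_normed_vector) \<Rightarrow> 'a \<Rightarrow> 'b" where
  "partial_deriv i f x = frechet_derivative f (at x) i"

primrec Ck :: "nat \<Rightarrow> ('a::euclidean_space \<Rightarrow> 'b::real_normed_vector) \<Rightarrow> bool" where
  "Ck 0 f \<longleftrightarrow> continuous_on UNIV f"
| "Ck (Suc k) f \<longleftrightarrow> (\<forall>x. f differentiable (at x)) \<and> (\<forall>i\<in>Basis. Ck k (partial_deriv i f))"

definition smooth :: "('a::euclidean_space \<Rightarrow> 'b::real_normed_vector) \<Rightarrow> bool" where
  "smooth f \<longleftrightarrow> (\<forall>k. Ck k f)"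

definition smooth_upto_boundary ::
  "('a::euclidean_space \<Rightarrow> 'b::real_normed_vector) \<Rightarrow> 'a set \<Rightarrow> bool" where
  "smooth_upto_boundary f \<Omega> \<longleftrightarrow> (\<exists>h. smooth h \<and> (\<forall>x\<in>closure \<Omega>. f x = h x))"

definition test_function :: "('a::euclidean_space \<Rightarrow> real) \<Rightarrow> 'a set \<Rightarrow> bool" where
  "test_function \<phi> \<Omega> \<longleftrightarrow> smooth \<phi> \<and> (\<exists>K. compact K \<and> K \<subseteq> \<Omega> \<and> (\<forall>x. x \<notin> K \<longrightarrow> \<phi> x = 0))"

section \<open>Sobolev spaces and traces on the unit ball\<close>

abbreviation unit_ball :: "'a::euclidean_space set" where
  "unit_ball \<equiv> ball 0 1"

text \<open>Surface measure on the unit sphere, obtained from the cone formula: the part of the unit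
  ball lying over a portion of the sphere with area \<open>s\<close> has volume \<open>s / n\<close>.
  The measure is carried by the sphere but lives on the whole space.\<close>

definition sphere_measure :: "'a::euclidean_space measure" where
  "sphere_measure = scale_measure (of_nat DIM('a))
     (distr (lebesgue_on unit_ball) borel (\<lambda>x. x /\<^sub>R norm x))"

definition square_integrable :: "'a measure \<Rightarrow> ('a \<Rightarrow> complex) \<Rightarrow> bool" where
  "square_integrable M u \<longleftrightarrow> u \<in> borel_measurable M \<and> integrable M (\<lambda>x. (cmod (u x))\<^sup>2)"

text \<open>A gradient is represented by the family of its components, indexed by \<open>Basis\<close>.
  \<open>H1 u G\<close> says that \<open>u\<close> belongs to the Sobolev space $H^1$ of the unit ball and that \<open>G\<close> is
  (a representative of) its weak gradient, which is unique up to null sets.\<close>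

definition weak_partial_deriv ::
  "'a::euclidean_space \<Rightarrow> ('a \<Rightarrow> complex) \<Rightarrow> ('a \<Rightarrow> complex) \<Rightarrow> bool" where
  "weak_partial_deriv i u w \<longleftrightarrow> (\<forall>\<phi>. test_function \<phi> unit_ball \<longrightarrow>
     (LINT x|lebesgue_on unit_ball. u x * of_real (partial_deriv i \<phi> x)) =
     - (LINT x|lebesgue_on unit_ball. w x * of_real (\<phi> x)))"

definition H1 :: "('a::euclidean_space \<Rightarrow> complex) \<Rightarrow> ('a \<Rightarrow> 'a \<Rightarrow> complex) \<Rightarrow> bool" where
  "H1 u G \<longleftrightarrow> square_integrable (lebesgue_on unit_ball) u \<and>
     (\<forall>i\<in>Basis. square_integrable (lebesgue_on unit_ball) (G i) \<and> weak_partial_deriv i u (G i))"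

definition H1_dist_sq ::
  "('a::euclidean_space \<Rightarrow> complex) \<Rightarrow> ('a \<Rightarrow> 'a \<Rightarrow> complex) \<Rightarrow>
   ('a \<Rightarrow> complex) \<Rightarrow> ('a \<Rightarrow> 'a \<Rightarrow> complex) \<Rightarrow> real" where
  "H1_dist_sq u G v H = (LINT x|lebesgue_on unit_ball.
     (cmod (u x - v x))\<^sup>2 + (\<Sum>i\<in>Basis. (cmod (G i x - H i x))\<^sup>2))"

text \<open>The trace operator is the continuous extension of restriction to the sphere from smooth
  functions on the closed ball to $H^1$; boundary values are functions modulo null sets of
  the surface measure, so \<open>has_trace u G\<close> relates \<open>u\<close> to every representative of its trace.\<close>

definition has_trace ::
  "('a::euclidean_space \<Rightarrow> complex) \<Rightarrow> ('a \<Rightarrow> 'a \<Rightarrow> complex) \<Rightarrow> ('a \<Rightarrow> complex) \<Rightarrow> bool" where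
  "has_trace u G f \<longleftrightarrow> H1 u G \<and> square_integrable sphere_measure f \<and>
     (\<exists>\<phi> :: nat \<Rightarrow> 'a \<Rightarrow> complex. (\<forall>k. smooth (\<phi> k)) \<and>
        (\<lambda>k. H1_dist_sq (\<phi> k) (\<lambda>i. partial_deriv i (\<phi> k)) u G) \<longlonglongrightarrow> 0 \<and>
        (\<lambda>k. LINT x|sphere_measure. (cmod (\<phi> k x - f x))\<^sup>2) \<longlonglongrightarrow> 0)"

text \<open>$H^{1/2}$ of the sphere is the range of the trace operator on $H^1$.\<close>

definition H_half :: "('a::euclidean_space \<Rightarrow> complex) set" where
  "H_half = {f. \<exists>u G. has_trace u G f}"

section \<open>The Schroedinger Dirichlet-to-Neumann map\<close>

definition schroedinger_form ::
  "('a::euclidean_space \<Rightarrow> real) \<Rightarrow> ('a \<Rightarrow> complex) \<Rightarrow> ('a \<Rightarrow> 'a \<Rightarrow> complex) \<Rightarrow>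
   ('a \<Rightarrow> complex) \<Rightarrow> ('a \<Rightarrow> 'a \<Rightarrow> complex) \<Rightarrow> complex" where
  "schroedinger_form q u G v H = (LINT x|lebesgue_on unit_ball.
     (\<Sum>i\<in>Basis. G i x * H i x) + of_real (q x) * u x * v x)"

text \<open>Weak form of $(-\Delta + q) u = 0$ in the ball and $u = f$ on the sphere; the space
  $H^1_0$ of admissible test functions consists of the $H^1$ functions with zero trace.\<close>

definition dirichlet_solution ::
  "('a::euclidean_space \<Rightarrow> real) \<Rightarrow> ('a \<Rightarrow> complex) \<Rightarrow>
   ('a \<Rightarrow> complex) \<Rightarrow> ('a \<Rightarrow> 'a \<Rightarrow> complex) \<Rightarrow> bool" where
  "dirichlet_solution q f u G \<longleftrightarrow> has_trace u G f \<and>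
     (\<forall>v H. has_trace v H (\<lambda>_. 0) \<longrightarrow> schroedinger_form q u G v H = 0)"

text \<open>\<open>DN q f\<close> is the weak normal derivative of the solution with boundary value \<open>f\<close>, an element
  of $H^{-1/2}$ given as a functional on $H^{1/2}$. By Green's formula, if $\Delta u = q u$ then
  $\langle \partial_\nu u, g \rangle = \int \nabla u \cdot \nabla v + q u v$ for every
  $v \in H^1$ with trace \<open>g\<close>. The pairing is bilinear (no complex conjugation).\<close>

definition DN ::
  "('a::euclidean_space \<Rightarrow> real) \<Rightarrow> ('a \<Rightarrow> complex) \<Rightarrow> ('a \<Rightarrow> complex) \<Rightarrow> complex" where
  "DN q f g = (THE c. \<exists>u G v H. dirichlet_solution q f u G \<and> has_trace v H g \<and>
     c = schroedinger_form q u G v H)"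

section \<open>Random potentials\<close>

text \<open>A potential is a function on the closed ball, so it is taken \<open>undefined\<close> elsewhere; equality
  of potentials is then equality on the closed ball.\<close>

definition potentials :: "('a::euclidean_space \<Rightarrow> real) set" where
  "potentials = {q \<in> extensional (closure unit_ball). smooth_upto_boundary q unit_ball \<and>
     (\<forall>x\<in>closure unit_ball. 0 \<le> q x)}"

definition mean_potential :: "('a::euclidean_space \<Rightarrow> real) pmf \<Rightarrow> 'a \<Rightarrow> real" where
  "mean_potential Q = (\<lambda>x\<in>closure unit_ball. measure_pmf.expectation Q (\<lambda>q. q x))"

definition mean_DN ::
  "('a::euclidean_space \<Rightarrow> real) pmf \<Rightarrow> ('a \<Rightarrow> complex) \<Rightarrow> ('a \<Rightarrow> complex) \<Rightarrow> complex" where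
  "mean_DN Q f g = measure_pmf.expectation Q (\<lambda>q. DN q f g)"

end

(* For a harmonic function h in the unit ball of R^3 and r = |x|, put F = r h_r + (w_0 + 1/2) h, which is
   again harmonic. If w(r) solves the Riccati equation r w' = w^2 - a^2 with w(1) = w_0, then
   u = r h_r + (w + 1/2) h solves (-Delta + q) u = 0 with q = 2 (w^2 - a^2) / r^2. On the sphere u = F,
   whatever a is, and the weak normal derivative of u is that of F plus (w_0^2 - a^2) h. So the
   Dirichlet-to-Neumann map is affine in a^2, while q is not. For w_0 = 7/2 and a = 1, 2, 3 the
   potentials q_1, q_2, q_3 are smooth and nonnegative; as 4 = 5/8 * 1 + 3/8 * 9, the choice Q = q_1 with
   probability 5/8 and Q = q_3 with probability 3/8 gives the map of q_2. At the origin q_2 and q_3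
   vanish but q_1 does not.

   F is the minimiser of the Dirichlet energy with given boundary values, and
   h(x) = int_0^1 s^(w_0 - 1/2) F(s x) ds. *)
theory Submission
  imports Defs
begin

section \<open>Calculus of smooth functions\<close>

text \<open>In dimension three put t = -ln r and H = r^(1/2) h. Harmonicity of h becomes (-d^2/dt^2
  + L) H = 0 with an angular operator L. If w' + w^2 = a^2 in t, then -d^2/dt^2 + a^2 = (d/dt +
  w)(-d/dt + w), and the factors in reverse order give -d^2/dt^2 + a^2 - 2 w'. Both commute with L,
  so -d/dt + w carries harmonic functions to solutions with r^2 q = -2 w'; written for h, it is r
  h_r + (w + 1/2) h. The value 7/2 exceeds a = 1, 2, 3, which gives q >= 0 and keeps the pole of w
  outside the closed ball; being a half-integer, it makes s^(w_0 - 1/2) a natural power. Integer a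
  makes q smooth at the origin. The obstacle is that F is known only as a weak minimiser in H^1.
  Interior regularity is avoided: identities are proved for smooth approximants, which are not
  harmonic, and harmonicity enters in the limit as orthogonality of the gradient to gradients of
  functions with zero trace. What puts h into H^1 is an L^2 bound for the inverse of r d/dr +
  c.\<close>

lemma partial_deriv_eq:
  assumes "(f has_derivative f') (at x)"
  shows "partial_deriv i f x = f' i"
  using frechet_derivative_at[OF assms] by (simp add: partial_deriv_def)

lemma Ck_SucI:
  assumes "\<And>x. (f has_derivative f' x) (at x)" "\<And>i. i \<in> Basis \<Longrightarrow> Ck k (\<lambda>x. f' x i)"
  shows "Ck (Suc k) f"
proof -
  have "partial_deriv i f = (\<lambda>x. f' x i)" for i
    using partial_deriv_eq[OF assms(1)] by (intro ext)
  with assms show ?thesis by (auto simp: differentiable_def)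
qed

lemma Ck_Suc_D: "Ck (Suc k) f \<Longrightarrow> Ck k f"
proof (induction k arbitrary: f)
  case 0
  then show ?case
    by (auto intro!: continuous_at_imp_continuous_on differentiable_imp_continuous_within)
next
  case (Suc k)
  then show ?case by (metis Ck.simps(2))
qed

lemma Ck_has_derivative:
  assumes "Ck (Suc k) f"
  shows "(f has_derivative frechet_derivative f (at x)) (at x)"
  using assms by (simp flip: frechet_derivative_works)

lemma Ck_partial_deriv: "Ck (Suc k) f \<Longrightarrow> i \<in> Basis \<Longrightarrow> Ck k (partial_deriv i f)"
  by simp

lemma Ck_frechet_derivative:
  "Ck (Suc k) f \<Longrightarrow> i \<in> Basis \<Longrightarrow> Ck k (\<lambda>x. frechet_derivative f (at x) i)"
  using Ck_partial_deriv by (simp add: partial_deriv_def[abs_def])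

lemma Ck_continuous_on: "Ck k f \<Longrightarrow> continuous_on S f"
proof (induction k arbitrary: f)
  case 0
  then show ?case by (auto intro: continuous_on_subset)
next
  case (Suc k)
  then show ?case using Ck_Suc_D by blast
qed

lemma Ck_const [simp]: "Ck k (\<lambda>x. c)"
  proof (induction k arbitrary: c)
  case (Suc k)
  show ?case by (rule Ck_SucI[where f' = "\<lambda>_ _. 0"]) (auto intro: Suc.IH)
qed auto

lemma Ck_linear:
  assumes "bounded_linear L"
  shows "Ck k L"
proof (cases k)
  case 0
  then show ?thesis by (simp add: assms linear_continuous_on)
next
  case (Suc j)
  have "Ck (Suc j) L"
    by (rule Ck_SucI[where f' = "\<lambda>_. L"])
       (auto intro: bounded_linear_imp_has_derivative assms)
  with Suc show ?thesis by simp
qed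

lemma Ck_add: "Ck k f \<Longrightarrow> Ck k g \<Longrightarrow> Ck k (\<lambda>x. f x + g x)"
proof (induction k arbitrary: f g)
  case 0
  then show ?case by (auto intro: continuous_intros)
next
  case (Suc k)
  show ?case
    by (rule Ck_SucI[OF has_derivative_add[OF Suc.prems[THEN Ck_has_derivative]]])
       (use Suc in \<open>auto simp: partial_deriv_def[abs_def]\<close>)
qed

lemma Ck_bounded_linear:
  assumes L: "bounded_linear L"
  shows "Ck k f \<Longrightarrow> Ck k (\<lambda>x. L (f x))"
proof (induction k arbitrary: f)
  case 0
  then show ?case by (auto intro: bounded_linear.continuous_on[OF L])
next
  case (Suc k)
  show ?case
    by (rule Ck_SucI[OF bounded_linear.has_derivative[OF L Suc.prems(1)[THEN Ck_has_derivative]]])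
       (use Suc in \<open>auto simp: partial_deriv_def[abs_def]\<close>)
qed

lemma Ck_bounded_bilinear:
  assumes B: "bounded_bilinear B"
  shows "Ck k f \<Longrightarrow> Ck k g \<Longrightarrow> Ck k (\<lambda>x. B (f x) (g x))"
proof (induction k arbitrary: f g)
  case 0
  then show ?case by (auto intro: bounded_bilinear.continuous_on[OF B])
next
  case (Suc k)
  show ?case
    by (rule Ck_SucI[OF bounded_bilinear.FDERIV[OF B Suc.prems[THEN Ck_has_derivative]]])
       (intro Ck_add Suc.IH Ck_frechet_derivative Suc.prems[THEN Ck_Suc_D] Suc.prems; assumption)
qed

lemma Ck_mult:
  fixes f g :: "'a::euclidean_space \<Rightarrow> 'b::real_normed_algebra"
  shows "Ck k f \<Longrightarrow> Ck k g \<Longrightarrow> Ck k (\<lambda>x. f x * g x)"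
  by (rule Ck_bounded_bilinear[OF bounded_bilinear_mult])

text \<open>Since the inner function is real-valued, the chain rule is a single product of the
  derivative of \<open>f\<close> with \<open>g'\<close> at \<open>f x\<close>, so the induction runs
  through \<open>Ck_bounded_bilinear\<close>. Functions of |x|^2 are the intended use.\<close>

lemma Ck_compose:
  fixes g :: "real \<Rightarrow> 'b::real_normed_algebra_1" and f :: "'a::euclidean_space \<Rightarrow> real"
  shows "Ck k g \<Longrightarrow> Ck k f \<Longrightarrow> Ck k (\<lambda>x. g (f x))"
proof (induction k arbitrary: f g)
  case 0
  then show ?case by (auto intro: continuous_on_compose2)
next
  case (Suc k)
  have D: "((\<lambda>x. g (f x)) has_derivative
      (\<lambda>v. frechet_derivative f (at x) v *\<^sub>R partial_deriv 1 g (f x))) (at x)" for x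
  proof -
    have "((g \<circ> f) has_derivative (frechet_derivative g (at (f x)) \<circ> frechet_derivative f (at x))) (at x)"
      by (intro diff_chain_at Ck_has_derivative[OF Suc.prems(1)] Ck_has_derivative[OF Suc.prems(2)])
    moreover have "frechet_derivative g (at (f x)) r = r *\<^sub>R partial_deriv 1 g (f x)" for r
    proof -
      have "linear (frechet_derivative g (at (f x)))"
        using Suc.prems(1) by (simp add: linear_frechet_derivative)
      from linear_scale[OF this, of r 1] show ?thesis by (simp add: partial_deriv_def)
    qed
    ultimately show ?thesis by (simp add: o_def)
  qed
  show ?case
    by (rule Ck_SucI[OF D])
       (intro Ck_bounded_bilinear[OF bounded_bilinear_scaleR] Ck_frechet_derivative
          Suc.IH[OF Ck_partial_deriv] Suc.prems Suc.prems(2)[THEN Ck_Suc_D];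
        simp)
qed

text \<open>The derivative of the inverse is a product of inverses and the derivative of
  \<open>f\<close>, so the induction on \<open>k\<close> feeds on itself.\<close>

lemma Ck_inverse:
  fixes f :: "'a::euclidean_space \<Rightarrow> 'b::real_normed_div_algebra"
  assumes "Ck k f" "\<And>x. f x \<noteq> 0"
  shows "Ck k (\<lambda>x. inverse (f x))"
  using assms
proof (induction k arbitrary: f)
  case 0
  then show ?case by (auto intro!: continuous_on_inverse)
next
  case (Suc k)
  have D: "((\<lambda>x. inverse (f x)) has_derivative (\<lambda>h. - (inverse (f x) * frechet_derivative f (at x) h * inverse (f x)))) (at x)" for x
    using Deriv.has_derivative_inverse[OF Suc.prems(2) Ck_has_derivative[OF Suc.prems(1)]] by simp
  have "Ck k (\<lambda>x. - (inverse (f x) * frechet_derivative f (at x) i * inverse (f x)))" if "i \<in> Basis" for i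
    by (intro Ck_bounded_linear[OF bounded_linear_minus[OF bounded_linear_ident]] Ck_mult Suc.IH
        Ck_frechet_derivative Suc.prems Suc.prems(1)[THEN Ck_Suc_D] that)
  then show ?case by (rule Ck_SucI[OF D])
qed

section \<open>Dilations and weighted integrals over them\<close>

lemma has_derivative_dilate:
  assumes "f differentiable (at (s *\<^sub>R x))"
  shows "((\<lambda>x. f (s *\<^sub>R x)) has_derivative (\<lambda>v. s *\<^sub>R frechet_derivative f (at (s *\<^sub>R x)) v)) (at x)"
proof -
  have "(f \<circ> (\<lambda>x. s *\<^sub>R x) has_derivative (frechet_derivative f (at (s *\<^sub>R x)) \<circ> (\<lambda>x. s *\<^sub>R x))) (at x)"
    by (intro diff_chain_at assms[unfolded frechet_derivative_works] derivative_intros)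
  then show ?thesis by (simp add: o_def linear_scale[OF linear_frechet_derivative[OF assms]])
qed

lemma Ck_dilate:
  shows "Ck k f \<Longrightarrow> Ck k (\<lambda>x. f (s *\<^sub>R x))"
proof (induction k arbitrary: f)
  case 0
  then show ?case by (auto intro!: continuous_on_compose2[of UNIV f] continuous_intros)
next
  case (Suc k)
  have "Ck k (\<lambda>x. s *\<^sub>R partial_deriv i f (s *\<^sub>R x))" if "i \<in> Basis" for i
    using Suc that by (intro Ck_bounded_linear[OF bounded_linear_scaleR_right] Suc.IH) simp
  with Suc.prems show ?case
    by (intro Ck_SucI[OF has_derivative_dilate]) (simp_all add: partial_deriv_def)
qed

lemma partial_deriv_dilate:
  "f differentiable at (s *\<^sub>R x) \<Longrightarrow> partial_deriv i (\<lambda>x. f (s *\<^sub>R x)) x = s *\<^sub>R partial_deriv i f (s *\<^sub>R x)"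
  using partial_deriv_eq[OF has_derivative_dilate] by (simp add: partial_deriv_def)

text \<open>Differentiation under the integral replaces \<open>f\<close> by its partial derivatives
  and raises the weight from \<open>s ^ m\<close> to \<open>s ^ Suc m\<close>; the induction
  therefore runs over all \<open>f\<close> and \<open>m\<close> at once.\<close>

lemma Ck_integral_dilate:
  fixes f :: "'a::euclidean_space \<Rightarrow> 'b::{banach}"
  shows "Ck k f \<Longrightarrow> Ck k (\<lambda>x. integral {0..1} (\<lambda>s::real. s ^ m *\<^sub>R f (s *\<^sub>R x)))"
    and "Ck (Suc k) f \<Longrightarrow> ((\<lambda>x. integral {0..1} (\<lambda>s::real. s ^ m *\<^sub>R f (s *\<^sub>R x))) has_derivative
      (\<lambda>i. integral {0..1} (\<lambda>s::real. s ^ Suc m *\<^sub>R frechet_derivative f (at (s *\<^sub>R x)) i))) (at x)"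
proof -
  have cont: "continuous_on (UNIV \<times> cbox 0 1) (\<lambda>(x, s). s ^ m *\<^sub>R f (s *\<^sub>R x))" 
    if "Ck k f" for k m and f :: "'a \<Rightarrow> 'b"
  proof -
    have "continuous_on (UNIV \<times> cbox 0 1) (\<lambda>p :: 'a \<times> real. f (snd p *\<^sub>R fst p))"
      by (rule continuous_on_compose2[OF Ck_continuous_on[OF that, of UNIV]])
         (auto intro!: continuous_intros)
    then show ?thesis by (auto simp: case_prod_beta intro!: continuous_intros)
  qed
  have D: "((\<lambda>x. integral {0..1} (\<lambda>s::real. s ^ m *\<^sub>R f (s *\<^sub>R x))) has_derivative
      (\<lambda>i. integral {0..1} (\<lambda>s::real. s ^ Suc m *\<^sub>R frechet_derivative f (at (s *\<^sub>R x)) i))) (at x)"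
    if f: "Ck (Suc k) f" for k m x and f :: "'a \<Rightarrow> 'b"
  proof -
    \<comment> \<open>The Leibniz rule wants the derivative as a continuous function into bounded
      linear maps. Continuity is checked on basis vectors, where \<open>B\<close> is a weighted
      partial derivative.\<close>
    define B where "B = (\<lambda>x s. Blinfun (\<lambda>v. s ^ Suc m *\<^sub>R frechet_derivative f (at (s *\<^sub>R x)) v))"
    have B: "blinfun_apply (B x s) = (\<lambda>v. s ^ Suc m *\<^sub>R frechet_derivative f (at (s *\<^sub>R x)) v)" for x s
      unfolding B_def
      by (intro bounded_linear_Blinfun_apply bounded_linear_const_scaleR 
          has_derivative_bounded_linear[OF Ck_has_derivative[OF f]])
    have contB: "continuous_on (UNIV \<times> cbox 0 1) (\<lambda>(x, s). B x s)"
    proof (rule continuous_on_blinfun_componentwise)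
      fix i :: 'a assume "i \<in> Basis"
      then have "Ck k (partial_deriv i f)" using f by simp
      from cont[OF this, of "Suc m"] show "continuous_on (UNIV \<times> cbox 0 1) (\<lambda>x. blinfun_apply (case x of (x, s) \<Rightarrow> B x s) i)"
        by (simp add: case_prod_beta B partial_deriv_def)
    qed
    have fx: "((\<lambda>x. s ^ m *\<^sub>R f (s *\<^sub>R x)) has_derivative blinfun_apply (B x s)) (at x within UNIV)" for x s
    proof -
      have "((\<lambda>x. f (s *\<^sub>R x)) has_derivative (\<lambda>v. s *\<^sub>R frechet_derivative f (at (s *\<^sub>R x)) v)) (at x)"
        using f by (intro has_derivative_dilate) simp
      from has_derivative_scaleR_right[OF this, of "s ^ m"] show ?thesis by (simp add: B mult.commute)
    qed
    have int: "(\<lambda>s. s ^ m *\<^sub>R f (s *\<^sub>R x)) integrable_on cbox 0 1" for x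
    proof -
      have "continuous_on (cbox 0 1) (\<lambda>s. f (s *\<^sub>R x))"
        by (rule continuous_on_compose2[OF Ck_continuous_on[OF f, of UNIV]])
           (auto intro!: continuous_intros)
      then show ?thesis by (intro integrable_continuous continuous_intros)
    qed
    have "((\<lambda>x. integral (cbox 0 1) (\<lambda>s. s ^ m *\<^sub>R f (s *\<^sub>R x))) has_derivative
       integral (cbox 0 1) (B x)) (at x within UNIV)"
      by (rule leibniz_rule[OF fx int contB]) auto
    moreover have "blinfun_apply (integral (cbox 0 1) (B x)) i = integral (cbox 0 1) (\<lambda>s. blinfun_apply (B x s) i)" for i
    proof (rule blinfun_apply_integral)
      have "continuous_on (cbox 0 1) (\<lambda>s. (\<lambda>(x, s). B x s) (x, s))"
        by (rule continuous_on_compose2[OF contB]) (auto intro!: continuous_intros)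
      then show "B x integrable_on cbox 0 1" by (auto intro!: integrable_continuous_interval)
    qed
    ultimately have "blinfun_apply (integral {0..1} (B x)) =
        (\<lambda>i. integral {0..1} (\<lambda>s. s ^ Suc m *\<^sub>R frechet_derivative f (at (s *\<^sub>R x)) i))"
      and "((\<lambda>x. integral {0..1} (\<lambda>s. s ^ m *\<^sub>R f (s *\<^sub>R x))) has_derivative
         blinfun_apply (integral {0..1} (B x))) (at x)"
      by (auto simp: B)
    then show ?thesis by simp
  qed
  show "Ck (Suc k) f \<Longrightarrow> ((\<lambda>x. integral {0..1} (\<lambda>s::real. s ^ m *\<^sub>R f (s *\<^sub>R x))) has_derivative
      (\<lambda>i. integral {0..1} (\<lambda>s::real. s ^ Suc m *\<^sub>R frechet_derivative f (at (s *\<^sub>R x)) i))) (at x)"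
    by (rule D)
  show "Ck k f \<Longrightarrow> Ck k (\<lambda>x. integral {0..1} (\<lambda>s::real. s ^ m *\<^sub>R f (s *\<^sub>R x)))"
  proof (induction k arbitrary: f m)
    case 0
    have "continuous_on UNIV (\<lambda>x. integral (cbox 0 1) (\<lambda>s. s ^ m *\<^sub>R f (s *\<^sub>R x)))"
      by (rule integral_continuous_on_param[OF cont[OF 0]])
    then show ?case by simp
  next
    case (Suc k)
    show ?case
      by (rule Ck_SucI[OF D[OF Suc.prems]])
         (use Suc in \<open>auto simp flip: partial_deriv_def simp del: power_Suc\<close>)
  qed
qed

section \<open>Closure properties of smooth functions and rules for their partial
  derivatives\<close>

lemma smooth_Ck: "smooth f \<Longrightarrow> Ck k f"
  by (simp add: smooth_def)

lemma smooth_has_derivative: "smooth f \<Longrightarrow> (f has_derivative frechet_derivative f (at x)) (at x)"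
  by (rule Ck_has_derivative[OF smooth_Ck])

lemma smooth_differentiable: "smooth f \<Longrightarrow> f differentiable (at x)"
  using smooth_has_derivative differentiable_def by blast

lemma smooth_partial_deriv [intro]: "smooth f \<Longrightarrow> i \<in> Basis \<Longrightarrow> smooth (partial_deriv i f)"
  unfolding smooth_def by (auto intro: Ck_partial_deriv)

lemma smooth_continuous_on: "smooth f \<Longrightarrow> continuous_on S f"
  by (rule Ck_continuous_on[OF smooth_Ck])

lemma smooth_const [simp, intro]: "smooth (\<lambda>x. c)"
  by (simp add: smooth_def)

lemma smooth_linear: "bounded_linear L \<Longrightarrow> smooth L"
  by (simp add: smooth_def Ck_linear)

lemma smooth_add [intro]: "smooth f \<Longrightarrow> smooth g \<Longrightarrow> smooth (\<lambda>x. f x + g x)"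
  by (simp add: smooth_def Ck_add)

lemma smooth_bounded_linear: "bounded_linear L \<Longrightarrow> smooth f \<Longrightarrow> smooth (\<lambda>x. L (f x))"
  by (simp add: smooth_def Ck_bounded_linear)

lemma smooth_minus [intro]: "smooth f \<Longrightarrow> smooth (\<lambda>x. - f x)"
  by (rule smooth_bounded_linear[OF bounded_linear_minus[OF bounded_linear_ident]])

lemma smooth_diff [intro]: "smooth f \<Longrightarrow> smooth g \<Longrightarrow> smooth (\<lambda>x. f x - g x)"
  using smooth_add[OF _ smooth_minus, of f g] by simp

lemma smooth_of_real [intro]:
  "smooth f \<Longrightarrow> smooth (\<lambda>x. of_real (f x) :: 'b::{real_normed_algebra_1})"
  by (rule smooth_bounded_linear[OF bounded_linear_of_real])

lemma smooth_cnj [intro]: "smooth f \<Longrightarrow> smooth (\<lambda>x. cnj (f x))"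
  by (rule smooth_bounded_linear[OF bounded_linear_cnj])

lemma smooth_inner_left [intro]: "smooth (\<lambda>x. x \<bullet> i)"
  by (rule smooth_linear[OF bounded_linear_inner_left])

lemma smooth_mult [intro]:
  fixes f g :: "'a::euclidean_space \<Rightarrow> 'b::real_normed_algebra"
  shows "smooth f \<Longrightarrow> smooth g \<Longrightarrow> smooth (\<lambda>x. f x * g x)"
  by (simp add: smooth_def Ck_mult)

lemma smooth_power [intro]:
  fixes f :: "'a::euclidean_space \<Rightarrow> 'b::real_normed_algebra_1"
  shows "smooth f \<Longrightarrow> smooth (\<lambda>x. f x ^ n)"
  by (induction n) auto

lemma smooth_sum [intro]:
  "(\<And>i. i \<in> I \<Longrightarrow> smooth (f i)) \<Longrightarrow> smooth (\<lambda>x. \<Sum>i\<in>I. f i x)"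
  by (induction I rule: infinite_finite_induct) auto

lemma smooth_norm_sq [intro]: "smooth (\<lambda>x. x \<bullet> x)"
  unfolding smooth_def
  by (intro allI Ck_bounded_bilinear[OF bounded_bilinear_inner] Ck_linear bounded_linear_ident)

lemma smooth_compose:
  fixes g :: "real \<Rightarrow> 'b::real_normed_algebra_1"
  shows "smooth g \<Longrightarrow> smooth f \<Longrightarrow> smooth (\<lambda>x. g (f x))"
  by (simp add: smooth_def Ck_compose)

lemma smooth_inverse:
  fixes f :: "'a::euclidean_space \<Rightarrow> 'b::real_normed_div_algebra"
  shows "smooth f \<Longrightarrow> (\<And>x. f x \<noteq> 0) \<Longrightarrow> smooth (\<lambda>x. inverse (f x))"
  by (simp add: smooth_def Ck_inverse)

lemma smooth_dilate: "smooth f \<Longrightarrow> smooth (\<lambda>x. f (s *\<^sub>R x))"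
  by (simp add: smooth_def Ck_dilate)

lemma smooth_integral_dilate:
  fixes f :: "'a::euclidean_space \<Rightarrow> 'b::banach"
  shows "smooth f \<Longrightarrow> smooth (\<lambda>x. integral {0..1} (\<lambda>s::real. s ^ m *\<^sub>R f (s *\<^sub>R x)))"
  by (simp add: smooth_def Ck_integral_dilate)

lemma partial_deriv_integral_dilate:
  fixes f :: "'a::euclidean_space \<Rightarrow> 'b::banach"
  assumes "smooth f"
  shows "partial_deriv i (\<lambda>x. integral {0..1} (\<lambda>s::real. s ^ m *\<^sub>R f (s *\<^sub>R x))) x
    = integral {0..1} (\<lambda>s::real. s ^ Suc m *\<^sub>R partial_deriv i f (s *\<^sub>R x))"
  unfolding partial_deriv_def[of i f]
  by (rule partial_deriv_eq[OF Ck_integral_dilate(2)]) (rule smooth_Ck[OF assms])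

lemma partial_deriv_const [simp]: "partial_deriv i (\<lambda>x. c) x = 0"
  by (simp add: partial_deriv_def)

lemma partial_deriv_add:
  "smooth f \<Longrightarrow> smooth g \<Longrightarrow> partial_deriv i (\<lambda>x. f x + g x) x = partial_deriv i f x + partial_deriv i g x"
  using partial_deriv_eq[OF has_derivative_add[OF smooth_has_derivative smooth_has_derivative]]
  by (simp add: partial_deriv_def)

lemma partial_deriv_bounded_linear:
  "bounded_linear L \<Longrightarrow> smooth f \<Longrightarrow> partial_deriv i (\<lambda>x. L (f x)) x = L (partial_deriv i f x)"
  using partial_deriv_eq[OF bounded_linear.has_derivative[OF _ smooth_has_derivative]]
  by (simp add: partial_deriv_def)

lemma partial_deriv_of_real:
  "smooth f \<Longrightarrow> partial_deriv i (\<lambda>x. of_real (f x) :: 'b::real_normed_algebra_1) x = of_real (partial_deriv i f x)"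
  by (rule partial_deriv_bounded_linear[OF bounded_linear_of_real])

lemma partial_deriv_cnj:
  "smooth f \<Longrightarrow> partial_deriv i (\<lambda>x. cnj (f x)) x = cnj (partial_deriv i f x)"
  by (rule partial_deriv_bounded_linear[OF bounded_linear_cnj])

lemma partial_deriv_mult:
  fixes f g :: "'a::euclidean_space \<Rightarrow> 'b::real_normed_algebra"
  shows "smooth f \<Longrightarrow> smooth g \<Longrightarrow>
    partial_deriv i (\<lambda>x. f x * g x) x = f x * partial_deriv i g x + partial_deriv i f x * g x"
  using partial_deriv_eq[OF has_derivative_mult[OF smooth_has_derivative smooth_has_derivative]]
  by (simp add: partial_deriv_def)

lemma frechet_derivative_partial_deriv:
  assumes "smooth f"
  shows "frechet_derivative f (at x) v = (\<Sum>i\<in>Basis. (v \<bullet> i) *\<^sub>R partial_deriv i f x)"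
proof -
  have l: "linear (frechet_derivative f (at x))"
    by (rule linear_frechet_derivative[OF smooth_differentiable[OF assms]])
  have "frechet_derivative f (at x) v = frechet_derivative f (at x) (\<Sum>i\<in>Basis. (v \<bullet> i) *\<^sub>R i)"
    by (simp add: euclidean_representation)
  also have "\<dots> = (\<Sum>i\<in>Basis. (v \<bullet> i) *\<^sub>R partial_deriv i f x)"
    by (simp add: linear_sum[OF l] linear_scale[OF l] partial_deriv_def)
  finally show ?thesis .
qed

section \<open>Square integrable functions\<close>

definition L2_norm :: "'a measure \<Rightarrow> ('a \<Rightarrow> complex) \<Rightarrow> real" where
  "L2_norm M u = sqrt (LINT x|M. (cmod (u x))\<^sup>2)"

definition L2_lim :: "'a measure \<Rightarrow> (nat \<Rightarrow> 'a \<Rightarrow> complex) \<Rightarrow> ('a \<Rightarrow> complex) \<Rightarrow> bool" where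
  "L2_lim M U u \<longleftrightarrow> (\<lambda>k. L2_norm M (\<lambda>x. U k x - u x)) \<longlonglongrightarrow> 0"

lemma L2_norm_sq: "(L2_norm M u)\<^sup>2 = (LINT x|M. (cmod (u x))\<^sup>2)"
  by (simp add: L2_norm_def)

lemma L2_norm_nonneg [simp]: "0 \<le> L2_norm M u"
  by (simp add: L2_norm_def)

lemma L2_lim_iff: "L2_lim M U u \<longleftrightarrow> (\<lambda>k. LINT x|M. (cmod (U k x - u x))\<^sup>2) \<longlonglongrightarrow> 0"
proof
  assume "L2_lim M U u"
  then have "(\<lambda>k. (L2_norm M (\<lambda>x. U k x - u x))\<^sup>2) \<longlonglongrightarrow> 0\<^sup>2"
    unfolding L2_lim_def by (rule tendsto_power)
  then show "(\<lambda>k. LINT x|M. (cmod (U k x - u x))\<^sup>2) \<longlonglongrightarrow> 0" by (simp add: L2_norm_sq)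
next
  assume "(\<lambda>k. LINT x|M. (cmod (U k x - u x))\<^sup>2) \<longlonglongrightarrow> 0"
  from tendsto_real_sqrt[OF this] show "L2_lim M U u" by (simp add: L2_lim_def L2_norm_def)
qed

lemma square_integrable_borel: "square_integrable M u \<Longrightarrow> u \<in> borel_measurable M"
  by (simp add: square_integrable_def)

lemma integrable_dominated:
  fixes f :: "'a \<Rightarrow> 'b::{banach, second_countable_topology}"
  assumes "integrable M g" "f \<in> borel_measurable M" "\<And>x. x \<in> space M \<Longrightarrow> norm (f x) \<le> (g x :: real)"
  shows "integrable M f"
  using assms(1,2)
  by (rule Bochner_Integration.integrable_bound) (rule AE_I2, use assms(3) in fastforce)

lemma square_integrable_mult_bounded:
  assumes u: "square_integrable M u" and g: "g \<in> borel_measurable M" "\<And>x. x \<in> space M \<Longrightarrow> cmod (g x) \<le> C"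
  shows "square_integrable M (\<lambda>x. g x * u x)"
    and "L2_norm M (\<lambda>x. g x * u x) \<le> \<bar>C\<bar> * L2_norm M u"
proof -
  note [measurable] = square_integrable_borel[OF u] g(1)
  have le: "(cmod (g x * u x))\<^sup>2 \<le> C\<^sup>2 * (cmod (u x))\<^sup>2" if "x \<in> space M" for x
    using g(2)[OF that] by (simp add: norm_mult power_mult_distrib mult_right_mono power_mono)
  have int: "integrable M (\<lambda>x. C\<^sup>2 * (cmod (u x))\<^sup>2)"
    using u by (simp add: square_integrable_def)
  have i: "integrable M (\<lambda>x. (cmod (g x * u x))\<^sup>2)"
    by (rule integrable_dominated[OF int]) (use le in auto)
  then show "square_integrable M (\<lambda>x. g x * u x)" by (simp add: square_integrable_def)
  have "(LINT x|M. (cmod (g x * u x))\<^sup>2) \<le> (LINT x|M. C\<^sup>2 * (cmod (u x))\<^sup>2)"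
    by (rule integral_mono[OF i int le])
  then have "(L2_norm M (\<lambda>x. g x * u x))\<^sup>2 \<le> (\<bar>C\<bar> * L2_norm M u)\<^sup>2"
    by (simp add: L2_norm_sq power_mult_distrib)
  then show "L2_norm M (\<lambda>x. g x * u x) \<le> \<bar>C\<bar> * L2_norm M u"
    by (rule power2_le_imp_le) simp
qed

lemma square_integrable_cmult: "square_integrable M u \<Longrightarrow> square_integrable M (\<lambda>x. c * u x)"
  by (rule square_integrable_mult_bounded(1)[where C = "cmod c"]) auto

lemma square_integrable_cnj: "square_integrable M u \<Longrightarrow> square_integrable M (\<lambda>x. cnj (u x))"
  using borel_measurable_continuous_onI[OF continuous_on_cnj[OF continuous_on_id]]
  by (auto simp: square_integrable_def intro: measurable_compose)

lemma square_integrable_0: "square_integrable M (\<lambda>x. 0)"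
  by (simp add: square_integrable_def)

lemma square_integrable_add:
  assumes "square_integrable M u" "square_integrable M v"
  shows "square_integrable M (\<lambda>x. u x + v x)"
proof -
  note [measurable] = assms[THEN square_integrable_borel]
  have int: "integrable M (\<lambda>x. 2 * (cmod (u x))\<^sup>2 + 2 * (cmod (v x))\<^sup>2)"
    using assms by (simp add: square_integrable_def)
  have "(cmod (u x + v x))\<^sup>2 \<le> 2 * (cmod (u x))\<^sup>2 + 2 * (cmod (v x))\<^sup>2" for x
  proof -
    have "(cmod (u x + v x))\<^sup>2 \<le> (cmod (u x) + cmod (v x))\<^sup>2"
      by (simp add: norm_triangle_ineq power_mono)
    also have "\<dots> \<le> 2 * (cmod (u x))\<^sup>2 + 2 * (cmod (v x))\<^sup>2"
      using sum_squares_bound[of "cmod (u x)" "cmod (v x)"] by (simp add: power2_sum)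
    finally show ?thesis .
  qed
  then have "integrable M (\<lambda>x. (cmod (u x + v x))\<^sup>2)"
    by (intro integrable_dominated[OF int]) auto
  then show ?thesis by (simp add: square_integrable_def)
qed

lemma square_integrable_diff:
  "square_integrable M u \<Longrightarrow> square_integrable M v \<Longrightarrow> square_integrable M (\<lambda>x. u x - v x)"
  using square_integrable_add[OF _ square_integrable_cmult[of M v "-1"], of u] by simp

lemma square_integrable_imp_integrable:
  assumes "square_integrable M u" "square_integrable M v"
  shows "integrable M (\<lambda>x. u x * v x)" and "integrable M (\<lambda>x. cmod (u x) * cmod (v x))"
proof -
  note [measurable] = assms[THEN square_integrable_borel]
  have int: "integrable M (\<lambda>x. (cmod (u x))\<^sup>2 + (cmod (v x))\<^sup>2)"
    using assms by (simp add: square_integrable_def)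
  have le: "cmod (u x) * cmod (v x) \<le> (cmod (u x))\<^sup>2 + (cmod (v x))\<^sup>2" for x
  proof -
    have "0 \<le> cmod (u x) * cmod (v x)" by simp
    with sum_squares_bound[of "cmod (u x)" "cmod (v x)"] show ?thesis by linarith
  qed
  show "integrable M (\<lambda>x. u x * v x)" 
    by (rule integrable_dominated[OF int]) (use le in \<open>auto simp: norm_mult\<close>)
  show "integrable M (\<lambda>x. cmod (u x) * cmod (v x))" 
    by (rule integrable_dominated[OF int]) (use le in \<open>auto simp: norm_mult\<close>)
qed

text \<open>The optimal choice is t = b / a, which makes no sense when \<open>a\<close> or
  \<open>b\<close> vanishes. Both are therefore enlarged by a small \<open>d\<close>, and the
  resulting error is at most \<open>e\<close>.\<close>

lemma Cauchy_Schwarz_from_scaling: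
  fixes a b c :: real
  assumes "a \<ge> 0" "b \<ge> 0" "\<And>t. t > 0 \<Longrightarrow> 2 * c \<le> t * a\<^sup>2 + b\<^sup>2 / t"
  shows "c \<le> a * b"
proof (rule field_le_epsilon)
  fix e :: real assume e: "e > 0"
  \<comment> \<open>With this value \<open>d \<le> e\<close>, hence d (a + b + d) is at most 2 d (a
    + b + e + 1) = e.\<close>
  define d where "d = e / (2 * (a + b + e + 1))"
  have S: "a + b + e + 1 > 0" using assms e by simp
  have d: "d > 0" using S e by (simp add: d_def)
  have "d * (2 * (a + b + e + 1)) = e" using S by (simp add: d_def)
  moreover have "d * 1 \<le> d * (2 * (a + b + e + 1))"
    by (rule mult_left_mono) (use d assms(1,2) e in auto)
  ultimately have d2: "d \<le> e" by simp
  define a' b' where "a' = a + d" and "b' = b + d"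
  have pos: "a' > 0" "b' > 0" using assms d by (auto simp: a'_def b'_def)
  have "2 * c \<le> (b' / a') * a\<^sup>2 + b\<^sup>2 / (b' / a')" using assms(3)[of "b'/a'"] pos by simp
  also have "\<dots> \<le> (b' / a') * a'\<^sup>2 + b'\<^sup>2 / (b' / a')"
    using assms(1,2) pos d by (intro add_mono mult_left_mono divide_right_mono power_mono)
      (auto simp: a'_def b'_def)
  also have "\<dots> = 2 * (a' * b')" using pos by (simp add: field_simps power2_eq_square)
  finally have "c \<le> (a + d) * (b + d)" by (simp add: a'_def b'_def)
  also have "\<dots> = a * b + d * (a + b + d)" by (simp add: algebra_simps)
  also have "d * (a + b + d) \<le> d * (2 * (a + b + e + 1))"
    using d d2 assms(1,2) e by (intro mult_left_mono) auto
  also have "\<dots> = e" using S by (simp add: d_def)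
  finally show "c \<le> a * b + e" by simp
qed

text \<open>Integrate 2 |u| |v| <= t |u|^2 + |v|^2 / t, which is a square divided by t, and optimise
  over t > 0 on the level of the norms.\<close>

lemma L2_Cauchy_Schwarz:
  assumes "square_integrable M u" "square_integrable M v"
  shows "(LINT x|M. cmod (u x) * cmod (v x)) \<le> L2_norm M u * L2_norm M v"
    and "cmod (LINT x|M. u x * v x) \<le> L2_norm M u * L2_norm M v"
proof -
  note int = square_integrable_imp_integrable[OF assms]
  show *: "(LINT x|M. cmod (u x) * cmod (v x)) \<le> L2_norm M u * L2_norm M v"
  proof (rule Cauchy_Schwarz_from_scaling)
    fix t :: real assume t: "t > 0"
    have "2 * (LINT x|M. cmod (u x) * cmod (v x)) = (LINT x|M. 2 * (cmod (u x) * cmod (v x)))" by simp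
    also have "\<dots> \<le> (LINT x|M. t * (cmod (u x))\<^sup>2 + (cmod (v x))\<^sup>2 / t)"
    proof (rule integral_mono)
      show "2 * (cmod (u x) * cmod (v x)) \<le> t * (cmod (u x))\<^sup>2 + (cmod (v x))\<^sup>2 / t" for x
      proof -
        have "0 \<le> (t * cmod (u x) - cmod (v x))\<^sup>2 / t" using t by simp
        also have "\<dots> = t * (cmod (u x))\<^sup>2 + (cmod (v x))\<^sup>2 / t - 2 * (cmod (u x) * cmod (v x))"
          using t by (simp add: field_simps power2_eq_square)
        finally show ?thesis by simp
      qed
    qed (use int assms in \<open>auto simp: square_integrable_def\<close>)
    also have "\<dots> = t * (L2_norm M u)\<^sup>2 + (L2_norm M v)\<^sup>2 / t"
      using assms by (simp add: L2_norm_sq square_integrable_def)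
    finally show "2 * (LINT x|M. cmod (u x) * cmod (v x)) \<le> t * (L2_norm M u)\<^sup>2 + (L2_norm M v)\<^sup>2 / t" .
  qed simp_all
  have "cmod (LINT x|M. u x * v x) \<le> (LINT x|M. cmod (u x * v x))"
    by simp
  with * show "cmod (LINT x|M. u x * v x) \<le> L2_norm M u * L2_norm M v" by (simp add: norm_mult)
qed

lemma L2_norm_mult: "L2_norm M (\<lambda>x. c * u x) = cmod c * L2_norm M u"
  by (simp add: L2_norm_def norm_mult power_mult_distrib real_sqrt_mult)

lemma L2_norm_minus_commute: "L2_norm M (\<lambda>x. u x - v x) = L2_norm M (\<lambda>x. v x - u x)"
  by (simp add: L2_norm_def norm_minus_commute)

lemma L2_norm_cnj: "L2_norm M (\<lambda>x. cnj (u x)) = L2_norm M u"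
  by (simp add: L2_norm_def)

lemma L2_norm_triangle:
  assumes "square_integrable M u" "square_integrable M v"
  shows "L2_norm M (\<lambda>x. u x + v x) \<le> L2_norm M u + L2_norm M v"
proof (rule power2_le_imp_le)
  note int = square_integrable_imp_integrable[OF assms]
  have "(L2_norm M (\<lambda>x. u x + v x))\<^sup>2 \<le> (LINT x|M. (cmod (u x))\<^sup>2 + (cmod (v x))\<^sup>2 + 2 * (cmod (u x) * cmod (v x)))"
    unfolding L2_norm_sq
  proof (rule integral_mono)
    show "integrable M (\<lambda>x. (cmod (u x + v x))\<^sup>2)"
      using square_integrable_add[OF assms] by (simp add: square_integrable_def)
    show "(cmod (u x + v x))\<^sup>2 \<le> (cmod (u x))\<^sup>2 + (cmod (v x))\<^sup>2 + 2 * (cmod (u x) * cmod (v x))" for x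
      using power_mono[OF norm_triangle_ineq[of "u x" "v x"], of 2] by (simp add: power2_sum)
  qed (use int assms in \<open>auto simp: square_integrable_def\<close>)
  also have "\<dots> = (L2_norm M u)\<^sup>2 + (L2_norm M v)\<^sup>2 + 2 * (LINT x|M. cmod (u x) * cmod (v x))"
    using int assms by (simp add: L2_norm_sq square_integrable_def)
  also have "\<dots> \<le> (L2_norm M u + L2_norm M v)\<^sup>2"
    using L2_Cauchy_Schwarz(1)[OF assms] by (simp add: power2_sum)
  finally show "(L2_norm M (\<lambda>x. u x + v x))\<^sup>2 \<le> (L2_norm M u + L2_norm M v)\<^sup>2" .
qed simp

lemma L2_norm_triangle_diff:
  assumes "square_integrable M u" "square_integrable M v" "square_integrable M w"
  shows "L2_norm M (\<lambda>x. u x - w x) \<le> L2_norm M (\<lambda>x. u x - v x) + L2_norm M (\<lambda>x. v x - w x)"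
  using L2_norm_triangle[of M "\<lambda>x. u x - v x" "\<lambda>x. v x - w x"] assms square_integrable_diff
  by fastforce

lemma L2_norm_le_add:
  assumes "square_integrable M u" "square_integrable M v"
  shows "L2_norm M u \<le> L2_norm M (\<lambda>x. u x - v x) + L2_norm M v"
  using L2_norm_triangle_diff[OF assms square_integrable_0] by simp

lemma L2_limI:
  assumes "\<And>k. L2_norm M (\<lambda>x. U k x - u x) \<le> e k" "e \<longlonglongrightarrow> 0"
  shows "L2_lim M U u"
  unfolding L2_lim_def by (rule tendsto_sandwich[OF _ _ tendsto_const assms(2)]) (use assms(1) in auto)

lemma L2_lim_const: "L2_lim M (\<lambda>_. u) u"
  by (simp add: L2_lim_def L2_norm_def)

lemma L2_lim_mult_bounded:
  assumes "L2_lim M U u" "\<And>k. square_integrable M (U k)" "square_integrable M u" 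
    "g \<in> borel_measurable M" "\<And>x. x \<in> space M \<Longrightarrow> cmod (g x) \<le> C"
  shows "L2_lim M (\<lambda>k x. g x * U k x) (\<lambda>x. g x * u x)"
proof (rule L2_limI)
  show "L2_norm M (\<lambda>x. g x * U k x - g x * u x) \<le> \<bar>C\<bar> * L2_norm M (\<lambda>x. U k x - u x)" for k
    using square_integrable_mult_bounded(2)[OF square_integrable_diff[OF assms(2)[of k] assms(3)] assms(4,5)]
    by (simp add: right_diff_distrib)
  show "(\<lambda>k. \<bar>C\<bar> * L2_norm M (\<lambda>x. U k x - u x)) \<longlonglongrightarrow> 0"
    using assms(1) by (intro tendsto_mult_right_zero) (simp add: L2_lim_def)
qed

lemma L2_lim_cmult: "L2_lim M U u \<Longrightarrow> L2_lim M (\<lambda>k x. c * U k x) (\<lambda>x. c * u x)"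
  using L2_norm_mult[of M c] by (auto simp: L2_lim_def intro: tendsto_mult_right_zero simp flip: right_diff_distrib)

lemma L2_lim_cnj: "L2_lim M U u \<Longrightarrow> L2_lim M (\<lambda>k x. cnj (U k x)) (\<lambda>x. cnj (u x))"
  by (simp add: L2_lim_def L2_norm_cnj flip: complex_cnj_diff)

lemma L2_lim_add:
  assumes "L2_lim M U u" "\<And>k. square_integrable M (U k)" "square_integrable M u"
    and "L2_lim M V v" "\<And>k. square_integrable M (V k)" "square_integrable M v"
  shows "L2_lim M (\<lambda>k x. U k x + V k x) (\<lambda>x. u x + v x)"
proof (rule L2_limI)
  show "L2_norm M (\<lambda>x. U k x + V k x - (u x + v x))
      \<le> L2_norm M (\<lambda>x. U k x - u x) + L2_norm M (\<lambda>x. V k x - v x)" for k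
    using L2_norm_triangle[OF square_integrable_diff[OF assms(2,3), of k] square_integrable_diff[OF assms(5,6), of k]]
    by (simp add: algebra_simps)
  show "(\<lambda>k. L2_norm M (\<lambda>x. U k x - u x) + L2_norm M (\<lambda>x. V k x - v x)) \<longlonglongrightarrow> 0"
    using tendsto_add[OF assms(1)[unfolded L2_lim_def] assms(4)[unfolded L2_lim_def]] by simp
qed

lemma L2_lim_norm:
  assumes "L2_lim M U u" "\<And>k. square_integrable M (U k)" "square_integrable M u"
  shows "(\<lambda>k. L2_norm M (U k)) \<longlonglongrightarrow> L2_norm M u"
proof -
  have "\<bar>L2_norm M (U k) - L2_norm M u\<bar> \<le> L2_norm M (\<lambda>x. U k x - u x)" for k
    using L2_norm_le_add[OF assms(2,3), of k] L2_norm_le_add[OF assms(3) assms(2), of k]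
    by (simp add: L2_norm_minus_commute[of M u])
  then have "(\<lambda>k. L2_norm M (U k) - L2_norm M u) \<longlonglongrightarrow> 0"
    by (intro Lim_null_comparison[OF _ assms(1)[unfolded L2_lim_def]]) simp
  then show ?thesis by (rule LIM_zero_cancel)
qed

lemma L2_lim_integral_mult:
  assumes "L2_lim M U u" "\<And>k. square_integrable M (U k)" "square_integrable M u"
    and "L2_lim M V v" "\<And>k. square_integrable M (V k)" "square_integrable M v"
  shows "(\<lambda>k. LINT x|M. U k x * V k x) \<longlonglongrightarrow> (LINT x|M. u x * v x)"
proof -
  have "norm ((LINT x|M. U k x * V k x) - (LINT x|M. u x * v x))
     \<le> L2_norm M (\<lambda>x. U k x - u x) * L2_norm M (V k) + L2_norm M u * L2_norm M (\<lambda>x. V k x - v x)" for k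
  proof -
    have "(LINT x|M. U k x * V k x) - (LINT x|M. u x * v x) = (LINT x|M. U k x * V k x - u x * v x)"
      using assms by (simp add: square_integrable_imp_integrable)
    also have "\<dots> = (LINT x|M. (U k x - u x) * V k x + u x * (V k x - v x))"
      by (simp add: algebra_simps)
    also have "\<dots> = (LINT x|M. (U k x - u x) * V k x) + (LINT x|M. u x * (V k x - v x))"
      using assms by (intro Bochner_Integration.integral_add square_integrable_imp_integrable square_integrable_diff)
    finally show ?thesis
      using L2_Cauchy_Schwarz(2)[OF square_integrable_diff[OF assms(2,3), of k] assms(5)[of k]]
        L2_Cauchy_Schwarz(2)[OF assms(3) square_integrable_diff[OF assms(5,6), of k]]
      by (smt (verit) norm_triangle_ineq)
  qed
  then have le: "\<forall>\<^sub>F k in sequentially. norm ((LINT x|M. U k x * V k x) - (LINT x|M. u x * v x))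
     \<le> L2_norm M (\<lambda>x. U k x - u x) * L2_norm M (V k) + L2_norm M u * L2_norm M (\<lambda>x. V k x - v x)"
    by simp
  have "(\<lambda>k. L2_norm M (\<lambda>x. U k x - u x) * L2_norm M (V k) + L2_norm M u * L2_norm M (\<lambda>x. V k x - v x)) \<longlonglongrightarrow> 0"
    using tendsto_add[OF tendsto_mult[OF assms(1)[unfolded L2_lim_def] L2_lim_norm[OF assms(4-6)]]
      tendsto_mult[OF tendsto_const[of "L2_norm M u"] assms(4)[unfolded L2_lim_def]]] by simp
  from Lim_null_comparison[OF le this] show ?thesis by (rule LIM_zero_cancel)
qed

section \<open>Completeness of L^2\<close>

lemma L2_norm_cong_AE:
  assumes "AE x in M. u x = v x" "u \<in> borel_measurable M" "v \<in> borel_measurable M"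
  shows "L2_norm M u = L2_norm M v"
  unfolding L2_norm_def using assms by (intro arg_cong[where f = sqrt] integral_cong_AE) auto

text \<open>Riesz--Fischer. The inequality $a \le 2^{-n} + 2^n a^2$ gives pointwise summability of the
  increments without a finiteness assumption on the measure.\<close>

lemma L2_complete:
  assumes si: "\<And>k. square_integrable M (U k)"
    and Cauchy: "\<And>e. e > 0 \<Longrightarrow> \<exists>N. \<forall>m\<ge>N. \<forall>n\<ge>N. L2_norm M (\<lambda>x. U m x - U n x) < e"
  shows "\<exists>u. square_integrable M u \<and> L2_lim M U u"
proof -
  note [measurable] = si[THEN square_integrable_borel]
  have "\<forall>n. \<exists>N. \<forall>m\<ge>N. \<forall>k\<ge>N. L2_norm M (\<lambda>x. U m x - U k x) < (1/2) ^ n"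
    using Cauchy by simp
  then obtain N where N: "\<And>n m k. m \<ge> N n \<Longrightarrow> k \<ge> N n \<Longrightarrow> L2_norm M (\<lambda>x. U m x - U k x) < (1/2) ^ n"
    by metis
  \<comment> \<open>The sum is a monotone majorant of \<open>N\<close>, so \<open>r n\<close> and
    \<open>r (Suc n)\<close> both lie beyond \<open>N n\<close>; the summand \<open>n\<close> makes
    the subsequence indices unbounded.\<close>
  define r where "r n = (\<Sum>i\<le>n. N i) + n" for n
  have "N n \<le> (\<Sum>i\<le>m. N i)" if "n \<le> m" for m n
    using that by (intro member_le_sum) auto
  then have r: "r n \<ge> N n" "r n \<ge> n" "r (Suc n) \<ge> N n" for n
    unfolding r_def by (meson order_refl trans_le_add1 le_add2 le_SucI)+
  define u where "u x = lim (\<lambda>n. U (r n) x)" for x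
  have [measurable]: "u \<in> borel_measurable M" unfolding u_def by measurable
  define a where "a n x = cmod (U (r (Suc n)) x - U (r n) x)" for n x
  have [measurable]: "a n \<in> borel_measurable M" for n unfolding a_def by measurable
  have nn: "(\<integral>\<^sup>+x. ennreal ((cmod (v x))\<^sup>2) \<partial>M) = ennreal ((L2_norm M v)\<^sup>2)" if "square_integrable M v" for v
    using that by (subst nn_integral_eq_integral) (auto simp: L2_norm_sq square_integrable_def)
  have "(\<integral>\<^sup>+x. (\<Sum>n. ennreal (2 ^ n * (a n x)\<^sup>2)) \<partial>M) = (\<Sum>n. \<integral>\<^sup>+x. ennreal (2 ^ n * (a n x)\<^sup>2) \<partial>M)"
    by (rule nn_integral_suminf) measurable
  also have "\<dots> \<le> (\<Sum>n. ennreal ((1/2) ^ n))"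
  proof (intro suminf_le allI)
    fix n
    have "(\<integral>\<^sup>+x. ennreal (2 ^ n * (a n x)\<^sup>2) \<partial>M) = ennreal (2 ^ n) * (\<integral>\<^sup>+x. ennreal ((a n x)\<^sup>2) \<partial>M)"
      by (subst nn_integral_cmult[symmetric]) (auto simp: ennreal_mult)
    also have "\<dots> = ennreal (2 ^ n) * ennreal ((L2_norm M (\<lambda>x. U (r (Suc n)) x - U (r n) x))\<^sup>2)"
      unfolding a_def by (subst nn) (auto intro: square_integrable_diff si)
    also have "\<dots> \<le> ennreal (2 ^ n) * ennreal (((1/2) ^ n)\<^sup>2)"
      using N[OF r(3) r(1), of n] by (intro mult_left_mono ennreal_leI power_mono) auto
    also have "\<dots> = ennreal (2 ^ n * ((1/2) ^ n)\<^sup>2)" by (subst ennreal_mult) auto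
    also have "2 ^ n * ((1/2::real) ^ n)\<^sup>2 = (1/2) ^ n"
      by (simp add: power2_eq_square field_simps)
    finally show "(\<integral>\<^sup>+x. ennreal (2 ^ n * (a n x)\<^sup>2) \<partial>M) \<le> ennreal ((1/2) ^ n)" .
  qed auto
  also have "\<dots> = ennreal (\<Sum>n. (1/2) ^ n)"
    by (rule suminf_ennreal2) (auto simp: summable_geometric)
  also have "\<dots> < \<infinity>" by simp
  finally have "(\<integral>\<^sup>+x. (\<Sum>n. ennreal (2 ^ n * (a n x)\<^sup>2)) \<partial>M) \<noteq> \<infinity>" by simp
  then have "AE x in M. (\<Sum>n. ennreal (2 ^ n * (a n x)\<^sup>2)) \<noteq> \<infinity>"
    by (intro nn_integral_PInf_AE) auto
  then have conv: "AE x in M. (\<lambda>n. U (r n) x) \<longlonglongrightarrow> u x"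
  proof eventually_elim
    case (elim x)
    have "summable (\<lambda>n. 2 ^ n * (a n x)\<^sup>2)"
      using elim by (intro summable_suminf_not_top) auto
    then have "summable (\<lambda>n. (1/2) ^ n + 2 ^ n * (a n x)\<^sup>2)"
      by (intro summable_add) (auto simp: summable_geometric)
    moreover have "norm (norm (U (r (Suc n)) x - U (r n) x)) \<le> (1/2) ^ n + 2 ^ n * (a n x)\<^sup>2" for n
    proof (cases "a n x \<le> (1/2) ^ n")
      case True
      then show ?thesis by (simp add: a_def add_increasing2)
    next
      case False
      then have "1 \<le> 2 ^ n * a n x" by (simp add: field_simps)
      then have "1 * a n x \<le> (2 ^ n * a n x) * a n x"
        by (rule mult_right_mono) (simp add: a_def)
      then show ?thesis by (simp add: a_def power2_eq_square mult.assoc add_increasing)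
    qed
    ultimately have "summable (\<lambda>n. norm (U (r (Suc n)) x - U (r n) x))"
      by (rule summable_comparison_test'[where N = 0])
    then have "summable (\<lambda>n. U (r (Suc n)) x - U (r n) x)" by (rule summable_norm_cancel)
    then have "convergent (\<lambda>n. U (r n) x)"
      using convergent_add[OF _ convergent_const[of "U (r 0) x"], of "\<lambda>n. U (r n) x - U (r 0) x"]
      by (simp add: summable_iff_convergent sum_lessThan_telescope[of "\<lambda>n. U (r n) x"])
    then show ?case by (simp add: u_def convergent_LIMSEQ_iff)
  qed
  \<comment> \<open>Fatou's lemma along the subsequence turns the Cauchy estimate for
    \<open>U k\<close> and \<open>U (r m)\<close> into an estimate for \<open>U k\<close> and the
    limit.\<close>
  have bound: "(\<integral>\<^sup>+x. ennreal ((cmod (U k x - u x))\<^sup>2) \<partial>M) \<le> ennreal (((1/2)^n)\<^sup>2)" if "k \<ge> N n" for k n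
  proof -
    have "(\<integral>\<^sup>+x. ennreal ((cmod (U k x - u x))\<^sup>2) \<partial>M)
       = (\<integral>\<^sup>+x. liminf (\<lambda>m. ennreal ((cmod (U k x - U (r m) x))\<^sup>2)) \<partial>M)"
      using conv
    proof (intro nn_integral_cong_AE, eventually_elim)
      case (elim x)
      have "(\<lambda>m. ennreal ((cmod (U k x - U (r m) x))\<^sup>2)) \<longlonglongrightarrow> ennreal ((cmod (U k x - u x))\<^sup>2)"
        by (intro tendsto_intros tendsto_ennrealI elim)
      from lim_imp_Liminf[OF trivial_limit_sequentially this] show ?case by (rule sym)
    qed
    also have "\<dots> \<le> liminf (\<lambda>m. \<integral>\<^sup>+x. ennreal ((cmod (U k x - U (r m) x))\<^sup>2) \<partial>M)"
      by (rule nn_integral_liminf) measurable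
    also have "\<dots> \<le> ennreal (((1/2)^n)\<^sup>2)"
    proof (rule Liminf_le)
      show "\<forall>\<^sub>F m in sequentially. (\<integral>\<^sup>+x. ennreal ((cmod (U k x - U (r m) x))\<^sup>2) \<partial>M) \<le> ennreal (((1/2)^n)\<^sup>2)"
        using eventually_ge_at_top[of "N n"]
      proof eventually_elim
        case (elim m)
        then have "L2_norm M (\<lambda>x. U k x - U (r m) x) < (1/2) ^ n"
          using r(2)[of m] that by (intro N) auto
        then show ?case by (subst nn) (auto intro: square_integrable_diff si power_mono ennreal_leI)
      qed
    qed auto
    finally show ?thesis .
  qed
  have d: "square_integrable M (\<lambda>x. U k x - u x)" if "k \<ge> N n" for k n
    unfolding square_integrable_def
  proof
    show "integrable M (\<lambda>x. (cmod (U k x - u x))\<^sup>2)"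
    proof (rule integrableI_bounded)
      have "(\<integral>\<^sup>+x. ennreal ((cmod (U k x - u x))\<^sup>2) \<partial>M) < \<infinity>"
        using bound[OF that] by (rule order.strict_trans1) simp
      then show "(\<integral>\<^sup>+x. ennreal (norm ((cmod (U k x - u x))\<^sup>2)) \<partial>M) < \<infinity>" by simp
    qed measurable
  qed measurable
  \<comment> \<open>So far only differences \<open>U k - u\<close> are known to be square
    integrable; \<open>u\<close> is recovered from one of them.\<close>
  have "square_integrable M (\<lambda>x. U (N 0) x - (U (N 0) x - u x))"
    by (intro square_integrable_diff si d) auto
  then have si_u: "square_integrable M u" by simp
  have "L2_norm M (\<lambda>x. U k x - u x) \<le> (1/2) ^ n" if "k \<ge> N n" for k n
  proof -
    have "ennreal ((L2_norm M (\<lambda>x. U k x - u x))\<^sup>2) \<le> ennreal (((1/2)^n)\<^sup>2)"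
      using bound[OF that] by (subst (asm) nn[OF d[OF that]])
    then have "(L2_norm M (\<lambda>x. U k x - u x))\<^sup>2 \<le> ((1/2)^n)\<^sup>2" by (simp add: ennreal_le_iff)
    then show ?thesis by (rule power2_le_imp_le) simp
  qed
  moreover have "\<exists>n. (1/2::real) ^ n < e" if "e > 0" for e using that real_arch_pow_inv[of e "1/2"] by auto
  ultimately have "L2_lim M U u"
    unfolding L2_lim_def LIMSEQ_iff by simp (meson order.strict_trans1)
  with si_u show ?thesis by blast
qed

lemma L2_lim_Cauchy:
  assumes "L2_lim M U u" "\<And>k. square_integrable M (U k)" "square_integrable M u" "e > 0"
  shows "\<exists>N. \<forall>m\<ge>N. \<forall>n\<ge>N. L2_norm M (\<lambda>x. U m x - U n x) < e"
proof -
  obtain N where N: "\<And>n. n \<ge> N \<Longrightarrow> L2_norm M (\<lambda>x. U n x - u x) < e / 2"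
    using assms(1,4) unfolding L2_lim_def LIMSEQ_iff by (metis half_gt_zero L2_norm_nonneg abs_of_nonneg diff_zero real_norm_def)
  have "L2_norm M (\<lambda>x. U m x - U n x) < e" if "m \<ge> N" "n \<ge> N" for m n
    using L2_norm_triangle_diff[OF assms(2)[of m] assms(3) assms(2)[of n]] N[OF that(1)] N[OF that(2)]
    by (simp add: L2_norm_minus_commute[of M u])
  then show ?thesis by blast
qed

section \<open>The radial divergence theorem\<close>

abbreviation vol :: "'a::euclidean_space measure" where
  "vol \<equiv> lebesgue_on unit_ball"

lemma space_ball_measure [simp]: "space (vol :: 'a::euclidean_space measure) = ball 0 1"
  by (simp add: space_restrict_space)

lemma finite_ball_measure: "finite_measure (vol :: 'a::euclidean_space measure)"
  by (rule finite_measureI) (use emeasure_bounded_finite[OF bounded_ball[of "0::'a" 1]] in \<open>simp add: emeasure_restrict_space less_top\<close>)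

lemma borel_measurable_ball_measure:
  "f \<in> borel_measurable borel \<Longrightarrow> f \<in> borel_measurable (vol :: 'a::euclidean_space measure)"
  by (intro measurable_restrict_space1 measurable_completion) simp

lemma integral_ball_measure:
  fixes f :: "'a::euclidean_space \<Rightarrow> 'b::{banach, second_countable_topology}"
  assumes [measurable]: "f \<in> borel_measurable borel"
  shows "(LINT x|vol. f x) = (LINT x|lborel. indicator (ball 0 1) x *\<^sub>R f x)"
  by (subst integral_restrict_space, simp) (use assms in \<open>auto intro!: integral_completion borel_measurable_scaleR borel_measurable_indicator\<close>)

lemma integrable_ball_measure_iff:
  fixes f :: "'a::euclidean_space \<Rightarrow> 'b::{banach, second_countable_topology}"
  assumes [measurable]: "f \<in> borel_measurable borel"
  shows "integrable vol f \<longleftrightarrow> integrable lborel (\<lambda>x. indicator (ball 0 1) x *\<^sub>R f x)"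
  by (subst integrable_restrict_space, simp) (use assms in \<open>auto intro!: integrable_completion borel_measurable_scaleR borel_measurable_indicator\<close>)

lemma continuous_bounded_cball:
  fixes f :: "'a::euclidean_space \<Rightarrow> 'b::real_normed_vector"
  assumes "continuous_on UNIV f"
  obtains C where "C > 0" "\<And>x. norm x \<le> r \<Longrightarrow> norm (f x) \<le> C"
proof -
  have "compact (f ` cball 0 r)"
    by (rule compact_continuous_image[OF continuous_on_subset[OF assms]]) auto
  then obtain C where "C > 0" "\<forall>y\<in>f ` cball 0 r. norm y \<le> C"
    using compact_imp_bounded bounded_pos by blast
  then show ?thesis using that by auto
qed

lemma integrable_ball_continuous:
  fixes f :: "'a::euclidean_space \<Rightarrow> 'b::{banach, second_countable_topology}"
  assumes "continuous_on UNIV f"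
  shows "integrable vol f"
proof -
  obtain C where "\<And>x. norm x \<le> 1 \<Longrightarrow> norm (f x) \<le> C"
    using continuous_bounded_cball[OF assms] by metis
  then show ?thesis
    by (intro finite_measure.integrable_const_bound[OF finite_ball_measure, where B = C] AE_I2
        borel_measurable_ball_measure borel_measurable_continuous_onI assms) simp
qed

lemma AE_ball_measure_nonzero: "AE x in (vol :: 'a::euclidean_space measure). x \<noteq> 0"
  by (subst AE_restrict_space_iff) (auto intro!: AE_completion eventually_mono[OF AE_lborel_singleton[of 0]])

lemma scale_measure_eq_density:
  "scale_measure r M = density M (\<lambda>_. r)"
  by (rule measure_eqI) (auto simp: emeasure_density nn_integral_cmult_indicator)

lemma measurable_radial_projection [measurable]:
  "(\<lambda>x. x /\<^sub>R norm x) \<in> measurable (vol :: 'a::euclidean_space measure) borel"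
  by (rule borel_measurable_ball_measure) measurable

lemma sphere_measure_eq:
  "(sphere_measure :: 'a::euclidean_space measure) = density (distr vol borel (\<lambda>x. x /\<^sub>R norm x)) (\<lambda>_. ennreal (DIM('a)))"
  by (simp add: sphere_measure_def scale_measure_eq_density ennreal_of_nat_eq_real_of_nat)

lemma sets_sphere_measure [measurable_cong, simp]: "sets sphere_measure = sets borel"
  by (simp add: sphere_measure_def)

lemma space_sphere_measure [simp]: "space sphere_measure = UNIV"
  by (simp add: sphere_measure_def space_scale_measure)

lemma integral_sphere_measure:
  fixes f :: "'a::euclidean_space \<Rightarrow> 'b::{banach, second_countable_topology}"
  assumes [measurable]: "f \<in> borel_measurable borel"
  shows "(LINT x|sphere_measure. f x) = DIM('a) *\<^sub>R (LINT x|vol. f (x /\<^sub>R norm x))"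
  unfolding sphere_measure_eq
  by (subst integral_density) (auto simp: integral_distr)

text \<open>The radial projection sends every nonzero point to the sphere. Only the origin, a null
  set, is sent to 0.\<close>

lemma AE_sphere_measure:
  "AE x in (sphere_measure :: 'a::euclidean_space measure). norm x = 1"
  unfolding sphere_measure_eq
  by (subst AE_density, simp, subst AE_distr_iff)
     (auto intro!: eventually_mono[OF AE_ball_measure_nonzero])

lemma finite_sphere_measure: "finite_measure (sphere_measure :: 'a::euclidean_space measure)"
proof (rule finite_measureI)
  have "emeasure (distr (vol :: 'a measure) borel (\<lambda>x. x /\<^sub>R norm x)) UNIV = emeasure (vol :: 'a measure) (space vol)"
    by (subst emeasure_distr) auto
  also have "\<dots> < \<infinity>"
    using finite_measure.emeasure_finite[OF finite_ball_measure] by (simp add: less_top)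
  finally show "emeasure (sphere_measure :: 'a measure) (space sphere_measure) \<noteq> \<infinity>"
    by (simp add: sphere_measure_def space_scale_measure ennreal_mult_eq_top_iff of_nat_less_top less_top)
qed

lemma integrable_sphere_continuous:
  fixes f :: "'a::euclidean_space \<Rightarrow> 'b::{banach, second_countable_topology}"
  assumes "continuous_on UNIV f"
  shows "integrable sphere_measure f"
proof -
  obtain C where C: "\<And>x. norm x \<le> 1 \<Longrightarrow> norm (f x) \<le> C"
    using continuous_bounded_cball[OF assms] by metis
  have "AE x in sphere_measure. norm (f x) \<le> C"
    using AE_sphere_measure by eventually_elim (simp add: C)
  then show ?thesis
    by (rule finite_measure.integrable_const_bound[OF finite_sphere_measure])
       (simp add: borel_measurable_continuous_onI assms measurable_cong_sets[OF sets_sphere_measure refl])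
qed

lemma integral_lborel_scale:
  fixes f :: "'a::euclidean_space \<Rightarrow> 'b::{banach, second_countable_topology}"
  assumes [measurable]: "f \<in> borel_measurable borel" and c: "c > 0"
  shows "(LINT x|lborel. f x) = c ^ DIM('a) *\<^sub>R (LINT x|lborel. f (c *\<^sub>R x))"
    and "integrable lborel f \<longleftrightarrow> integrable lborel (\<lambda>x. f (c *\<^sub>R x))"
proof -
  have eq: "lborel = density (distr lborel borel (\<lambda>x::'a. c *\<^sub>R x)) (\<lambda>_. ennreal (c ^ DIM('a)))"
    using lborel_affine[of c "0::'a"] c by simp
  show "(LINT x|lborel. f x) = c ^ DIM('a) *\<^sub>R (LINT x|lborel. f (c *\<^sub>R x))"
    using c by (subst eq, subst integral_density) (auto simp: integral_distr)
  have "integrable lborel f \<longleftrightarrow> integrable (distr lborel borel (\<lambda>x::'a. c *\<^sub>R x)) (\<lambda>x. c ^ DIM('a) *\<^sub>R f x)"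
    using c by (subst eq, subst integrable_density) auto
  also have "\<dots> \<longleftrightarrow> integrable lborel (\<lambda>x. c ^ DIM('a) *\<^sub>R f (c *\<^sub>R x))"
    by (subst integrable_distr_eq) auto
  also have "\<dots> \<longleftrightarrow> integrable lborel (\<lambda>x. f (c *\<^sub>R x))"
    using c integrable_scaleR_right[of "inverse (c ^ DIM('a))" lborel "\<lambda>x. c ^ DIM('a) *\<^sub>R f (c *\<^sub>R x)"] by auto
  finally show "integrable lborel f \<longleftrightarrow> integrable lborel (\<lambda>x. f (c *\<^sub>R x))" .
qed

text \<open>This is r times the derivative in the direction of x / r. Without the division by r it
  is smooth at the origin too.\<close>

definition radial_deriv :: "('a::euclidean_space \<Rightarrow> 'b::real_normed_vector) \<Rightarrow> 'a \<Rightarrow> 'b" where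
  "radial_deriv f x = frechet_derivative f (at x) x"

lemma radial_deriv_eq: "smooth f \<Longrightarrow> radial_deriv f x = (\<Sum>i\<in>Basis. (x \<bullet> i) *\<^sub>R partial_deriv i f x)"
  by (simp add: radial_deriv_def frechet_derivative_partial_deriv)

lemma smooth_radial_deriv [intro]:
  assumes "smooth f" shows "smooth (radial_deriv f)"
proof -
  have "smooth (\<lambda>x. (x \<bullet> i) *\<^sub>R partial_deriv i f x)" if "i \<in> Basis" for i
    using smooth_inner_left[of i] smooth_partial_deriv[OF assms that]
    by (simp add: smooth_def Ck_bounded_bilinear[OF bounded_bilinear_scaleR])
  then have "smooth (\<lambda>x. \<Sum>i\<in>Basis. (x \<bullet> i) *\<^sub>R partial_deriv i f x)" by (rule smooth_sum)
  then show ?thesis by (simp add: radial_deriv_eq[OF assms, abs_def])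
qed

lemma radial_deriv_mult:
  fixes f g :: "'a::euclidean_space \<Rightarrow> 'b::real_normed_algebra"
  assumes "smooth f" "smooth g"
  shows "radial_deriv (\<lambda>x. f x * g x) x = f x * radial_deriv g x + radial_deriv f x * g x"
  using partial_deriv_mult[OF assms, of x x] by (simp add: radial_deriv_def partial_deriv_def)

text \<open>The surface integral of \<open>\<psi>\<close> is \<open>n\<close> times the integral of \<open>\<psi> (x / |x|)\<close> over the ball, and
  \<open>\<psi> (x / |x|) - \<psi> x\<close> is the integral of \<open>radial_deriv \<psi> (x / s) / s\<close> over \<open>|x| < s < 1\<close>.
  Exchanging the integrals and rescaling gives the divergence theorem for the field \<open>\<psi> x\<close>.\<close>

lemma radial_divergence:
  fixes \<psi> :: "'a::euclidean_space \<Rightarrow> 'b::euclidean_space"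
  assumes \<psi>: "smooth \<psi>"
  shows "(LINT x|sphere_measure. \<psi> x) = (LINT x|vol. real DIM('a) *\<^sub>R \<psi> x + radial_deriv \<psi> x)"
proof -
  define E where "E = radial_deriv \<psi>"
  have E: "smooth E" unfolding E_def by (rule smooth_radial_deriv[OF \<psi>])
  have [measurable]: "E \<in> borel_measurable borel" "\<psi> \<in> borel_measurable borel"
    by (auto intro!: borel_measurable_continuous_onI smooth_continuous_on E \<psi>)
  have [measurable]: "ball (0::'a) 1 \<in> sets borel" by simp
  define n where "n = DIM('a)"
  have n: "n > 0" by (simp add: n_def)
  \<comment> \<open>The integrand for both orders of integration: for fixed \<open>s\<close> a
    dilate of \<open>E\<close> carried by the ball of radius \<open>s\<close>, for fixed
    \<open>x\<close> the \<open>s\<close>-derivative of \<open>- \<psi> (x / s)\<close> on |x| < s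
    <= 1.\<close>
  define k :: "real \<Rightarrow> 'a \<Rightarrow> 'b" where "k s x = (if 0 < s \<and> s \<le> 1 \<and> norm x < s then inverse s *\<^sub>R E (inverse s *\<^sub>R x) else 0)" for s x
  have [measurable]: "case_prod k \<in> borel_measurable (lborel \<Otimes>\<^sub>M lborel)"
    unfolding k_def by measurable
  have scale: "(LINT x|lborel. (if norm x < s then g (inverse s *\<^sub>R x) else 0)) = s ^ n *\<^sub>R (LINT x|vol. g x)"
    "integrable vol g \<Longrightarrow> integrable lborel (\<lambda>x. (if norm x < s then g (inverse s *\<^sub>R x) else 0))"
    if [measurable]: "g \<in> borel_measurable borel" and s: "s > 0" 
    for s and g :: "'a \<Rightarrow> 'c::{banach, second_countable_topology}"
  proof -
    have eq: "(\<lambda>x. if norm (s *\<^sub>R x) < s then g (inverse s *\<^sub>R s *\<^sub>R x) else 0) = (\<lambda>x. indicator (ball 0 1) x *\<^sub>R g x)"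
      using s by (auto simp: fun_eq_iff indicator_def)
    show "(LINT x|lborel. (if norm x < s then g (inverse s *\<^sub>R x) else 0)) = s ^ n *\<^sub>R (LINT x|vol. g x)"
      by (subst integral_lborel_scale(1)[OF _ s]) (use eq in \<open>simp_all add: n_def integral_ball_measure\<close>)
    show "integrable vol g \<Longrightarrow> integrable lborel (\<lambda>x. (if norm x < s then g (inverse s *\<^sub>R x) else 0))"
      by (subst integral_lborel_scale(2)[OF _ s]) (use eq in \<open>simp_all add: integrable_ball_measure_iff\<close>)
  qed
  have intE: "integrable vol E" "integrable vol (\<lambda>x. norm (E x))"
    using integrable_ball_continuous[OF smooth_continuous_on[OF E]] by auto
  have k1: "(LINT x|lborel. k s x) = indicator {0..1} s *\<^sub>R (s ^ (n - 1) *\<^sub>R (LINT x|vol. E x))"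
    "(LINT x|lborel. norm (k s x)) = s ^ (n - 1) * indicator {0..1} s * (LINT x|vol. norm (E x))"
    "integrable lborel (k s)" if s0: "s \<noteq> 0" for s
  proof -
    consider "0 < s" "s \<le> 1" | "\<not> (0 \<le> s \<and> s \<le> 1)" using s0 by linarith
    then have "(LINT x|lborel. k s x) = indicator {0..1} s *\<^sub>R (s ^ (n - 1) *\<^sub>R (LINT x|vol. E x)) \<and>
      (LINT x|lborel. norm (k s x)) = s ^ (n - 1) * indicator {0..1} s * (LINT x|vol. norm (E x)) \<and>
      integrable lborel (k s)"
    proof cases
      case 1
      have s: "s ^ n = s * s ^ (n - 1)" using n by (simp add: power_eq_if)
      have "k s = (\<lambda>x. inverse s *\<^sub>R (if norm x < s then E (inverse s *\<^sub>R x) else 0))"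
        "(\<lambda>x. norm (k s x)) = (\<lambda>x. inverse s * (if norm x < s then norm (E (inverse s *\<^sub>R x)) else 0))"
        using 1 by (auto simp: k_def)
      moreover have "(LINT x|lborel. (if norm x < s then norm (E (inverse s *\<^sub>R x)) else 0))
          = s ^ n * (LINT x|vol. norm (E x))"
        using scale(1)[of "\<lambda>x. norm (E x)" s] 1 by simp
      ultimately show ?thesis using 1 intE by (simp add: scale s)
    next
      case 2
      then have "k s = (\<lambda>x. 0)" by (auto simp: k_def)
      with 2 show ?thesis by (auto simp: indicator_def)
    qed
    then show "(LINT x|lborel. k s x) = indicator {0..1} s *\<^sub>R (s ^ (n - 1) *\<^sub>R (LINT x|vol. E x))"
      "(LINT x|lborel. norm (k s x)) = s ^ (n - 1) * indicator {0..1} s * (LINT x|vol. norm (E x))"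
      "integrable lborel (k s)" by auto
  qed
  \<comment> \<open>At \<open>s = 0\<close> the formulas \<open>k1\<close> can fail in dimension
    one, where \<open>s ^ (n - 1)\<close> is 1 although \<open>k 0\<close> vanishes.\<close>
  have ae0: "AE s in lborel. s \<noteq> (0::real)" by (rule AE_lborel_singleton)
  have ipow: "integrable lborel (\<lambda>s::real. s ^ (n - 1) * indicator {0..1} s)"
    "(LINT s|lborel. s ^ (n - 1) * indicator {0..1::real} s) = 1 / n"
  proof -
    have "integrable lborel (\<lambda>x::real. indicator {0..1} x *\<^sub>R x ^ (n - 1))"
      by (intro borel_integrable_compact continuous_intros) auto
    then show "integrable lborel (\<lambda>s::real. s ^ (n - 1) * indicator {0..1} s)"
      by (simp add: mult.commute)
    show "(LINT s|lborel. s ^ (n - 1) * indicator {0..1::real} s) = 1 / n"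
      using integral_power[of 0 1 "n - 1"] n by simp
  qed
  have int: "integrable (lborel \<Otimes>\<^sub>M lborel) (case_prod k)"
  proof (rule lborel_pair.Fubini_integrable)
    show "integrable lborel (\<lambda>s. LINT x|lborel. norm (case_prod k (s, x)))"
    proof (subst integrable_cong_AE)
      show "AE s in lborel. (LINT x|lborel. norm (case_prod k (s, x))) = 
         s ^ (n - 1) * indicator {0..1} s * (LINT x|vol. norm (E x))"
        using ae0 by eventually_elim (simp add: k1)
      show "integrable lborel (\<lambda>s. s ^ (n - 1) * indicator {0..1} s * (LINT x|vol. norm (E x)))"
        using ipow(1) by simp
    qed measurable
    show "AE s in lborel. integrable lborel (\<lambda>x. case_prod k (s, x))"
      using ae0 by eventually_elim (simp add: k1)
  qed measurable
  have "(LINT x|lborel. LINT s|lborel. k s x) = (LINT s|lborel. LINT x|lborel. k s x)"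
    by (rule lborel_pair.Fubini_integral[OF int])
  also have "\<dots> = (LINT s|lborel. (s ^ (n - 1) * indicator {0..1} s) *\<^sub>R (LINT x|vol. E x))"
    by (rule integral_cong_AE, measurable)
       (use ae0 in \<open>eventually_elim, simp add: k1 mult.commute\<close>)
  also have "\<dots> = (1 / n) *\<^sub>R (LINT x|vol. E x)"
    using ipow by simp
  finally have A: "(LINT x|lborel. LINT s|lborel. k s x) = (1 / n) *\<^sub>R (LINT x|vol. E x)" .
  \<comment> \<open>The fundamental theorem of calculus on the interval from |x| to 1, which stays
    away from 0 because \<open>x\<close> is not the origin.\<close>
  have inner: "(LINT s|lborel. k s x) = indicator (ball 0 1) x *\<^sub>R (\<psi> (x /\<^sub>R norm x) - \<psi> x)" if x: "x \<noteq> 0" for x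
  proof (cases "norm x < 1")
    case True
    have pos: "0 < s" if "norm x \<le> s" for s using that x by (smt (verit) zero_less_norm_iff)
    have D: "((\<lambda>s. - \<psi> (inverse s *\<^sub>R x)) has_vector_derivative inverse s *\<^sub>R E (inverse s *\<^sub>R x)) (at s within {norm x..1})"
      if "norm x \<le> s" "s \<le> 1" for s
    proof -
      have l: "linear (frechet_derivative \<psi> (at (inverse s *\<^sub>R x)))"
        by (rule linear_frechet_derivative[OF smooth_differentiable[OF \<psi>]])
      have i: "((\<lambda>s. inverse s *\<^sub>R x) has_derivative (\<lambda>h. (- (inverse s * h * inverse s)) *\<^sub>R x)) (at s within {norm x..1})"
        using pos[OF that(1)] by (auto intro!: derivative_eq_intros)
      have "((\<lambda>s. \<psi> (inverse s *\<^sub>R x)) has_derivative (\<lambda>h. frechet_derivative \<psi> (at (inverse s *\<^sub>R x)) ((- (inverse s * h * inverse s)) *\<^sub>R x))) (at s within {norm x..1})"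
        by (rule has_derivative_compose[OF i smooth_has_derivative[OF \<psi>]])
      from has_derivative_minus[OF this] show ?thesis
        unfolding has_vector_derivative_def E_def radial_deriv_def
        by (simp add: linear_scale[OF l] linear_neg[OF l] mult_ac)
    qed
    have c: "continuous_on {norm x..1} (\<lambda>s. inverse s *\<^sub>R E (inverse s *\<^sub>R x))"
      using x by (intro continuous_intros continuous_on_compose2[OF smooth_continuous_on[OF E, of UNIV]]) auto
    have "(LINT s|lborel. k s x) = (LINT s|lborel. indicator {norm x..1} s *\<^sub>R (inverse s *\<^sub>R E (inverse s *\<^sub>R x)))"
    proof (rule integral_cong_AE)
      show "AE s in lborel. k s x = indicator {norm x..1} s *\<^sub>R (inverse s *\<^sub>R E (inverse s *\<^sub>R x))"
        using AE_lborel_singleton[of "norm x"]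
      proof eventually_elim
        case (elim s)
        show ?case
        proof (cases "norm x < s \<and> s \<le> 1")
          case True then show ?thesis using pos[of s] by (simp add: k_def)
        next
          case False then show ?thesis using elim by (auto simp: k_def indicator_def)
        qed
      qed
    qed measurable
    also have "\<dots> = - \<psi> (inverse 1 *\<^sub>R x) - (- \<psi> (inverse (norm x) *\<^sub>R x))"
      using True by (intro integral_FTC_atLeastAtMost D c) auto
    finally show ?thesis using True by simp
  next
    case False
    then have "k s x = 0" for s by (auto simp: k_def)
    with False show ?thesis by simp
  qed
  have "(LINT x|lborel. LINT s|lborel. k s x) = (LINT x|lborel. indicator (ball 0 1) x *\<^sub>R (\<psi> (x /\<^sub>R norm x) - \<psi> x))"
    by (rule integral_cong_AE, measurable) (use AE_lborel_singleton[of 0] in \<open>eventually_elim, simp add: inner\<close>)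
  also have "\<dots> = (LINT x|vol. \<psi> (x /\<^sub>R norm x) - \<psi> x)"
    by (rule integral_ball_measure[symmetric]) measurable
  also have "\<dots> = (LINT x|vol. \<psi> (x /\<^sub>R norm x)) - (LINT x|vol. \<psi> x)"
  proof (rule Bochner_Integration.integral_diff)
    obtain C where C: "\<And>x. norm x \<le> 1 \<Longrightarrow> norm (\<psi> x) \<le> C"
      using continuous_bounded_cball[OF smooth_continuous_on[OF \<psi>]] by metis
    have "norm (\<psi> (x /\<^sub>R norm x)) \<le> C" for x by (rule C) (simp add: field_simps)
    then show "integrable vol (\<lambda>x. \<psi> (x /\<^sub>R norm x))"
      by (intro finite_measure.integrable_const_bound[OF finite_ball_measure, where B = C] AE_I2
        borel_measurable_ball_measure) auto
  qed (auto intro: integrable_ball_continuous smooth_continuous_on \<psi>)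
  finally have "(LINT x|vol. \<psi> (x /\<^sub>R norm x)) = (LINT x|vol. \<psi> x) + (1 / n) *\<^sub>R (LINT x|vol. E x)"
    using A by (simp add: algebra_simps)
  then have "(LINT x|sphere_measure. \<psi> x) = n *\<^sub>R (LINT x|vol. \<psi> x) + (LINT x|vol. E x)"
    using n by (simp add: integral_sphere_measure n_def[symmetric] scaleR_add_right)
  also have "\<dots> = (LINT x|vol. n *\<^sub>R \<psi> x + E x)"
    by (simp add: integrable_ball_continuous smooth_continuous_on \<psi> E)
  finally show ?thesis by (simp add: n_def E_def)
qed

section \<open>Flat functions\<close>

text \<open>The extra powers of 1/t make the family closed under differentiation up to linear
  combinations, so smoothness follows by one induction for all \<open>n\<close> together.\<close>

definition flat :: "nat \<Rightarrow> real \<Rightarrow> real" where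
  "flat n t = (if t > 0 then exp (- inverse t) * inverse t ^ n else 0)"

lemma flat_nonneg: "0 \<le> flat n t"
  by (simp add: flat_def)

lemma flat_nonpos [simp]: "t \<le> 0 \<Longrightarrow> flat n t = 0"
  by (simp add: flat_def)

lemma flat_tendsto_0: "(flat n \<longlongrightarrow> 0) (at_right 0)"
proof -
  have "((\<lambda>t::real. inverse t ^ n / exp (inverse t)) \<longlongrightarrow> 0) (at_right 0)"
    by (rule filterlim_compose[OF tendsto_power_div_exp_0 filterlim_inverse_at_top_right])
  then show ?thesis
    by (rule Lim_transform_eventually)
       (auto simp: eventually_at_filter flat_def exp_minus divide_inverse mult.commute)
qed

lemma flat_has_derivative:
  "(flat n has_real_derivative (flat (n + 2) t - real n * flat (n + 1) t)) (at t)"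
proof -
  consider "t > 0" | "t < 0" | "t = 0" by linarith
  then show ?thesis
  proof cases
    case 1
    have "((\<lambda>t. exp (- inverse t) * inverse t ^ n) has_real_derivative
        exp (- inverse t) * (inverse t)\<^sup>2 * inverse t ^ n
        + exp (- inverse t) * (real n * inverse t ^ (n - 1) * - (inverse t)\<^sup>2)) (at t)"
      using 1 by (auto intro!: derivative_eq_intros simp: power2_eq_square)
    also have "exp (- inverse t) * (inverse t)\<^sup>2 * inverse t ^ n
        + exp (- inverse t) * (real n * inverse t ^ (n - 1) * - (inverse t)\<^sup>2)
      = flat (n + 2) t - real n * flat (n + 1) t"
      using 1 by (cases n) (simp_all add: flat_def power_add power2_eq_square algebra_simps)
    finally have "((\<lambda>t. exp (- inverse t) * inverse t ^ n) has_real_derivative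
        (flat (n + 2) t - real n * flat (n + 1) t)) (at t)" .
    then show ?thesis
      by (rule has_field_derivative_transform_within_open[of _ _ _ "{0<..}"]) (use 1 in \<open>auto simp: flat_def\<close>)
  next
    case 2
    have "((\<lambda>t. 0) has_real_derivative (flat (n + 2) t - real n * flat (n + 1) t)) (at t)"
      using 2 by simp
    then show ?thesis
      by (rule has_field_derivative_transform_within_open[of _ _ _ "{..<0}"]) (use 2 in \<open>auto simp: flat_def\<close>)
  next
    case 3
    \<comment> \<open>For h > 0 the difference quotient is \<open>flat (Suc n) h\<close>, to which
      \<open>flat_tendsto_0\<close> applies one index higher.\<close>
    have "((\<lambda>h. (flat n (0 + h) - flat n 0) / h) \<longlongrightarrow> 0) (at 0)"
    proof (rule filterlim_split_at)
      show "((\<lambda>h. (flat n (0 + h) - flat n 0) / h) \<longlongrightarrow> 0) (at_left 0)"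
        by (rule tendsto_eventually) (auto simp: eventually_at_filter)
      show "((\<lambda>h. (flat n (0 + h) - flat n 0) / h) \<longlongrightarrow> 0) (at_right 0)"
        by (rule Lim_transform_eventually[OF flat_tendsto_0[of "Suc n"]])
           (auto simp: eventually_at_filter flat_def divide_inverse)
    qed
    then show ?thesis by (simp add: DERIV_def 3)
  qed
qed

lemma smooth_flat: "smooth (flat n)"
proof -
  have "Ck k (flat n)" for k n
  proof (induction k arbitrary: n)
    case 0
    show ?case by (auto intro!: continuous_at_imp_continuous_on DERIV_isCont[OF flat_has_derivative])
  next
    case (Suc k)
    show ?case
    proof (rule Ck_SucI)
      show "(flat n has_derivative (\<lambda>h. (flat (n + 2) t - real n * flat (n + 1) t) * h)) (at t)" for t
        using flat_has_derivative unfolding has_field_derivative_def .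
      show "Ck k (\<lambda>t. (flat (n + 2) t - real n * flat (n + 1) t) * i)" if "i \<in> Basis" for i
        using Ck_add[OF Suc.IH[of "n + 2"] Ck_mult[OF Ck_const[of k "- real n"] Suc.IH[of "n + 1"]]] that
        by simp
    qed
  qed
  then show ?thesis by (simp add: smooth_def)
qed

text \<open>A smooth function on the line that agrees with \<open>1 / (D - t)\<close> for \<open>t \<le> 1\<close>: adding a multiple
  of a function that is flat at \<open>1\<close> removes the pole at \<open>D > 1\<close>.\<close>

definition recip_ext :: "real \<Rightarrow> real \<Rightarrow> real" where
  "recip_ext D t = inverse (D - t + (t - 1) * flat 0 (t - 1) / flat 0 ((D - 1) / 2))"

lemma recip_ext_eq: "t \<le> 1 \<Longrightarrow> recip_ext D t = inverse (D - t)"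
  by (simp add: recip_ext_def)

text \<open>Up to the midpoint of 1 and \<open>D\<close>, the term D - t is already positive and the
  correction is nonnegative. Beyond it \<open>flat 0\<close> exceeds its value at (D - 1) / 2, so
  the correction is at least t - 1 and the whole at least D - 1.\<close>

lemma recip_ext_denominator:
  assumes "D > 1"
  shows "D - t + (t - 1) * flat 0 (t - 1) / flat 0 ((D - 1) / 2) > 0"
proof -
  have pos: "flat 0 ((D - 1) / 2) > 0" using assms by (simp add: flat_def)
  show ?thesis
  proof (cases "t - 1 \<le> (D - 1) / 2")
    case True
    have "(t - 1) * flat 0 (t - 1) \<ge> 0"
      by (cases "t \<le> 1") (auto intro: mult_nonneg_nonneg flat_nonneg)
    then have "(t - 1) * flat 0 (t - 1) / flat 0 ((D - 1) / 2) \<ge> 0" using pos by simp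
    moreover have "D - t > 0" using True assms by simp
    ultimately show ?thesis by linarith
  next
    case False
    have "inverse (t - 1) \<le> inverse ((D - 1) / 2)"
      using False assms by (intro le_imp_inverse_le) auto
    then have "flat 0 ((D - 1) / 2) \<le> flat 0 (t - 1)"
      using False assms by (simp add: flat_def)
    then have "(t - 1) * 1 \<le> (t - 1) * (flat 0 (t - 1) / flat 0 ((D - 1) / 2))"
      using False assms pos by (intro mult_left_mono) auto
    then show ?thesis using assms by simp
  qed
qed

lemma smooth_recip_ext:
  assumes "D > 1" shows "smooth (recip_ext D)"
proof -
  have id: "smooth (\<lambda>t::real. t)" by (rule smooth_linear[OF bounded_linear_ident])
  have "smooth (\<lambda>t. flat 0 (t - 1))"
    by (rule smooth_compose[OF smooth_flat]) (intro smooth_diff id smooth_const)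
  then have "smooth (\<lambda>t. D - t + (t - 1) * flat 0 (t - 1) * inverse (flat 0 ((D - 1) / 2)))"
    by (intro smooth_add smooth_diff smooth_mult id smooth_const)
  from smooth_inverse[OF this] show ?thesis
    using recip_ext_denominator[OF assms] unfolding recip_ext_def[abs_def] divide_inverse
    by (metis less_irrefl)
qed

text \<open>Inside the ball the function is 1 / (D - |x|^(2k)), and its derivative contains its own
  square. The case k = 1 serves the Hardy inequality, k = a the potentials; in both the square is
  what closes the computation.\<close>

lemma has_derivative_recip_ext_norm_sq:
  assumes "D > 1" "norm x < 1" "k > 0"
  shows "((\<lambda>x :: 'a::euclidean_space. recip_ext D ((x \<bullet> x) ^ k)) has_derivative
    (\<lambda>v. (recip_ext D ((x \<bullet> x) ^ k))\<^sup>2 * (2 * real k * (x \<bullet> x) ^ (k - 1) * (x \<bullet> v)))) (at x)"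
proof -
  have lt: "(y \<bullet> y) ^ k < 1" if "norm y < 1" for y :: 'a
  proof -
    have "y \<bullet> y < 1" using that by (simp add: norm_eq_sqrt_inner)
    then show ?thesis using assms(3) by (simp add: power_less_one_iff)
  qed
  have "((\<lambda>x :: 'a. inverse (D - (x \<bullet> x) ^ k)) has_derivative
    (\<lambda>v. (inverse (D - (x \<bullet> x) ^ k))\<^sup>2 * (2 * real k * (x \<bullet> x) ^ (k - 1) * (x \<bullet> v)))) (at x)"
    using lt[OF assms(2)] assms(1)
    by (auto intro!: derivative_eq_intros simp: power2_eq_square inner_commute algebra_simps)
  then have "((\<lambda>x :: 'a. recip_ext D ((x \<bullet> x) ^ k)) has_derivative
    (\<lambda>v. (inverse (D - (x \<bullet> x) ^ k))\<^sup>2 * (2 * real k * (x \<bullet> x) ^ (k - 1) * (x \<bullet> v)))) (at x)"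
    by (rule has_derivative_transform_within_open[OF _ open_ball[of 0 1]])
       (use assms lt in \<open>auto simp: recip_ext_eq less_imp_le\<close>)
  then show ?thesis using lt[OF assms(2)] by (simp add: recip_ext_eq)
qed

lemma smooth_recip_ext_norm_sq: "D > 1 \<Longrightarrow> smooth (\<lambda>x. recip_ext D ((x \<bullet> x) ^ k))"
  by (intro smooth_compose[OF smooth_recip_ext] smooth_power smooth_norm_sq)

section \<open>Sobolev functions as limits of smooth functions\<close>

lemma smooth_borel_measurable: "smooth f \<Longrightarrow> f \<in> borel_measurable borel"
  by (intro borel_measurable_continuous_onI smooth_continuous_on)

lemma smooth_integrable_ball:
  fixes f :: "'a::euclidean_space \<Rightarrow> 'b::{banach, second_countable_topology}"
  shows "smooth f \<Longrightarrow> integrable vol f"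
  by (intro integrable_ball_continuous smooth_continuous_on)

lemma smooth_square_integrable_ball: "smooth f \<Longrightarrow> square_integrable vol f"
  unfolding square_integrable_def
  by (intro conjI borel_measurable_ball_measure smooth_borel_measurable
      integrable_ball_continuous continuous_intros smooth_continuous_on)

lemma smooth_square_integrable_sphere: "smooth f \<Longrightarrow> square_integrable sphere_measure f"
  unfolding square_integrable_def measurable_cong_sets[OF sets_sphere_measure refl]
  by (intro conjI smooth_borel_measurable
      integrable_sphere_continuous continuous_intros smooth_continuous_on)

text \<open>Difference quotients have integral zero by translation invariance of Lebesgue measure,
  and dominated convergence carries this over to the partial derivative.\<close>

lemma integral_partial_deriv_compact:
  fixes g :: "'a::euclidean_space \<Rightarrow> complex"
  assumes g: "smooth g" and K: "compact K" "K \<subseteq> ball 0 1" "\<And>x. x \<notin> K \<Longrightarrow> g x = 0" and i: "i \<in> Basis"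
  shows "(LINT x|vol. partial_deriv i g x) = 0"
proof -
  have D: "smooth (partial_deriv i g)" by (rule smooth_partial_deriv[OF g i])
  have [measurable]: "g \<in> borel_measurable borel" "partial_deriv i g \<in> borel_measurable borel"
    by (auto intro: smooth_borel_measurable g D)
  have D0: "partial_deriv i g x = 0" if "x \<notin> K" for x
  proof -
    have "(g has_derivative (\<lambda>h. 0)) (at x)"
      by (rule has_derivative_transform_within_open[OF has_derivative_const, of "- K"])
         (use K that in \<open>auto intro: compact_imp_closed\<close>)
    then show ?thesis by (rule partial_deriv_eq)
  qed
  obtain C where C: "C > 0" "\<And>x. norm x \<le> 1 \<Longrightarrow> norm (partial_deriv i g x) \<le> C"
    using continuous_bounded_cball[OF smooth_continuous_on[OF D]] by metis
  have C': "norm (partial_deriv i g x) \<le> C" for x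
    using C D0[of x] K(2) by (cases "x \<in> K") (auto simp: subset_iff less_imp_le)
  have ind: "indicator (ball 0 1) x *\<^sub>R f x = f x" if "\<And>x. x \<notin> K \<Longrightarrow> f x = 0" for x and f :: "'a \<Rightarrow> complex"
    using that[of x] K(2) by (auto simp: indicator_def subset_iff)
  have int_g: "integrable lborel g"
    using smooth_integrable_ball[OF g] by (subst (asm) integrable_ball_measure_iff) (auto simp: ind[of g] K)
  define h :: "nat \<Rightarrow> 'a" where "h n = inverse (real (Suc n)) *\<^sub>R i" for n
  have nh: "norm (h n) = inverse (real (Suc n))" for n using i by (simp add: h_def)
  have h0: "h \<longlonglongrightarrow> 0" unfolding h_def by (rule tendsto_eq_intros LIMSEQ_inverse_real_of_nat refl | simp)+
  define s where "s n x = real (Suc n) *\<^sub>R (g (x + h n) - g x)" for n x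
  have [measurable]: "s n \<in> borel_measurable borel" for n unfolding s_def by measurable
  have shift: "integrable lborel (\<lambda>x. g (x + c))" "(LINT x|lborel. g (x + c)) = (LINT x|lborel. g x)" for c
  proof -
    have "integrable (distr lborel borel ((+) c)) g" using int_g by (simp add: lborel_distr_plus)
    then show "integrable lborel (\<lambda>x. g (x + c))" by (subst (asm) integrable_distr_eq) (auto simp: add.commute)
    have "(LINT x|distr lborel borel ((+) c). g x) = (LINT x|lborel. g x)" by (simp add: lborel_distr_plus)
    then show "(LINT x|lborel. g (x + c)) = (LINT x|lborel. g x)" by (subst (asm) integral_distr) (auto simp: add.commute)
  qed
  have s0: "(LINT x|lborel. s n x) = 0" for n
    unfolding s_def using shift int_g by simp
  \<comment> \<open>The mean value inequality along the segment in direction \<open>i\<close>; it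
    bounds all difference quotients by \<open>C\<close>.\<close>
  have lip: "norm (g (x + h n) - g x) \<le> C * norm (h n)" for x n
  proof -
    define p where "p t = g (x + t *\<^sub>R i)" for t
    have p: "(p has_derivative (\<lambda>k. k *\<^sub>R partial_deriv i g (x + t *\<^sub>R i))) (at t within {0..inverse (Suc n)})" for t
    proof -
      have l: "linear (frechet_derivative g (at (x + t *\<^sub>R i)))"
        by (rule linear_frechet_derivative[OF smooth_differentiable[OF g]])
      have "((\<lambda>t. x + t *\<^sub>R i) has_derivative (\<lambda>k. k *\<^sub>R i)) (at t within {0..inverse (Suc n)})"
        by (auto intro!: derivative_eq_intros)
      from has_derivative_compose[OF this smooth_has_derivative[OF g]] show ?thesis
        by (simp add: p_def[abs_def] linear_scale[OF l] partial_deriv_def)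
    qed
    have "norm (p (inverse (Suc n)) - p 0) \<le> C * norm (inverse (real (Suc n)) - 0)"
    proof (rule differentiable_bound[OF _ p])
      show "onorm (\<lambda>k. k *\<^sub>R partial_deriv i g (x + t *\<^sub>R i)) \<le> C" for t :: real
        by (rule onorm_le) (simp add: mult.commute[of C] mult_left_mono C')
    qed auto
    then show ?thesis using i by (simp add: p_def h_def)
  qed
  have "(\<lambda>n. LINT x|lborel. s n x) \<longlonglongrightarrow> (LINT x|lborel. partial_deriv i g x)"
  proof (rule integral_dominated_convergence)
    \<comment> \<open>Radius 2 suffices: \<open>K\<close> lies in the unit ball and the shifts have
      length at most 1.\<close>
    show "integrable lborel (\<lambda>x::'a. C * indicator (cball 0 2) x)"
      using emeasure_lborel_cball_finite[of "0::'a" 2] by auto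
    show "AE x in lborel. norm (s n x) \<le> C * indicator (cball 0 2) x" for n
    proof (rule AE_I2)
      fix x :: 'a
      show "norm (s n x) \<le> C * indicator (cball 0 2) x"
      proof (cases "norm x \<le> 2")
        case True
        have "norm (s n x) \<le> real (Suc n) * (C * norm (h n))"
          unfolding s_def norm_scaleR using lip[of x n] by (intro mult_mono) auto
        also have "\<dots> = C" by (simp add: nh)
        finally show ?thesis using True by simp
      next
        case False
        have "norm (h n) \<le> 1" unfolding nh by (simp add: inverse_le_1_iff)
        moreover have "norm x \<le> norm (x + h n) + norm (h n)"
          using norm_triangle_ineq4[of "x + h n" "h n"] by simp
        ultimately have "norm (x + h n) > 1" "norm x > 1" using False by linarith+
        then have "x + h n \<notin> K" "x \<notin> K" using K(2) by (auto simp: subset_iff)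
        then show ?thesis using C(1) by (simp add: s_def K(3))
      qed
    qed
    show "AE x in lborel. (\<lambda>n. s n x) \<longlonglongrightarrow> partial_deriv i g x"
    proof (rule AE_I2)
      fix x
      have "((\<lambda>h. norm (g (x + h) - g x - frechet_derivative g (at x) h) / norm h) \<longlongrightarrow> 0) (at 0)"
        using smooth_has_derivative[OF g, of x] by (simp add: has_derivative_at)
      moreover have "filterlim h (at 0) sequentially"
        using h0 i by (auto simp: filterlim_at h_def)
      ultimately have "(\<lambda>n. norm (g (x + h n) - g x - frechet_derivative g (at x) (h n)) / norm (h n)) \<longlonglongrightarrow> 0"
        by (rule filterlim_compose)
      moreover have "norm (g (x + h n) - g x - frechet_derivative g (at x) (h n)) / norm (h n) = norm (s n x - partial_deriv i g x)" for n
      proof -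
        have l: "linear (frechet_derivative g (at x))"
          by (rule linear_frechet_derivative[OF smooth_differentiable[OF g]])
        have "s n x - partial_deriv i g x = real (Suc n) *\<^sub>R (g (x + h n) - g x - frechet_derivative g (at x) (h n))"
          by (simp add: s_def h_def linear_scale[OF l] partial_deriv_def scaleR_diff_right del: of_nat_Suc)
        then show ?thesis by (simp add: nh divide_inverse mult.commute del: of_nat_Suc)
      qed
      ultimately show "(\<lambda>n. s n x) \<longlonglongrightarrow> partial_deriv i g x"
        by (simp add: tendsto_norm_zero_iff LIM_zero_iff)
    qed
  qed measurable
  then have "(LINT x|lborel. partial_deriv i g x) = 0"
    using LIMSEQ_unique[OF _ tendsto_const] by (simp add: s0)
  moreover have "(\<lambda>x. indicator (ball 0 1) x *\<^sub>R partial_deriv i g x) = partial_deriv i g"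
    by (intro ext ind D0)
  ultimately show ?thesis by (simp add: integral_ball_measure)
qed

lemma weak_partial_deriv_smooth:
  assumes \<phi>: "smooth \<phi>" and i: "i \<in> Basis"
  shows "weak_partial_deriv i \<phi> (partial_deriv i \<phi>)"
  unfolding weak_partial_deriv_def
proof (intro allI impI)
  fix \<eta> :: "'a \<Rightarrow> real" assume "test_function \<eta> unit_ball"
  then obtain K where \<eta>: "smooth \<eta>" and K: "compact K" "K \<subseteq> ball 0 1" "\<And>x. x \<notin> K \<Longrightarrow> \<eta> x = 0"
    by (auto simp: test_function_def)
  have s: "smooth (\<lambda>x. of_real (\<eta> x) :: complex)" by (rule smooth_of_real[OF \<eta>])
  have D: "smooth (partial_deriv i \<phi>)" "smooth (partial_deriv i \<eta>)" by (auto intro: \<phi> \<eta> i)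
  have "(LINT x|vol. partial_deriv i (\<lambda>x. \<phi> x * of_real (\<eta> x)) x) = 0"
    by (rule integral_partial_deriv_compact[OF smooth_mult[OF \<phi> s] K(1,2) _ i]) (simp add: K(3))
  moreover have "partial_deriv i (\<lambda>x. \<phi> x * of_real (\<eta> x)) x = \<phi> x * of_real (partial_deriv i \<eta> x) + partial_deriv i \<phi> x * of_real (\<eta> x)" for x
    by (simp add: partial_deriv_mult[OF \<phi> s] partial_deriv_of_real[OF \<eta>])
  moreover have "integrable vol (\<lambda>x. \<phi> x * of_real (partial_deriv i \<eta> x))"
    "integrable vol (\<lambda>x. partial_deriv i \<phi> x * of_real (\<eta> x))"
    by (auto intro!: smooth_integrable_ball smooth_mult \<phi> s D smooth_of_real)
  ultimately show "(LINT x|vol. \<phi> x * of_real (partial_deriv i \<eta> x)) = - (LINT x|vol. partial_deriv i \<phi> x * of_real (\<eta> x))"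
    by (simp add: eq_neg_iff_add_eq_0)
qed

text \<open>Keeps the approximating sequence explicit, because later facts are proved for smooth
  functions and carried to the limit along it. Nothing is required on the sphere, so the same notion
  serves functions whose trace is not under control.\<close>

definition H1_lim :: "(nat \<Rightarrow> 'a::euclidean_space \<Rightarrow> complex) \<Rightarrow> ('a \<Rightarrow> complex) \<Rightarrow> ('a \<Rightarrow> 'a \<Rightarrow> complex) \<Rightarrow> bool" where
  "H1_lim \<Phi> u G \<longleftrightarrow> (\<forall>k. smooth (\<Phi> k)) \<and> square_integrable vol u \<and> L2_lim vol \<Phi> u \<and>
    (\<forall>i\<in>Basis. square_integrable vol (G i) \<and> L2_lim vol (\<lambda>k. partial_deriv i (\<Phi> k)) (G i))"

lemma H1_limD:
  assumes "H1_lim \<Phi> u G"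
  shows "smooth (\<Phi> k)" "square_integrable vol u" "L2_lim vol \<Phi> u"
    "i \<in> Basis \<Longrightarrow> square_integrable vol (G i)"
    "i \<in> Basis \<Longrightarrow> L2_lim vol (\<lambda>k. partial_deriv i (\<Phi> k)) (G i)"
    "square_integrable vol (\<Phi> k)"
    "i \<in> Basis \<Longrightarrow> square_integrable vol (partial_deriv i (\<Phi> k))"
  using assms by (auto simp: H1_lim_def intro!: smooth_square_integrable_ball)

lemma H1_lim_weak_partial_deriv:
  assumes "H1_lim \<Phi> u G" "i \<in> Basis"
  shows "weak_partial_deriv i u (G i)"
  unfolding weak_partial_deriv_def
proof (intro allI impI)
  fix \<eta> :: "'a \<Rightarrow> real" assume \<eta>: "test_function \<eta> unit_ball"
  then have s: "smooth \<eta>" by (simp add: test_function_def)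
  have 1: "square_integrable vol (\<lambda>x. of_real (\<eta> x))"
    "square_integrable vol (\<lambda>x. of_real (partial_deriv i \<eta> x))"
    by (intro smooth_square_integrable_ball smooth_of_real s smooth_partial_deriv assms)+
  have \<Phi>: "smooth (\<Phi> k)" for k using assms by (simp add: H1_lim_def)
  have "(\<lambda>k. LINT x|vol. \<Phi> k x * of_real (partial_deriv i \<eta> x)) \<longlonglongrightarrow> (LINT x|vol. u x * of_real (partial_deriv i \<eta> x))"
    using assms 1 by (intro L2_lim_integral_mult L2_lim_const) (auto simp: H1_lim_def smooth_square_integrable_ball)
  moreover have "(\<lambda>k. - (LINT x|vol. partial_deriv i (\<Phi> k) x * of_real (\<eta> x))) \<longlonglongrightarrow> - (LINT x|vol. G i x * of_real (\<eta> x))"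
    using assms 1 by (intro tendsto_minus L2_lim_integral_mult L2_lim_const)
      (auto simp: H1_lim_def intro!: smooth_square_integrable_ball)
  moreover have "(LINT x|vol. \<Phi> k x * of_real (partial_deriv i \<eta> x)) = - (LINT x|vol. partial_deriv i (\<Phi> k) x * of_real (\<eta> x))" for k
    using weak_partial_deriv_smooth[OF \<Phi> assms(2), of k] \<eta> by (simp add: weak_partial_deriv_def)
  ultimately show "(LINT x|vol. u x * of_real (partial_deriv i \<eta> x)) = - (LINT x|vol. G i x * of_real (\<eta> x))"
    by (simp add: LIMSEQ_unique)
qed

lemma H1_lim_H1: "H1_lim \<Phi> u G \<Longrightarrow> H1 u G"
  by (auto simp: H1_def H1_lim_weak_partial_deriv) (auto simp: H1_lim_def)

lemma H1_dist_sq_eq: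
  assumes "square_integrable vol u" "\<And>i. i \<in> Basis \<Longrightarrow> square_integrable vol (G i)"
    "square_integrable vol v" "\<And>i. i \<in> Basis \<Longrightarrow> square_integrable vol (H i)"
  shows "H1_dist_sq u G v H = (L2_norm vol (\<lambda>x. u x - v x))\<^sup>2 + (\<Sum>i\<in>Basis. (L2_norm vol (\<lambda>x. G i x - H i x))\<^sup>2)"
proof -
  have "integrable vol (\<lambda>x. (cmod (u x - v x))\<^sup>2)"
    "\<And>i. i \<in> Basis \<Longrightarrow> integrable vol (\<lambda>x. (cmod (G i x - H i x))\<^sup>2)"
    using square_integrable_diff[OF assms(1,3)] square_integrable_diff[OF assms(2,4)]
    by (auto simp: square_integrable_def)
  then show ?thesis by (simp add: H1_dist_sq_def L2_norm_sq)
qed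

text \<open>The squared distance is a finite sum of squared L^2 distances, so it tends to 0 exactly
  when each of them does. The weak derivatives demanded by \<open>H1\<close> are inherited from the
  approximants.\<close>

lemma has_trace_iff:
  "has_trace u G f \<longleftrightarrow> square_integrable sphere_measure f \<and> (\<exists>\<Phi>. H1_lim \<Phi> u G \<and> L2_lim sphere_measure \<Phi> f)"
proof -
  have "(\<lambda>k. H1_dist_sq (\<Phi> k) (\<lambda>i. partial_deriv i (\<Phi> k)) u G) \<longlonglongrightarrow> 0 \<longleftrightarrow>
      L2_lim vol \<Phi> u \<and> (\<forall>i\<in>Basis. L2_lim vol (\<lambda>k. partial_deriv i (\<Phi> k)) (G i))" (is "?L \<longleftrightarrow> ?R")
    if \<Phi>: "\<And>k. smooth (\<Phi> k)" and si: "square_integrable vol u" "\<And>i. i \<in> Basis \<Longrightarrow> square_integrable vol (G i)" for \<Phi>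
  proof -
    have eq: "H1_dist_sq (\<Phi> k) (\<lambda>i. partial_deriv i (\<Phi> k)) u G = (L2_norm vol (\<lambda>x. \<Phi> k x - u x))\<^sup>2 + (\<Sum>i\<in>Basis. (L2_norm vol (\<lambda>x. partial_deriv i (\<Phi> k) x - G i x))\<^sup>2)" for k
      by (intro H1_dist_sq_eq smooth_square_integrable_ball \<Phi> smooth_partial_deriv si)
    show ?thesis
    proof
      assume L: ?L
      have "(\<lambda>k. (L2_norm vol (\<lambda>x. \<Phi> k x - u x))\<^sup>2) \<longlonglongrightarrow> 0"
        by (rule tendsto_sandwich[OF _ _ tendsto_const L]) (auto simp: eq sum_nonneg)
      moreover have "(\<lambda>k. (L2_norm vol (\<lambda>x. partial_deriv i (\<Phi> k) x - G i x))\<^sup>2) \<longlonglongrightarrow> 0" if "i \<in> Basis" for i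
        by (rule tendsto_sandwich[OF _ _ tendsto_const L])
           (auto simp: eq intro!: always_eventually add_increasing member_le_sum that)
      ultimately show ?R by (auto simp: L2_lim_iff L2_norm_sq)
    next
      assume ?R
      then have "(\<lambda>k. (L2_norm vol (\<lambda>x. \<Phi> k x - u x))\<^sup>2 + (\<Sum>i\<in>Basis. (L2_norm vol (\<lambda>x. partial_deriv i (\<Phi> k) x - G i x))\<^sup>2)) \<longlonglongrightarrow> 0 + (\<Sum>i\<in>(Basis::'a set). 0)"
        by (intro tendsto_add tendsto_sum) (auto simp: L2_lim_iff L2_norm_sq)
      then show ?L by (simp add: eq)
    qed
  qed
  note key = this
  show ?thesis
  proof
    assume "has_trace u G f"
    then obtain \<Phi> where *: "H1 u G" "square_integrable sphere_measure f" "\<And>k. smooth (\<Phi> k)"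
      "(\<lambda>k. H1_dist_sq (\<Phi> k) (\<lambda>i. partial_deriv i (\<Phi> k)) u G) \<longlonglongrightarrow> 0"
      "(\<lambda>k. LINT x|sphere_measure. (cmod (\<Phi> k x - f x))\<^sup>2) \<longlonglongrightarrow> 0"
      by (auto simp: has_trace_def)
    moreover have "H1_lim \<Phi> u G" using * key[of \<Phi>] by (auto simp: H1_lim_def H1_def)
    ultimately show "square_integrable sphere_measure f \<and> (\<exists>\<Phi>. H1_lim \<Phi> u G \<and> L2_lim sphere_measure \<Phi> f)"
      by (auto simp: L2_lim_iff)
  next
    assume "square_integrable sphere_measure f \<and> (\<exists>\<Phi>. H1_lim \<Phi> u G \<and> L2_lim sphere_measure \<Phi> f)"
    then obtain \<Phi> where *: "square_integrable sphere_measure f" "H1_lim \<Phi> u G" "L2_lim sphere_measure \<Phi> f" by blast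
    then have "(\<lambda>k. H1_dist_sq (\<Phi> k) (\<lambda>i. partial_deriv i (\<Phi> k)) u G) \<longlonglongrightarrow> 0"
      by (subst key) (auto simp: H1_lim_def)
    with * show "has_trace u G f"
      unfolding has_trace_def using H1_lim_H1[OF *(2)] H1_limD(1)[OF *(2)] by (auto simp: L2_lim_iff)
  qed
qed

lemma H1_lim_const: "smooth \<phi> \<Longrightarrow> H1_lim (\<lambda>_. \<phi>) \<phi> (\<lambda>i. partial_deriv i \<phi>)"
  by (auto simp: H1_lim_def L2_lim_const intro!: smooth_square_integrable_ball)

lemma H1_lim_add:
  assumes "H1_lim \<Phi> u G" "H1_lim \<Psi> v H"
  shows "H1_lim (\<lambda>k x. \<Phi> k x + \<Psi> k x) (\<lambda>x. u x + v x) (\<lambda>i x. G i x + H i x)"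
proof -
  have "partial_deriv i (\<lambda>x. \<Phi> k x + \<Psi> k x) = (\<lambda>x. partial_deriv i (\<Phi> k) x + partial_deriv i (\<Psi> k) x)" for i k
    by (rule ext) (rule partial_deriv_add[OF H1_limD(1)[OF assms(1)] H1_limD(1)[OF assms(2)]])
  then show ?thesis
    using H1_limD[OF assms(1)] H1_limD[OF assms(2)] unfolding H1_lim_def
    by (auto intro!: L2_lim_add square_integrable_add smooth_add)
qed

lemma H1_lim_cnj:
  assumes "H1_lim \<Phi> u G"
  shows "H1_lim (\<lambda>k x. cnj (\<Phi> k x)) (\<lambda>x. cnj (u x)) (\<lambda>i x. cnj (G i x))"
proof -
  have "partial_deriv i (\<lambda>x. cnj (\<Phi> k x)) = (\<lambda>x. cnj (partial_deriv i (\<Phi> k) x))" for i k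
    by (rule ext) (rule partial_deriv_cnj[OF H1_limD(1)[OF assms(1)]])
  then show ?thesis
    using H1_limD[OF assms(1)] unfolding H1_lim_def
    by (auto intro!: L2_lim_cnj square_integrable_cnj smooth_cnj)
qed

lemma smooth_bounded_ball:
  fixes a :: "'a::euclidean_space \<Rightarrow> complex"
  assumes "smooth a"
  obtains C where "\<And>x. x \<in> space (vol :: 'a measure) \<Longrightarrow> cmod (a x) \<le> C"
proof -
  obtain C where "\<And>x. norm x \<le> 1 \<Longrightarrow> cmod (a x) \<le> C"
    using continuous_bounded_cball[OF smooth_continuous_on[OF assms], where r = 1] by metis
  then show thesis by (intro that[of C]) (simp add: less_imp_le)
qed

lemma square_integrable_smooth_mult:
  assumes a: "smooth a" and "square_integrable vol w"
  shows "square_integrable vol (\<lambda>x. a x * w x)"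
proof -
  obtain C where "\<And>x. x \<in> space (vol :: 'a measure) \<Longrightarrow> cmod (a x) \<le> C"
    using smooth_bounded_ball[OF a] by metis
  then show ?thesis
    by (rule square_integrable_mult_bounded(1)[OF assms(2) borel_measurable_ball_measure[OF smooth_borel_measurable[OF a]]])
qed

lemma L2_lim_smooth_mult:
  assumes a: "smooth a" and "L2_lim vol U w" "\<And>k. square_integrable vol (U k)" "square_integrable vol w"
  shows "L2_lim vol (\<lambda>k x. a x * U k x) (\<lambda>x. a x * w x)"
proof -
  obtain C where "\<And>x. x \<in> space (vol :: 'a measure) \<Longrightarrow> cmod (a x) \<le> C"
    using smooth_bounded_ball[OF a] by metis
  then show ?thesis
    by (rule L2_lim_mult_bounded[OF assms(2-4) borel_measurable_ball_measure[OF smooth_borel_measurable[OF a]]])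
qed

lemma H1_lim_mult:
  assumes b: "smooth b" and "H1_lim \<Phi> u G"
  shows "H1_lim (\<lambda>k x. b x * \<Phi> k x) (\<lambda>x. b x * u x) (\<lambda>i x. b x * G i x + partial_deriv i b x * u x)"
proof -
  note l = H1_limD[OF assms(2)]
  have pd: "partial_deriv i (\<lambda>x. b x * \<Phi> k x) = (\<lambda>x. b x * partial_deriv i (\<Phi> k) x + partial_deriv i b x * \<Phi> k x)" for i k
    by (rule ext) (rule partial_deriv_mult[OF b l(1)])
  show ?thesis
    unfolding H1_lim_def pd using b l
    by (intro conjI allI ballI smooth_mult L2_lim_add square_integrable_add L2_lim_smooth_mult
        square_integrable_smooth_mult smooth_partial_deriv)
qed

lemma has_trace_add:
  assumes "has_trace u G f" "has_trace v H g"
  shows "has_trace (\<lambda>x. u x + v x) (\<lambda>i x. G i x + H i x) (\<lambda>x. f x + g x)"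
proof -
  obtain \<Phi> where \<Phi>: "H1_lim \<Phi> u G" "L2_lim sphere_measure \<Phi> f" "square_integrable sphere_measure f"
    using assms(1) by (auto simp: has_trace_iff)
  obtain \<Psi> where \<Psi>: "H1_lim \<Psi> v H" "L2_lim sphere_measure \<Psi> g" "square_integrable sphere_measure g"
    using assms(2) by (auto simp: has_trace_iff)
  show ?thesis
    unfolding has_trace_iff using \<Phi> \<Psi>
    by (intro conjI square_integrable_add exI[of _ "\<lambda>k x. \<Phi> k x + \<Psi> k x"] H1_lim_add L2_lim_add)
       (auto intro: smooth_square_integrable_sphere H1_limD(1))
qed

lemma has_trace_cnj:
  assumes "has_trace u G f"
  shows "has_trace (\<lambda>x. cnj (u x)) (\<lambda>i x. cnj (G i x)) (\<lambda>x. cnj (f x))"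
proof -
  obtain \<Phi> where \<Phi>: "H1_lim \<Phi> u G" "L2_lim sphere_measure \<Phi> f" "square_integrable sphere_measure f"
    using assms(1) by (auto simp: has_trace_iff)
  show ?thesis
    unfolding has_trace_iff using H1_lim_cnj[OF \<Phi>(1)] L2_lim_cnj[OF \<Phi>(2)] square_integrable_cnj[OF \<Phi>(3)]
    by blast
qed

lemma has_trace_cmult:
  assumes "has_trace u G f"
  shows "has_trace (\<lambda>x. c * u x) (\<lambda>i x. c * G i x) (\<lambda>x. c * f x)"
proof -
  obtain \<Phi> where \<Phi>: "H1_lim \<Phi> u G" "L2_lim sphere_measure \<Phi> f" "square_integrable sphere_measure f"
    using assms(1) by (auto simp: has_trace_iff)
  show ?thesis
    unfolding has_trace_iff using H1_lim_mult[OF smooth_const \<Phi>(1), of c] \<Phi>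
    by (auto intro!: square_integrable_cmult L2_lim_cmult exI[of _ "\<lambda>k x. c * \<Phi> k x"])
qed

lemma has_trace_diff:
  assumes "has_trace u G f" "has_trace v H g"
  shows "has_trace (\<lambda>x. u x - v x) (\<lambda>i x. G i x - H i x) (\<lambda>x. f x - g x)"
  using has_trace_add[OF assms(1) has_trace_cmult[OF assms(2), of "-1"]] by simp

lemma L2_norm_sphere_cong:
  assumes "\<And>x. norm x = 1 \<Longrightarrow> u x = v x" "u \<in> borel_measurable borel" "v \<in> borel_measurable borel"
  shows "L2_norm sphere_measure u = L2_norm (sphere_measure :: 'a::euclidean_space measure) v"
  using AE_sphere_measure assms
  by (intro L2_norm_cong_AE) (auto simp: measurable_cong_sets[OF sets_sphere_measure refl])

lemma has_trace_0_if_eq_0_on_sphere: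
  assumes "smooth \<phi>" "\<And>x. norm x = 1 \<Longrightarrow> \<phi> x = 0"
  shows "has_trace \<phi> (\<lambda>i. partial_deriv i \<phi>) (\<lambda>_. 0)"
proof -
  have "L2_norm sphere_measure (\<lambda>x. \<phi> x - 0) = L2_norm (sphere_measure :: 'a measure) (\<lambda>x. 0)"
    by (rule L2_norm_sphere_cong) (auto simp: assms smooth_borel_measurable)
  then have "L2_lim sphere_measure (\<lambda>_. \<phi>) (\<lambda>_. 0)"
    by (simp add: L2_lim_def) (simp add: L2_norm_def)
  then show ?thesis
    unfolding has_trace_iff using H1_lim_const[OF assms(1)] square_integrable_0 by blast
qed

text \<open>Each product \<open>b x * \<Phi> k x\<close> already vanishes on the sphere, whatever
  the boundary behaviour of \<open>\<Phi>\<close>. So multiplication by a function vanishing there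
  produces admissible test functions and corrections that leave boundary values unchanged.\<close>

lemma H1_lim_mult_trace_0:
  assumes "smooth b" "\<And>x. norm x = 1 \<Longrightarrow> b x = 0" "H1_lim \<Phi> u G"
  shows "has_trace (\<lambda>x. b x * u x) (\<lambda>i x. b x * G i x + partial_deriv i b x * u x) (\<lambda>_. 0)"
proof -
  have "L2_norm sphere_measure (\<lambda>x. b x * \<Phi> k x - 0) = L2_norm (sphere_measure :: 'a measure) (\<lambda>x. 0)" for k
    by (rule L2_norm_sphere_cong) (auto simp: assms(2) intro!: smooth_borel_measurable smooth_mult assms(1) H1_limD(1)[OF assms(3)])
  then have "L2_lim sphere_measure (\<lambda>k x. b x * \<Phi> k x) (\<lambda>_. 0)"
    by (simp add: L2_lim_def) (simp add: L2_norm_def)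
  then show ?thesis
    unfolding has_trace_iff using H1_lim_mult[OF assms(1,3)] square_integrable_0 by blast
qed

section \<open>Hardy and Poincare inequalities\<close>

lemma sphere_integral_mult:
  fixes \<phi> \<psi> :: "'a::euclidean_space \<Rightarrow> complex"
  assumes "smooth \<phi>" "smooth \<psi>"
  shows "(LINT x|sphere_measure. \<phi> x * \<psi> x) =
    (LINT x|vol. of_nat DIM('a) * (\<phi> x * \<psi> x) + (\<phi> x * radial_deriv \<psi> x + radial_deriv \<phi> x * \<psi> x))"
  using radial_divergence[OF smooth_mult[OF assms]]
  by (simp add: radial_deriv_mult[OF assms] scaleR_conv_of_real)

lemma radial_deriv_cnj: "smooth \<phi> \<Longrightarrow> radial_deriv (\<lambda>x. cnj (\<phi> x)) x = cnj (radial_deriv \<phi> x)"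
  using partial_deriv_cnj[of \<phi> x x] by (simp add: radial_deriv_def partial_deriv_def)

lemma radial_deriv_bound:
  fixes \<phi> :: "'a::euclidean_space \<Rightarrow> complex"
  assumes "smooth \<phi>"
  shows "(cmod (radial_deriv \<phi> x))\<^sup>2 \<le> (x \<bullet> x) * (\<Sum>i\<in>Basis. (cmod (partial_deriv i \<phi> x))\<^sup>2)"
proof -
  have "cmod (radial_deriv \<phi> x) \<le> (\<Sum>i\<in>Basis. \<bar>x \<bullet> i\<bar> * \<bar>cmod (partial_deriv i \<phi> x)\<bar>)"
    unfolding radial_deriv_eq[OF assms] by (rule sum_norm_le) simp
  also have "\<dots> \<le> L2_set (\<lambda>i. x \<bullet> i) Basis * L2_set (\<lambda>i. cmod (partial_deriv i \<phi> x)) Basis"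
    by (rule L2_set_mult_ineq)
  finally have "(cmod (radial_deriv \<phi> x))\<^sup>2 \<le> (L2_set (\<lambda>i. x \<bullet> i) Basis * L2_set (\<lambda>i. cmod (partial_deriv i \<phi> x)) Basis)\<^sup>2"
    by (intro power_mono) auto
  also have "\<dots> = (\<Sum>i\<in>Basis. (x \<bullet> i)\<^sup>2) * (\<Sum>i\<in>Basis. (cmod (partial_deriv i \<phi> x))\<^sup>2)"
    by (simp add: power_mult_distrib L2_set_def sum_nonneg)
  also have "(\<Sum>i\<in>Basis. (x \<bullet> i)\<^sup>2) = x \<bullet> x"
    by (subst euclidean_inner) (simp add: power2_eq_square)
  finally show ?thesis .
qed

definition energy :: "('a::euclidean_space \<Rightarrow> 'a \<Rightarrow> complex) \<Rightarrow> real" where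
  "energy G = (\<Sum>i\<in>Basis. (L2_norm vol (G i))\<^sup>2)"

lemma energy_nonneg [simp]: "0 \<le> energy G"
  by (simp add: energy_def sum_nonneg)

lemma energy_integral:
  assumes "\<And>i. i \<in> Basis \<Longrightarrow> square_integrable vol (G i)"
  shows "energy G = (LINT x|vol. (\<Sum>i\<in>Basis. (cmod (G i x))\<^sup>2))"
    "integrable vol (\<lambda>x. (\<Sum>i\<in>Basis. (cmod (G i x))\<^sup>2))"
  using assms by (simp_all add: energy_def L2_norm_sq square_integrable_def)

text \<open>Pairing with \<open>cnj h\<close> in the radial divergence theorem: the boundary term has a sign.\<close>

lemma radial_equation_bound:
  fixes h F :: "'a::euclidean_space \<Rightarrow> complex"
  assumes h: "smooth h" and F: "smooth F" and eq: "\<And>x. radial_deriv h x + of_real c * h x = F x"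
  shows "(2 * c - real DIM('a)) * L2_norm vol h \<le> 2 * L2_norm vol F"
proof (cases "L2_norm vol h = 0")
  case False
  define N where "N = L2_norm (vol :: 'a measure) h"
  have hc: "smooth (\<lambda>x. cnj (h x))" by (rule smooth_cnj[OF h])
  have "(LINT x|sphere_measure. h x * cnj (h x)) =
    (LINT x|vol. of_nat DIM('a) * (h x * cnj (h x)) + (h x * cnj (radial_deriv h x) + radial_deriv h x * cnj (h x)))"
    using sphere_integral_mult[OF h hc] by (simp add: radial_deriv_cnj[OF h])
  \<comment> \<open>Inserting \<open>radial_deriv h = F - c h\<close> and its conjugate turns the
    dimension into n - 2c. When this is negative, the nonnegative boundary integral bounds the norm
    of \<open>h\<close> by that of \<open>F\<close>.\<close>
  also have "\<dots> = (LINT x|vol. of_real (real DIM('a) - 2 * c) * (h x * cnj (h x)) + (h x * cnj (F x) + F x * cnj (h x)))"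
  proof (rule Bochner_Integration.integral_cong[OF refl])
    fix x
    have "F x = radial_deriv h x + of_real c * h x" by (simp add: eq)
    then show "of_nat DIM('a) * (h x * cnj (h x)) + (h x * cnj (radial_deriv h x) + radial_deriv h x * cnj (h x))
      = of_real (real DIM('a) - 2 * c) * (h x * cnj (h x)) + (h x * cnj (F x) + F x * cnj (h x))"
      by (simp add: algebra_simps)
  qed
  also have "\<dots> = of_real (real DIM('a) - 2 * c) * (LINT x|vol. h x * cnj (h x)) + ((LINT x|vol. h x * cnj (F x)) + (LINT x|vol. F x * cnj (h x)))"
    using h F hc by (simp add: smooth_integrable_ball smooth_mult smooth_cnj)
  finally have E: "(LINT x|sphere_measure. h x * cnj (h x)) = \<dots>" .
  have sq: "h x * cnj (h x) = of_real ((cmod (h x))\<^sup>2)" for x by (simp only: complex_norm_square)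
  have 1: "(LINT x|sphere_measure. h x * cnj (h x)) = of_real ((L2_norm sphere_measure h)\<^sup>2)"
    "(LINT x|vol. h x * cnj (h x)) = of_real (N\<^sup>2)"
    unfolding sq by (simp_all add: L2_norm_sq N_def del: of_real_power)
  have "cmod (LINT x|vol. h x * cnj (F x)) \<le> N * L2_norm vol F"
    "cmod (LINT x|vol. F x * cnj (h x)) \<le> L2_norm vol F * N"
    using L2_Cauchy_Schwarz(2)[of vol h "\<lambda>x. cnj (F x)"] L2_Cauchy_Schwarz(2)[of vol F "\<lambda>x. cnj (h x)"] h F hc
    by (simp_all add: smooth_square_integrable_ball smooth_cnj L2_norm_cnj N_def)
  then have "Re ((LINT x|vol. h x * cnj (F x)) + (LINT x|vol. F x * cnj (h x))) \<le> 2 * (N * L2_norm vol F)"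
    using complex_Re_le_cmod[of "LINT x|vol. h x * cnj (F x)"]
      complex_Re_le_cmod[of "LINT x|vol. F x * cnj (h x)"]
    unfolding mult.commute[of _ N] plus_complex.sel by linarith
  moreover have "0 \<le> Re (of_real (real DIM('a) - 2 * c) * of_real (N\<^sup>2) + ((LINT x|vol. h x * cnj (F x)) + (LINT x|vol. F x * cnj (h x))))"
    using arg_cong[OF E, of Re] unfolding 1 by (metis Re_complex_of_real zero_le_power2)
  ultimately have "(2 * c - real DIM('a)) * N\<^sup>2 \<le> 2 * (N * L2_norm vol F)"
    by (simp add: algebra_simps)
  then have "N * ((2 * c - real DIM('a)) * N) \<le> N * (2 * L2_norm vol F)"
    by (simp add: power2_eq_square mult_ac)
  moreover have "N > 0" using False L2_norm_nonneg[of vol h] by (simp add: N_def less_le)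
  ultimately show ?thesis by (simp add: N_def)
qed simp

text \<open>Apply the radial divergence theorem to \<open>\<eta> |\<phi>|\<^sup>2\<close> with \<open>\<eta> = 1 / (1 + \<delta> - |x|\<^sup>2)\<close>,
  for which \<open>x \<bullet> \<nabla>\<eta> = 2 |x|\<^sup>2 \<eta>\<^sup>2\<close>.\<close>

lemma Hardy_smooth:
  fixes \<phi> :: "'a::euclidean_space \<Rightarrow> complex"
  assumes \<phi>: "smooth \<phi>" and \<delta>: "\<delta> > 0"
  shows "(L2_norm vol (\<lambda>x. of_real (recip_ext (1 + \<delta>) (x \<bullet> x)) * \<phi> x))\<^sup>2
    \<le> (L2_norm sphere_measure \<phi>)\<^sup>2 / \<delta> + energy (\<lambda>i. partial_deriv i \<phi>)"
proof -
  define \<eta> where "\<eta> x = recip_ext (1 + \<delta>) ((x::'a) \<bullet> x)" for x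
  have \<eta>: "smooth \<eta>" using smooth_recip_ext_norm_sq[of "1 + \<delta>" 1] \<delta> by (simp add: \<eta>_def[abs_def])
  have sc: "smooth (\<lambda>x. cnj (\<phi> x))" "smooth (\<lambda>x. complex_of_real (\<eta> x))" "smooth (\<lambda>x. \<phi> x * cnj (\<phi> x))"
    by (intro smooth_cnj smooth_of_real smooth_mult \<phi> \<eta>)+
  define \<psi> where "\<psi> x = complex_of_real (\<eta> x) * (\<phi> x * cnj (\<phi> x))" for x
  have \<psi>: "smooth \<psi>" unfolding \<psi>_def[abs_def] by (intro smooth_mult sc)
  define g where "g x = (\<Sum>i\<in>Basis. (cmod (partial_deriv i \<phi> x))\<^sup>2)" for x
  have sphere: "(LINT x|sphere_measure. \<psi> x) = of_real ((L2_norm sphere_measure \<phi>)\<^sup>2 / \<delta>)"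
  proof -
    have "(LINT x|sphere_measure. \<psi> x) = (LINT x|sphere_measure. of_real ((cmod (\<phi> x))\<^sup>2 / \<delta>))"
    proof (rule integral_cong_AE)
      show "AE x in sphere_measure. \<psi> x = of_real ((cmod (\<phi> x))\<^sup>2 / \<delta>)"
        using AE_sphere_measure
      proof eventually_elim
        case (elim x)
        then have "x \<bullet> x = 1" by (simp add: norm_eq_1)
        then show ?case by (simp add: \<psi>_def \<eta>_def recip_ext_eq complex_norm_square divide_inverse mult.commute del: of_real_power)
      qed
      have "(\<lambda>x. complex_of_real ((cmod (\<phi> x))\<^sup>2 / \<delta>)) = (\<lambda>x. (\<phi> x * cnj (\<phi> x)) * of_real (inverse \<delta>))"
        by (simp add: complex_norm_square divide_inverse del: of_real_power)
      also have "\<dots> \<in> borel_measurable borel" by (intro smooth_borel_measurable smooth_mult sc smooth_const)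
      finally show "(\<lambda>x. complex_of_real ((cmod (\<phi> x))\<^sup>2 / \<delta>)) \<in> borel_measurable sphere_measure"
        by (simp add: measurable_cong_sets[OF sets_sphere_measure refl])
    qed (simp add: measurable_cong_sets[OF sets_sphere_measure refl] smooth_borel_measurable \<psi>)
    then show ?thesis by (simp add: L2_norm_sq del: of_real_power of_real_divide)
  qed
  define B where "B x = of_nat DIM('a) * \<psi> x + radial_deriv \<psi> x" for x
  have B: "smooth B" unfolding B_def[abs_def] by (intro smooth_add smooth_mult smooth_const smooth_radial_deriv \<psi>)
  have "(LINT x|vol. B x) = of_real ((L2_norm sphere_measure \<phi>)\<^sup>2 / \<delta>)"
    using radial_divergence[OF \<psi>] by (simp add: sphere B_def scaleR_conv_of_real)
  then have Bint: "(LINT x|vol. Re (B x)) = (L2_norm sphere_measure \<phi>)\<^sup>2 / \<delta>"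
    using integral_Re[OF smooth_integrable_ball[OF B]] by simp
  have pw: "(\<eta> x)\<^sup>2 * (cmod (\<phi> x))\<^sup>2 - g x \<le> Re (B x)" if x: "norm x < 1" for x
  proof -
    define r where "r = norm x"
    have xx: "x \<bullet> x = r\<^sup>2" by (simp add: r_def power2_norm_eq_inner)
    have r: "0 \<le> r" "r < 1" using x by (auto simp: r_def)
    then have r2: "r\<^sup>2 < 1" by (simp add: power_less_one_iff)
    have ex: "\<eta> x = inverse (1 + \<delta> - r\<^sup>2)" using r2 by (simp add: \<eta>_def xx recip_ext_eq)
    have e: "\<eta> x > 0" using r2 \<delta> by (simp add: ex)
    have R\<eta>: "radial_deriv \<eta> x = 2 * r\<^sup>2 * (\<eta> x)\<^sup>2"
      using has_derivative_recip_ext_norm_sq[of "1 + \<delta>" x 1] x \<delta> 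
      by (simp add: radial_deriv_def \<eta>_def[abs_def] xx flip: frechet_derivative_at)
    have "radial_deriv \<psi> x = of_real (\<eta> x) * radial_deriv (\<lambda>x. \<phi> x * cnj (\<phi> x)) x + radial_deriv (\<lambda>x. complex_of_real (\<eta> x)) x * (\<phi> x * cnj (\<phi> x))"
      unfolding \<psi>_def[abs_def] by (rule radial_deriv_mult) (intro sc)+
    also have "radial_deriv (\<lambda>x. complex_of_real (\<eta> x)) x = of_real (radial_deriv \<eta> x)"
      using partial_deriv_of_real[OF \<eta>, of x x] by (simp add: radial_deriv_def partial_deriv_def)
    also have "radial_deriv (\<lambda>x. \<phi> x * cnj (\<phi> x)) x = \<phi> x * cnj (radial_deriv \<phi> x) + radial_deriv \<phi> x * cnj (\<phi> x)"
      by (simp add: radial_deriv_mult[OF \<phi> sc(1)] radial_deriv_cnj[OF \<phi>])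
    finally have R\<psi>: "radial_deriv \<psi> x = of_real (\<eta> x) * (\<phi> x * cnj (radial_deriv \<phi> x) + radial_deriv \<phi> x * cnj (\<phi> x))
        + of_real (radial_deriv \<eta> x) * (\<phi> x * cnj (\<phi> x))" .
    have "\<phi> x * cnj (radial_deriv \<phi> x) + radial_deriv \<phi> x * cnj (\<phi> x) = of_real (2 * Re (\<phi> x * cnj (radial_deriv \<phi> x)))"
      by (simp add: complex_eq_iff)
    then have "B x = of_real (real DIM('a) * (\<eta> x * (cmod (\<phi> x))\<^sup>2) + 2 * r\<^sup>2 * (\<eta> x)\<^sup>2 * (cmod (\<phi> x))\<^sup>2
        + 2 * \<eta> x * Re (\<phi> x * cnj (radial_deriv \<phi> x)))"
      unfolding B_def R\<psi> \<psi>_def R\<eta> complex_norm_square[symmetric] by simp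
    then have ReB: "Re (B x) = real DIM('a) * (\<eta> x * (cmod (\<phi> x))\<^sup>2) + 2 * r\<^sup>2 * (\<eta> x)\<^sup>2 * (cmod (\<phi> x))\<^sup>2
        + 2 * \<eta> x * Re (\<phi> x * cnj (radial_deriv \<phi> x))"
      by (metis Re_complex_of_real)
    have Rg: "(cmod (radial_deriv \<phi> x))\<^sup>2 \<le> r\<^sup>2 * g x"
      using radial_deriv_bound[OF \<phi>, of x] by (simp add: xx g_def)
    have g0: "g x \<ge> 0" by (simp add: g_def sum_nonneg)
    have "- Re (\<phi> x * cnj (radial_deriv \<phi> x)) \<le> cmod (\<phi> x) * cmod (radial_deriv \<phi> x)"
      using abs_Re_le_cmod[of "\<phi> x * cnj (radial_deriv \<phi> x)"] by (simp add: norm_mult)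
    also have "\<dots> \<le> cmod (\<phi> x) * (r * sqrt (g x))"
      using Rg r g0 by (intro mult_left_mono power2_le_imp_le[of "cmod (radial_deriv \<phi> x)"]) (auto simp: power_mult_distrib)
    finally have "2 * \<eta> x * - Re (\<phi> x * cnj (radial_deriv \<phi> x)) \<le> 2 * \<eta> x * (cmod (\<phi> x) * (r * sqrt (g x)))"
      using e by (intro mult_left_mono) auto
    \<comment> \<open>Completing the square spends the gradient term \<open>g x\<close> and one of
      the two copies of \<open>r\<^sup>2 * (\<eta> x)\<^sup>2 * (cmod (\<phi> x))\<^sup>2\<close> in
      \<open>ReB\<close>; the other copy is needed below.\<close>
    also have "\<dots> \<le> (r * \<eta> x * cmod (\<phi> x))\<^sup>2 + (sqrt (g x))\<^sup>2"
      using sum_squares_bound[of "r * \<eta> x * cmod (\<phi> x)" "sqrt (g x)"] by (simp add: mult_ac)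
    also have "\<dots> = r\<^sup>2 * (\<eta> x)\<^sup>2 * (cmod (\<phi> x))\<^sup>2 + g x" using g0 by (simp add: power_mult_distrib)
    finally have 1: "Re (B x) \<ge> real DIM('a) * (\<eta> x * (cmod (\<phi> x))\<^sup>2) + r\<^sup>2 * (\<eta> x)\<^sup>2 * (cmod (\<phi> x))\<^sup>2 - g x"
      unfolding ReB by (simp add: algebra_simps)
    \<comment> \<open>Multiplied by \<open>\<eta> x\<close>, this expresses the square of
      \<open>\<eta> x\<close> through \<open>\<eta> x\<close> and the remaining copy, up to a term
      with \<open>\<delta>\<close> of favourable sign.\<close>
    have "\<eta> x * (1 + \<delta> - r\<^sup>2) = 1" using r2 \<delta> by (simp add: ex)
    then have "(\<eta> x)\<^sup>2 * (1 + \<delta> - r\<^sup>2) = \<eta> x" by (simp add: power2_eq_square mult.assoc)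
    then have "(\<eta> x)\<^sup>2 + \<delta> * (\<eta> x)\<^sup>2 = \<eta> x + r\<^sup>2 * (\<eta> x)\<^sup>2" by (simp add: algebra_simps)
    moreover have "\<delta> * (\<eta> x)\<^sup>2 \<ge> 0" using \<delta> by simp
    ultimately have "(\<eta> x)\<^sup>2 \<le> \<eta> x + r\<^sup>2 * (\<eta> x)\<^sup>2" by linarith
    also have "\<dots> \<le> real DIM('a) * \<eta> x + r\<^sup>2 * (\<eta> x)\<^sup>2" 
      using e DIM_positive[where 'a = 'a] mult_right_mono[of 1 "real DIM('a)" "\<eta> x"] by (simp add: Suc_le_eq)
    finally have "(\<eta> x)\<^sup>2 * (cmod (\<phi> x))\<^sup>2 \<le> (real DIM('a) * \<eta> x + r\<^sup>2 * (\<eta> x)\<^sup>2) * (cmod (\<phi> x))\<^sup>2"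
      by (rule mult_right_mono) simp
    with 1 show ?thesis by (simp add: algebra_simps)
  qed
  have si: "square_integrable vol (\<lambda>x. of_real (\<eta> x) * \<phi> x)"
    "\<And>i. i \<in> Basis \<Longrightarrow> square_integrable vol (partial_deriv i \<phi>)"
    by (intro smooth_square_integrable_ball smooth_mult sc \<phi> smooth_partial_deriv; assumption)+
  have sq: "(cmod (of_real (\<eta> x) * \<phi> x))\<^sup>2 = (\<eta> x)\<^sup>2 * (cmod (\<phi> x))\<^sup>2" for x
    by (simp add: norm_mult power_mult_distrib)
  have i1: "integrable vol (\<lambda>x. (\<eta> x)\<^sup>2 * (cmod (\<phi> x))\<^sup>2)"
    using si(1) unfolding square_integrable_def sq by simp
  have "(L2_norm vol (\<lambda>x. of_real (\<eta> x) * \<phi> x))\<^sup>2 - energy (\<lambda>i. partial_deriv i \<phi>)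
      = (LINT x|vol. (\<eta> x)\<^sup>2 * (cmod (\<phi> x))\<^sup>2 - g x)"
    using i1 energy_integral[of "\<lambda>i. partial_deriv i \<phi>", OF si(2)] by (simp add: L2_norm_sq sq g_def)
  also have "\<dots> \<le> (LINT x|vol. Re (B x))"
    using i1 energy_integral(2)[of "\<lambda>i. partial_deriv i \<phi>", OF si(2)] smooth_integrable_ball[OF B]
    by (intro integral_mono pw) (auto simp: g_def)
  finally show ?thesis by (simp add: Bint \<eta>_def)
qed

lemma H1_lim_energy:
  assumes "H1_lim \<Phi> u G"
  shows "(\<lambda>k. energy (\<lambda>i. partial_deriv i (\<Phi> k))) \<longlonglongrightarrow> energy G"
  unfolding energy_def using H1_limD[OF assms]
  by (intro tendsto_sum tendsto_power L2_lim_norm) auto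

text \<open>The boundary term of \<open>Hardy_smooth\<close>, however large its factor
  \<open>1 / \<delta>\<close>, vanishes in the limit of zero trace. The remaining bound no longer
  depends on \<open>\<delta>\<close>.\<close>

lemma Hardy_trace_0:
  fixes v :: "'a::euclidean_space \<Rightarrow> complex"
  assumes "has_trace v H (\<lambda>_. 0)" and \<delta>: "\<delta> > 0"
  shows "(L2_norm vol (\<lambda>x. of_real (recip_ext (1 + \<delta>) (x \<bullet> x)) * v x))\<^sup>2 \<le> energy H"
proof -
  obtain \<Phi> where \<Phi>: "H1_lim \<Phi> v H" "L2_lim sphere_measure \<Phi> (\<lambda>_. 0)"
    using assms(1) by (auto simp: has_trace_iff)
  note l = H1_limD[OF \<Phi>(1)]
  have \<eta>: "smooth (\<lambda>x::'a. complex_of_real (recip_ext (1 + \<delta>) (x \<bullet> x)))"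
    using smooth_recip_ext_norm_sq[of "1 + \<delta>" 1] \<delta> by (intro smooth_of_real) simp
  have "(\<lambda>k. (L2_norm vol (\<lambda>x. of_real (recip_ext (1 + \<delta>) (x \<bullet> x)) * \<Phi> k x))\<^sup>2) \<longlonglongrightarrow>
      (L2_norm vol (\<lambda>x. of_real (recip_ext (1 + \<delta>) (x \<bullet> x)) * v x))\<^sup>2"
    by (intro tendsto_power L2_lim_norm L2_lim_smooth_mult square_integrable_smooth_mult \<eta> l)
  moreover have "(\<lambda>k. (L2_norm sphere_measure (\<Phi> k))\<^sup>2 / \<delta> + energy (\<lambda>i. partial_deriv i (\<Phi> k))) \<longlonglongrightarrow> 0\<^sup>2 / \<delta> + energy H"
    using \<Phi>(2) \<delta> unfolding L2_lim_def by (intro tendsto_intros H1_lim_energy[OF \<Phi>(1)]) auto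
  ultimately show ?thesis
    using Hardy_smooth[OF l(1) \<delta>] by (simp add: LIMSEQ_le)
qed

text \<open>Hardy's inequality with \<open>\<delta> = 1\<close>: the factor 2 - |x|^2 that undoes
  the weight is at most 2 on the ball.\<close>

lemma Poincare_trace_0:
  fixes v :: "'a::euclidean_space \<Rightarrow> complex"
  assumes v: "has_trace v H (\<lambda>_. 0)"
  shows "L2_norm vol v \<le> 2 * sqrt (energy H)"
proof -
  have si: "square_integrable vol v" using v by (auto simp: has_trace_def H1_def)
  define \<eta> where "\<eta> x = complex_of_real (recip_ext (1 + 1) ((x::'a) \<bullet> x))" for x
  have \<eta>: "smooth \<eta>" using smooth_recip_ext_norm_sq[of "1 + 1" 1] unfolding \<eta>_def[abs_def] by (intro smooth_of_real) simp
  have lt: "x \<bullet> x < 1" if "norm x < 1" for x :: 'a using that by (simp add: norm_eq_sqrt_inner)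
  have ne: "2 - x \<bullet> x \<noteq> 0" if "norm x < 1" for x :: 'a using lt[OF that] by simp
  have b: "(\<lambda>x::'a. complex_of_real (2 - x \<bullet> x)) \<in> borel_measurable vol"
    by (intro borel_measurable_ball_measure smooth_borel_measurable smooth_of_real smooth_diff smooth_const smooth_norm_sq)
  have "L2_norm vol v = L2_norm vol (\<lambda>x. complex_of_real (2 - x \<bullet> x) * (\<eta> x * v x))"
    unfolding L2_norm_def
  proof (intro arg_cong[where f = sqrt] Bochner_Integration.integral_cong refl)
    fix x :: 'a assume "x \<in> space vol"
    then have x: "norm x < 1" by simp
    have "(2 - x \<bullet> x) * recip_ext (1 + 1) (x \<bullet> x) = 1"
      using ne[OF x] lt[OF x] by (simp add: recip_ext_eq)
    then have "complex_of_real (2 - x \<bullet> x) * \<eta> x = 1"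
      unfolding \<eta>_def of_real_mult[symmetric] by simp
    then show "(cmod (v x))\<^sup>2 = (cmod (complex_of_real (2 - x \<bullet> x) * (\<eta> x * v x)))\<^sup>2"
      by (simp flip: mult.assoc)
  qed
  also have "\<dots> \<le> \<bar>2\<bar> * L2_norm vol (\<lambda>x. \<eta> x * v x)"
  proof (rule square_integrable_mult_bounded(2)[OF square_integrable_smooth_mult[OF \<eta> si] b])
    show "cmod (complex_of_real (2 - x \<bullet> x)) \<le> 2" if "x \<in> space vol" for x :: 'a
      using lt[of x] that inner_ge_zero[of x] unfolding norm_of_real by simp
  qed
  also have "L2_norm vol (\<lambda>x. \<eta> x * v x) \<le> sqrt (energy H)"
    using Hardy_trace_0[OF v, of 1] by (intro real_le_rsqrt) (simp add: \<eta>_def)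
  finally show ?thesis by simp
qed

lemma has_traceD:
  assumes "has_trace u G f"
  shows "square_integrable vol u" "i \<in> Basis \<Longrightarrow> square_integrable vol (G i)"
    "square_integrable sphere_measure f"
  using assms by (auto simp: has_trace_def H1_def)

lemma norm_sq_less_1: "norm (x::'a::euclidean_space) < 1 \<Longrightarrow> x \<bullet> x < 1"
  by (simp add: norm_eq_sqrt_inner)

text \<open>The bound in \<open>Hardy_trace_0\<close> is uniform, so Fatou's lemma lets
  \<open>\<delta>\<close> tend to 0 and yields the singular weight, the inverse of 1 -
  |x|^2.\<close>

lemma Hardy_weight:
  fixes v :: "'a::euclidean_space \<Rightarrow> complex"
  assumes v: "has_trace v H (\<lambda>_. 0)"
  shows "square_integrable vol (\<lambda>x. of_real (inverse (1 - x \<bullet> x)) * v x)"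
proof -
  have si: "square_integrable vol v" using has_traceD[OF v] by simp
  note [measurable] = square_integrable_borel[OF si]
  define \<delta> where "\<delta> m = inverse (real (Suc m))" for m
  have \<delta>: "\<delta> m > 0" for m by (simp add: \<delta>_def)
  define g where "g m x = of_real (recip_ext (1 + \<delta> m) (x \<bullet> x)) * v x" for m x
  have \<eta>: "smooth (\<lambda>x::'a. complex_of_real (recip_ext (1 + \<delta> m) (x \<bullet> x)))" for m
    using smooth_recip_ext_norm_sq[of "1 + \<delta> m" 1] \<delta> by (intro smooth_of_real) simp
  have sg: "square_integrable vol (g m)" for m
    unfolding g_def[abs_def] by (rule square_integrable_smooth_mult[OF \<eta> si])
  note [measurable] = square_integrable_borel[OF sg]
  have bm: "(\<lambda>x::'a. complex_of_real (inverse (1 - x \<bullet> x))) \<in> borel_measurable vol"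
    by (rule borel_measurable_ball_measure) measurable
  have [measurable]: "(\<lambda>x. complex_of_real (inverse (1 - x \<bullet> x)) * v x) \<in> borel_measurable vol"
    by (rule borel_measurable_times[OF bm square_integrable_borel[OF si]])
  have "(\<integral>\<^sup>+x. ennreal ((cmod (of_real (inverse (1 - x \<bullet> x)) * v x))\<^sup>2) \<partial>vol)
     = (\<integral>\<^sup>+x. liminf (\<lambda>m. ennreal ((cmod (g m x))\<^sup>2)) \<partial>vol)"
  proof (rule nn_integral_cong)
    fix x :: 'a assume "x \<in> space vol"
    then have x: "x \<bullet> x < 1" by (simp add: norm_sq_less_1)
    have "(\<lambda>m. inverse (1 + \<delta> m - x \<bullet> x)) \<longlonglongrightarrow> inverse (1 + 0 - x \<bullet> x)"
      unfolding \<delta>_def by (intro tendsto_intros LIMSEQ_inverse_real_of_nat) (use x in auto)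
    moreover have "inverse (1 + \<delta> m - x \<bullet> x) = recip_ext (1 + \<delta> m) (x \<bullet> x)" for m
      using x by (simp add: recip_ext_eq)
    ultimately have "(\<lambda>m. recip_ext (1 + \<delta> m) (x \<bullet> x)) \<longlonglongrightarrow> inverse (1 - x \<bullet> x)" by simp
    then have "(\<lambda>m. ennreal ((cmod (g m x))\<^sup>2)) \<longlonglongrightarrow> ennreal ((cmod (of_real (inverse (1 - x \<bullet> x)) * v x))\<^sup>2)"
      unfolding g_def by (intro tendsto_ennrealI tendsto_power tendsto_norm tendsto_mult tendsto_of_real tendsto_const)
    from lim_imp_Liminf[OF trivial_limit_sequentially this]
    show "ennreal ((cmod (of_real (inverse (1 - x \<bullet> x)) * v x))\<^sup>2) = liminf (\<lambda>m. ennreal ((cmod (g m x))\<^sup>2))"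
      by (rule sym)
  qed
  also have "\<dots> \<le> liminf (\<lambda>m. \<integral>\<^sup>+x. ennreal ((cmod (g m x))\<^sup>2) \<partial>vol)"
    by (rule nn_integral_liminf) measurable
  also have "\<dots> \<le> ennreal (energy H)"
  proof (rule Liminf_le)
    have "(\<integral>\<^sup>+x. ennreal ((cmod (g m x))\<^sup>2) \<partial>vol) = ennreal ((L2_norm vol (g m))\<^sup>2)" for m
      using sg[of m] by (subst nn_integral_eq_integral) (auto simp: L2_norm_sq square_integrable_def)
    then show "\<forall>\<^sub>F m in sequentially. (\<integral>\<^sup>+x. ennreal ((cmod (g m x))\<^sup>2) \<partial>vol) \<le> ennreal (energy H)"
      using Hardy_trace_0[OF v \<delta>] by (simp add: g_def[abs_def] ennreal_leI)
  qed auto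
  finally have fin: "(\<integral>\<^sup>+x. ennreal ((cmod (of_real (inverse (1 - x \<bullet> x)) * v x))\<^sup>2) \<partial>vol) < \<infinity>"
    by (rule order.strict_trans1) simp
  have "integrable vol (\<lambda>x. (cmod (of_real (inverse (1 - x \<bullet> x)) * v x))\<^sup>2)"
    by (rule integrableI_bounded, measurable) (use fin in simp)
  moreover have "(\<lambda>x. complex_of_real (inverse (1 - x \<bullet> x)) * v x) \<in> borel_measurable vol"
    by measurable
  ultimately show ?thesis unfolding square_integrable_def by blast
qed

text \<open>Inside the ball this is exp (-1 / ((m + 1)(1 - |x|^2))). It only tends to 1 and has no
  plateau, but its gradient has a closed form that matches the Hardy weight.\<close>

definition cutoff :: "nat \<Rightarrow> 'a::euclidean_space \<Rightarrow> real" where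
  "cutoff m x = flat 0 (real (Suc m) * (1 - x \<bullet> x))"

lemma smooth_cutoff: "smooth (cutoff m)"
  unfolding cutoff_def[abs_def]
  by (rule smooth_compose[OF smooth_flat]) (intro smooth_mult smooth_diff smooth_const smooth_norm_sq)

lemma cutoff_eq_0: "norm x \<ge> 1 \<Longrightarrow> cutoff m x = 0"
proof -
  assume "norm x \<ge> 1"
  then have "1 - x \<bullet> x \<le> 0" by (simp add: norm_eq_sqrt_inner)
  then show ?thesis unfolding cutoff_def by (intro flat_nonpos mult_nonneg_nonpos) auto
qed

lemma cutoff_bounds: "0 \<le> cutoff m x" "cutoff m x \<le> 1"
proof -
  have "flat 0 t \<le> 1" for t by (simp add: flat_def)
  then show "0 \<le> cutoff m x" "cutoff m x \<le> 1" by (simp_all only: cutoff_def flat_nonneg)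
qed

lemma cutoff_tendsto: 
  assumes "norm x < 1" shows "(\<lambda>m. cutoff m x) \<longlonglongrightarrow> 1"
proof -
  have x: "x \<bullet> x < 1" using assms by (rule norm_sq_less_1)
  have "(\<lambda>m. exp (- (inverse (real (Suc m)) * inverse (1 - x \<bullet> x)))) \<longlonglongrightarrow> exp (- (0 * inverse (1 - x \<bullet> x)))"
    by (intro tendsto_intros LIMSEQ_inverse_real_of_nat)
  moreover have "cutoff m x = exp (- (inverse (real (Suc m)) * inverse (1 - x \<bullet> x)))" for m
  proof -
    have pos: "real (Suc m) * (1 - x \<bullet> x) > 0" using x by (intro mult_pos_pos) auto
    show ?thesis
      unfolding cutoff_def flat_def if_P[OF pos] by (simp only: inverse_mult_distrib power_0 mult_1_right)
  qed
  ultimately show ?thesis by simp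
qed

text \<open>With t = 1 - |x|^2 and y = 1 / ((m + 1) t) the derivative is at most 2 y exp (-y) / t.
  The estimate y exp (-y) <= 1 gives a majorant independent of \<open>m\<close>, and exp (-y) <= 1
  gives decay in \<open>m\<close> at each point.\<close>

lemma partial_deriv_cutoff:
  assumes i: "i \<in> Basis" and x: "norm x < 1"
  shows "\<bar>partial_deriv i (cutoff m) x\<bar> \<le> 2 * inverse (1 - x \<bullet> x)"
    and "\<bar>partial_deriv i (cutoff m) x\<bar> \<le> 2 * (inverse (1 - x \<bullet> x))\<^sup>2 * inverse (real (Suc m))"
proof -
  define t where "t = 1 - x \<bullet> x"
  define M where "M = real (Suc m)"
  have t: "t > 0" and M: "M > 0" using norm_sq_less_1[OF x] by (auto simp: t_def M_def)
  have "((\<lambda>x. M * (1 - x \<bullet> x)) has_derivative (\<lambda>h. M * - (2 * (x \<bullet> h)))) (at x)"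
    by (auto intro!: derivative_eq_intros simp: inner_commute)
  moreover have "(flat 0 has_derivative (\<lambda>h. flat 2 (M * (1 - x \<bullet> x)) * h)) (at (M * (1 - x \<bullet> x)))"
    using flat_has_derivative[of 0 "M * (1 - x \<bullet> x)"] by (simp add: has_field_derivative_def numeral_2_eq_2)
  ultimately have "(cutoff m has_derivative (\<lambda>h. flat 2 (M * t) * (M * - (2 * (x \<bullet> h))))) (at x)"
    unfolding cutoff_def[abs_def] M_def[symmetric] t_def by (rule has_derivative_compose)
  then have eq: "partial_deriv i (cutoff m) x = flat 2 (M * t) * (M * - (2 * (x \<bullet> i)))"
    by (rule partial_deriv_eq)
  have xi: "\<bar>x \<bullet> i\<bar> \<le> 1" using Basis_le_norm[OF i, of x] x by simp
  have "\<bar>partial_deriv i (cutoff m) x\<bar> = (flat 2 (M * t) * M * 2) * \<bar>x \<bullet> i\<bar>"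
    using M flat_nonneg[of 2 "M * t"] by (simp add: eq abs_mult)
  also have "\<dots> \<le> (flat 2 (M * t) * M * 2) * 1"
    using M xi flat_nonneg[of 2 "M * t"] by (intro mult_left_mono) auto
  finally have le: "\<bar>partial_deriv i (cutoff m) x\<bar> \<le> 2 * (flat 2 (M * t) * M)" by simp
  define y where "y = inverse (M * t)"
  have y: "y > 0" using M t by (simp add: y_def)
  have fl: "flat 2 (M * t) * M = exp (- y) * y * inverse t"
    using M t by (simp add: flat_def y_def power2_eq_square field_simps)
  have "y \<le> exp y" using exp_ge_add_one_self[of y] by linarith
  then have "y * exp (- y) \<le> 1" by (simp add: exp_minus field_simps)
  then have "exp (- y) * y * inverse t \<le> 1 * inverse t" using t by (intro mult_right_mono) (auto simp: mult.commute)
  with le fl show "\<bar>partial_deriv i (cutoff m) x\<bar> \<le> 2 * inverse (1 - x \<bullet> x)" by (simp add: t_def)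
  have "exp (- y) * y * inverse t \<le> 1 * y * inverse t" using y t by (intro mult_right_mono) auto
  also have "\<dots> = (inverse t)\<^sup>2 * inverse M" by (simp add: y_def power2_eq_square)
  finally show "\<bar>partial_deriv i (cutoff m) x\<bar> \<le> 2 * (inverse (1 - x \<bullet> x))\<^sup>2 * inverse (real (Suc m))"
    using le fl by (simp add: t_def M_def)
qed

text \<open>Functions vanishing outside the ball are dense among those with zero trace: multiply by
  \<open>cutoff m\<close>, whose gradient is controlled by Hardy's inequality.\<close>

lemma orthogonal_trace_0:
  fixes P :: "'a::euclidean_space \<Rightarrow> 'a \<Rightarrow> complex"
  assumes P: "\<And>i. i \<in> Basis \<Longrightarrow> square_integrable vol (P i)"
    and test: "\<And>\<xi>. smooth \<xi> \<Longrightarrow> (\<And>x. norm x \<ge> 1 \<Longrightarrow> \<xi> x = 0) \<Longrightarrow>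
      (\<Sum>i\<in>Basis. LINT x|vol. P i x * partial_deriv i \<xi> x) = 0"
    and v: "has_trace v H (\<lambda>_. 0)"
  shows "(\<Sum>i\<in>Basis. LINT x|vol. P i x * H i x) = 0"
proof -
  obtain \<Phi> where \<Phi>: "H1_lim \<Phi> v H"
    using v by (auto simp: has_trace_iff)
  note l = H1_limD[OF \<Phi>]
  have sc: "smooth (\<lambda>x::'a. complex_of_real (cutoff m x))" for m by (rule smooth_of_real[OF smooth_cutoff])
  have pd: "partial_deriv i (\<lambda>x::'a. complex_of_real (cutoff m x)) x = of_real (partial_deriv i (cutoff m) x)" for m x i
    by (rule partial_deriv_of_real[OF smooth_cutoff])
  \<comment> \<open>For fixed \<open>m\<close> the functions \<open>cutoff m x * \<Phi> k x\<close>
    are smooth and vanish off the ball, so \<open>test\<close> applies; first \<open>k\<close>, then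
    \<open>m\<close> tends to infinity.\<close>
  have zero: "(\<Sum>i\<in>Basis. LINT x|vol. P i x * (of_real (cutoff m x) * H i x + of_real (partial_deriv i (cutoff m) x) * v x)) = 0" for m
  proof -
    have L: "H1_lim (\<lambda>k x. of_real (cutoff m x) * \<Phi> k x) (\<lambda>x. of_real (cutoff m x) * v x)
        (\<lambda>i x. of_real (cutoff m x) * H i x + of_real (partial_deriv i (cutoff m) x) * v x)"
      using H1_lim_mult[OF sc \<Phi>, of m] by (simp add: pd)
    note l' = H1_limD[OF L]
    have "(\<lambda>k. \<Sum>i\<in>Basis. LINT x|vol. P i x * partial_deriv i (\<lambda>x. of_real (cutoff m x) * \<Phi> k x) x) \<longlonglongrightarrow>
      (\<Sum>i\<in>Basis. LINT x|vol. P i x * (of_real (cutoff m x) * H i x + of_real (partial_deriv i (cutoff m) x) * v x))"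
      by (intro tendsto_sum L2_lim_integral_mult L2_lim_const P l')
    moreover have "(\<Sum>i\<in>Basis. LINT x|vol. P i x * partial_deriv i (\<lambda>x. of_real (cutoff m x) * \<Phi> k x) x) = 0" for k
      by (rule test) (auto intro!: l'(1) simp: cutoff_eq_0)
    ultimately show ?thesis by (simp add: LIMSEQ_const_iff)
  qed
  \<comment> \<open>Near the sphere the gradient of \<open>cutoff m\<close> may grow like the
    inverse of 1 - |x|^2. Its product with \<open>v\<close> is dominated by 2 |W|, which Hardy's
    inequality makes square integrable.\<close>
  define W where "W x = of_real (inverse (1 - x \<bullet> x)) * v x" for x
  have W: "square_integrable vol W"
    unfolding W_def[abs_def] by (rule Hardy_weight[OF v])
  have "(\<lambda>m. LINT x|vol. P i x * (of_real (cutoff m x) * H i x + of_real (partial_deriv i (cutoff m) x) * v x))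
      \<longlonglongrightarrow> (LINT x|vol. P i x * H i x)" if i: "i \<in> Basis" for i
  proof (rule integral_dominated_convergence)
    have m1: "P i \<in> borel_measurable vol" "H i \<in> borel_measurable vol" "v \<in> borel_measurable vol"
      using P[OF i] l(2) l(4)[OF i] by (simp_all add: square_integrable_borel)
    have m2: "(\<lambda>x::'a. complex_of_real (cutoff m x)) \<in> borel_measurable vol"
      "(\<lambda>x::'a. complex_of_real (partial_deriv i (cutoff m) x)) \<in> borel_measurable vol" for m
      by (intro borel_measurable_ball_measure smooth_borel_measurable sc smooth_of_real smooth_partial_deriv smooth_cutoff i)+
    show "(\<lambda>x. P i x * H i x) \<in> borel_measurable vol" by (intro borel_measurable_times m1)
    show "(\<lambda>x. P i x * (of_real (cutoff m x) * H i x + of_real (partial_deriv i (cutoff m) x) * v x)) \<in> borel_measurable vol" for m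
      by (intro borel_measurable_times borel_measurable_add m1 m2)
    show "integrable vol (\<lambda>x. cmod (P i x) * cmod (H i x) + 2 * (cmod (P i x) * cmod (W x)))"
      using square_integrable_imp_integrable(2)[OF P[OF i] l(4)[OF i]] square_integrable_imp_integrable(2)[OF P[OF i] W] by simp
    show "AE x in vol. norm (P i x * (of_real (cutoff m x) * H i x + of_real (partial_deriv i (cutoff m) x) * v x))
        \<le> cmod (P i x) * cmod (H i x) + 2 * (cmod (P i x) * cmod (W x))" for m
    proof (rule AE_I2)
      fix x :: 'a assume "x \<in> space vol"
      then have x: "norm x < 1" by simp
      have "cmod (of_real (cutoff m x) * H i x) \<le> 1 * cmod (H i x)"
        unfolding norm_mult using cutoff_bounds[of m x] by (intro mult_right_mono) auto
      moreover have "cmod (of_real (partial_deriv i (cutoff m) x) * v x) \<le> (2 * inverse (1 - x \<bullet> x)) * cmod (v x)"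
        unfolding norm_mult using partial_deriv_cutoff(1)[OF i x, of m] by (intro mult_right_mono) auto
      moreover have "cmod (W x) = inverse (1 - x \<bullet> x) * cmod (v x)"
        unfolding W_def norm_mult norm_of_real using norm_sq_less_1[OF x] by simp
      ultimately have "cmod (of_real (cutoff m x) * H i x + of_real (partial_deriv i (cutoff m) x) * v x) \<le> cmod (H i x) + 2 * cmod (W x)"
        using norm_triangle_ineq[of "of_real (cutoff m x) * H i x" "of_real (partial_deriv i (cutoff m) x) * v x"] by simp
      then have "cmod (P i x) * cmod (of_real (cutoff m x) * H i x + of_real (partial_deriv i (cutoff m) x) * v x) \<le> cmod (P i x) * (cmod (H i x) + 2 * cmod (W x))"
        by (rule mult_left_mono) simp
      then show "norm (P i x * (of_real (cutoff m x) * H i x + of_real (partial_deriv i (cutoff m) x) * v x))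
        \<le> cmod (P i x) * cmod (H i x) + 2 * (cmod (P i x) * cmod (W x))"
        unfolding norm_mult[of "P i x"] by (simp add: distrib_left mult_ac)
    qed
    show "AE x in vol. (\<lambda>m. P i x * (of_real (cutoff m x) * H i x + of_real (partial_deriv i (cutoff m) x) * v x)) \<longlonglongrightarrow> P i x * H i x"
    proof (rule AE_I2)
      fix x :: 'a assume "x \<in> space vol"
      then have x: "norm x < 1" by simp
      have "(\<lambda>m. partial_deriv i (cutoff m) x) \<longlonglongrightarrow> 0"
      proof (rule Lim_null_comparison)
        show "\<forall>\<^sub>F m in sequentially. norm (partial_deriv i (cutoff m) x) \<le> 2 * (inverse (1 - x \<bullet> x))\<^sup>2 * inverse (real (Suc m))"
          using partial_deriv_cutoff(2)[OF i x] by simp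
        show "(\<lambda>m. 2 * (inverse (1 - x \<bullet> x))\<^sup>2 * inverse (real (Suc m))) \<longlonglongrightarrow> 0"
          by (rule tendsto_mult_right_zero[OF LIMSEQ_inverse_real_of_nat])
      qed
      then have "(\<lambda>m. P i x * (of_real (cutoff m x) * H i x + of_real (partial_deriv i (cutoff m) x) * v x)) \<longlonglongrightarrow> P i x * (of_real 1 * H i x + of_real 0 * v x)"
        by (intro tendsto_intros cutoff_tendsto x)
      then show "(\<lambda>m. P i x * (of_real (cutoff m x) * H i x + of_real (partial_deriv i (cutoff m) x) * v x)) \<longlonglongrightarrow> P i x * H i x"
        by simp
    qed
  qed
  then have "(\<lambda>m. \<Sum>i\<in>Basis. LINT x|vol. P i x * (of_real (cutoff m x) * H i x + of_real (partial_deriv i (cutoff m) x) * v x))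
      \<longlonglongrightarrow> (\<Sum>i\<in>Basis. LINT x|vol. P i x * H i x)"
    by (rule tendsto_sum)
  then show ?thesis by (simp add: zero LIMSEQ_const_iff)
qed

section \<open>Harmonic extensions and the Dirichlet-to-Neumann map\<close>

lemma L2_norm_sq_complex: "of_real ((L2_norm M w)\<^sup>2) = (LINT x|M. w x * cnj (w x))"
  unfolding complex_norm_square[symmetric] by (simp add: L2_norm_sq del: of_real_power)

lemma L2_norm_sq_add:
  assumes u: "square_integrable M u" and v: "square_integrable M v"
  shows "(L2_norm M (\<lambda>x. u x + c * v x))\<^sup>2 =
    (L2_norm M u)\<^sup>2 + 2 * Re (cnj c * (LINT x|M. u x * cnj (v x))) + (cmod c)\<^sup>2 * (L2_norm M v)\<^sup>2"
proof -
  define I where "I = (LINT x|M. u x * cnj (v x))"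
  have int: "integrable M (\<lambda>x. u x * cnj (u x))" "integrable M (\<lambda>x. u x * cnj (v x))"
    "integrable M (\<lambda>x. v x * cnj (u x))" "integrable M (\<lambda>x. v x * cnj (v x))"
    by (intro square_integrable_imp_integrable square_integrable_cnj u v)+
  have "(LINT x|M. v x * cnj (u x)) = (LINT x|M. cnj (u x * cnj (v x)))" by (simp add: mult.commute)
  then have I': "(LINT x|M. v x * cnj (u x)) = cnj I" by (simp add: I_def del: complex_cnj_mult)
  have "of_real ((L2_norm M (\<lambda>x. u x + c * v x))\<^sup>2)
     = (LINT x|M. u x * cnj (u x) + (cnj c * (u x * cnj (v x)) + (c * (v x * cnj (u x)) + (c * cnj c) * (v x * cnj (v x)))))"
    unfolding L2_norm_sq_complex by (simp add: algebra_simps)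
  also have "\<dots> = of_real ((L2_norm M u)\<^sup>2) + (cnj c * I + (c * cnj I + of_real ((cmod c)\<^sup>2) * of_real ((L2_norm M v)\<^sup>2)))"
    unfolding complex_norm_square L2_norm_sq_complex using int by (simp add: I_def[symmetric] I')
  also have "\<dots> = of_real ((L2_norm M u)\<^sup>2 + 2 * Re (cnj c * I) + (cmod c)\<^sup>2 * (L2_norm M v)\<^sup>2)"
    by (simp add: complex_eq_iff)
  finally show ?thesis unfolding of_real_eq_iff I_def .
qed

lemma energy_add:
  assumes "\<And>i. i \<in> Basis \<Longrightarrow> square_integrable vol (G i)"
    "\<And>i. i \<in> Basis \<Longrightarrow> square_integrable vol (H i)"
  shows "energy (\<lambda>i x. G i x + c * H i x) =
    energy G + 2 * Re (cnj c * (\<Sum>i\<in>Basis. LINT x|vol. G i x * cnj (H i x))) + (cmod c)\<^sup>2 * energy H"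
  unfolding energy_def sum_distrib_left Re_sum sum.distrib[symmetric]
  by (rule sum.cong) (simp_all add: L2_norm_sq_add assms)

lemma energy_parallelogram:
  assumes "\<And>i. i \<in> Basis \<Longrightarrow> square_integrable vol (G i)"
    "\<And>i. i \<in> Basis \<Longrightarrow> square_integrable vol (H i)"
  shows "energy (\<lambda>i x. G i x - H i x) + energy (\<lambda>i x. G i x + H i x) = 2 * energy G + 2 * energy H"
  using energy_add[OF assms, where c = "-1"] energy_add[OF assms, where c = 1] by simp

lemma energy_cmult: "energy (\<lambda>i x. c * G i x) = (cmod c)\<^sup>2 * energy G"
  by (simp add: energy_def L2_norm_mult power_mult_distrib sum_distrib_left)

lemma L2_norm_le_energy: "i \<in> Basis \<Longrightarrow> L2_norm vol (G i) \<le> sqrt (energy G)"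
  unfolding energy_def by (intro real_le_rsqrt member_le_sum) auto

lemma has_trace_approx:
  fixes G :: "'a::euclidean_space \<Rightarrow> 'a \<Rightarrow> complex"
  assumes "has_trace u G f" "e > 0"
  shows "\<exists>\<phi>. smooth \<phi> \<and> L2_norm vol (\<lambda>x. \<phi> x - u x) < e \<and>
    (\<forall>i\<in>Basis. L2_norm vol (\<lambda>x. partial_deriv i \<phi> x - G i x) < e) \<and>
    L2_norm sphere_measure (\<lambda>x. \<phi> x - f x) < e"
proof -
  obtain \<Phi> where \<Phi>: "H1_lim \<Phi> u G" "L2_lim sphere_measure \<Phi> f"
    using assms(1) by (auto simp: has_trace_iff)
  have "\<forall>\<^sub>F k in sequentially. L2_norm vol (\<lambda>x. \<Phi> k x - u x) < e"
    "\<forall>\<^sub>F k in sequentially. L2_norm sphere_measure (\<lambda>x. \<Phi> k x - f x) < e"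
    using H1_limD(3)[OF \<Phi>(1)] \<Phi>(2) assms(2) by (auto simp: L2_lim_def dest: order_tendstoD)
  moreover have "\<forall>\<^sub>F k in sequentially. \<forall>i\<in>Basis. L2_norm vol (\<lambda>x. partial_deriv i (\<Phi> k) x - G i x) < e"
    using H1_limD(5)[OF \<Phi>(1)] assms(2)
    by (intro eventually_ball_finite) (auto simp: L2_lim_def dest: order_tendstoD)
  ultimately have "\<forall>\<^sub>F k in sequentially. L2_norm vol (\<lambda>x. \<Phi> k x - u x) < e \<and>
     (\<forall>i\<in>Basis. L2_norm vol (\<lambda>x. partial_deriv i (\<Phi> k) x - G i x) < e) \<and>
     L2_norm sphere_measure (\<lambda>x. \<Phi> k x - f x) < e"
    by eventually_elim blast
  then obtain k where "L2_norm vol (\<lambda>x. \<Phi> k x - u x) < e \<and>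
     (\<forall>i\<in>Basis. L2_norm vol (\<lambda>x. partial_deriv i (\<Phi> k) x - G i x) < e) \<and>
     L2_norm sphere_measure (\<lambda>x. \<Phi> k x - f x) < e"
    by (auto dest: eventually_happens)
  then show ?thesis using H1_limD(1)[OF \<Phi>(1), of k] by blast
qed

text \<open>A diagonal choice: approximate the \<open>k\<close>-th function with error below 1 / (k
  + 1) in the ball, in the gradient and on the sphere. The trace is the same \<open>f\<close> for
  all \<open>k\<close>, so the boundary error is directly \<open>e k\<close>.\<close>

lemma has_trace_closed:
  fixes G :: "nat \<Rightarrow> 'a::euclidean_space \<Rightarrow> 'a \<Rightarrow> complex"
  assumes tr: "\<And>k. has_trace (u k) (G k) f"
    and lu: "L2_lim vol u U" "square_integrable vol U"
    and lG: "\<And>i. i \<in> Basis \<Longrightarrow> L2_lim vol (\<lambda>k. G k i) (W i)"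
      "\<And>i. i \<in> Basis \<Longrightarrow> square_integrable vol (W i)"
  shows "has_trace U W f"
proof -
  define e where "e k = inverse (real (Suc k))" for k
  have e: "e k > 0" "e \<longlonglongrightarrow> 0" for k
    unfolding e_def by (simp, rule LIMSEQ_inverse_real_of_nat)
  have "\<forall>k. \<exists>\<phi>. smooth \<phi> \<and> L2_norm vol (\<lambda>x. \<phi> x - u k x) < e k \<and>
    (\<forall>i\<in>Basis. L2_norm vol (\<lambda>x. partial_deriv i \<phi> x - G k i x) < e k) \<and>
    L2_norm sphere_measure (\<lambda>x. \<phi> x - f x) < e k"
    using has_trace_approx[OF tr e(1)] by blast
  then obtain \<Phi> where \<Phi>: "\<And>k. smooth (\<Phi> k)" "\<And>k. L2_norm vol (\<lambda>x. \<Phi> k x - u k x) < e k"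
    "\<And>k i. i \<in> Basis \<Longrightarrow> L2_norm vol (\<lambda>x. partial_deriv i (\<Phi> k) x - G k i x) < e k"
    "\<And>k. L2_norm sphere_measure (\<lambda>x. \<Phi> k x - f x) < e k"
    by (auto dest!: choice)
  have lim: "L2_lim vol \<Psi> w"
    if "\<And>k. smooth (\<Psi> k)" "\<And>k. L2_norm vol (\<lambda>x. \<Psi> k x - g k x) < e k" "L2_lim vol g w"
      "\<And>k. square_integrable vol (g k)" "square_integrable vol w" for \<Psi> g and w :: "'a \<Rightarrow> complex"
  proof (rule L2_limI)
    show "L2_norm vol (\<lambda>x. \<Psi> k x - w x) \<le> e k + L2_norm vol (\<lambda>x. g k x - w x)" for k
      using L2_norm_triangle_diff[OF smooth_square_integrable_ball[OF that(1)] that(4,5), of k k] that(2)[of k] by simp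
    show "(\<lambda>k. e k + L2_norm vol (\<lambda>x. g k x - w x)) \<longlonglongrightarrow> 0"
      using tendsto_add[OF e(2) that(3)[unfolded L2_lim_def]] by simp
  qed
  have "H1_lim \<Phi> U W"
    unfolding H1_lim_def
  proof (intro conjI allI ballI)
    show "L2_lim vol \<Phi> U" by (rule lim[OF \<Phi>(1,2) lu(1) has_traceD(1)[OF tr] lu(2)])
    show "L2_lim vol (\<lambda>k. partial_deriv i (\<Phi> k)) (W i)" if "i \<in> Basis" for i
      by (rule lim[OF smooth_partial_deriv[OF \<Phi>(1) that] \<Phi>(3)[OF that] lG(1)[OF that] has_traceD(2)[OF tr that] lG(2)[OF that]])
  qed (use \<Phi> lu lG in auto)
  moreover have "L2_lim sphere_measure \<Phi> f"
    by (rule L2_limI[OF less_imp_le[OF \<Phi>(4)] e(2)])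
  ultimately show ?thesis using has_traceD(3)[OF tr] unfolding has_trace_iff by blast
qed

text \<open>By the parallelogram law a minimising sequence has Cauchy gradients. Differences have
  zero trace, so Poincare's inequality makes the functions Cauchy too, and
  \<open>has_trace_closed\<close> keeps the boundary values of the limit.\<close>

lemma harmonic_extension_exists:
  fixes f :: "'a::euclidean_space \<Rightarrow> complex"
  assumes "f \<in> H_half"
  obtains F G where "has_trace F G f"
    "\<And>v H. has_trace v H (\<lambda>_. 0) \<Longrightarrow> (\<Sum>i\<in>Basis. LINT x|vol. G i x * H i x) = 0"
proof -
  define A where "A = {energy G | u G. has_trace u G f}"
  have ne: "A \<noteq> {}" using assms by (auto simp: A_def H_half_def)
  have bdd: "bdd_below A" by (rule bdd_belowI[of _ 0]) (auto simp: A_def)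
  define m where "m = Inf A"
  have m: "m \<le> energy G" if "has_trace u G f" for u G
    unfolding m_def using that by (intro cInf_lower bdd) (auto simp: A_def)
  define e where "e k = inverse (real (Suc k))" for k
  have e: "e k > 0" for k by (simp add: e_def)
  have "\<exists>u G. has_trace u G f \<and> energy G < m + e k" for k
    using cInf_lessD[OF ne, of "m + e k"] e[of k] by (auto simp: m_def A_def)
  then obtain u G where tr: "\<And>k. has_trace (u k) (G k) f" and en: "\<And>k. energy (G k) < m + e k" by metis
  note si = has_traceD[OF tr]
  \<comment> \<open>The mean of two competitors is again a competitor, so the energy of the sum is
    at least 4 m.\<close>
  have dist: "energy (\<lambda>i x. G k i x - G j i x) \<le> 4 * e N" if "k \<ge> N" "j \<ge> N" for k j N
  proof -
    have "has_trace (\<lambda>x. 1/2 * (u k x + u j x)) (\<lambda>i x. 1/2 * (G k i x + G j i x)) (\<lambda>x. 1/2 * (f x + f x))"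
      by (intro has_trace_cmult has_trace_add tr)
    then have "has_trace (\<lambda>x. 1/2 * (u k x + u j x)) (\<lambda>i x. 1/2 * (G k i x + G j i x)) f" by simp
    from m[OF this] have "4 * m \<le> energy (\<lambda>i x. G k i x + G j i x)"
      unfolding energy_cmult by (simp add: power2_eq_square)
    moreover have "e k \<le> e N" "e j \<le> e N" using that by (auto simp: e_def)
    ultimately show ?thesis
      using energy_parallelogram[of "G k" "G j", OF si(2) si(2)] en[of k] en[of j] by simp
  qed
  have small: "\<exists>N. 2 * sqrt (4 * e N) < r" if "r > 0" for r :: real
  proof -
    obtain N where "e N < r\<^sup>2 / 16" using reals_Archimedean[of "r\<^sup>2 / 16"] \<open>r > 0\<close> by (auto simp: e_def)
    then have "sqrt (16 * e N) < sqrt (r\<^sup>2)" by (intro real_sqrt_less_mono) simp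
    then have "sqrt (16 * e N) < r" using that by simp
    moreover have "sqrt (16 * e N) = 2 * sqrt (4 * e N)"
      using real_sqrt_mult[of 4 "4 * e N"] by simp
    ultimately show ?thesis by metis
  qed
  have P: "L2_norm vol (\<lambda>x. u k x - u j x) \<le> 2 * sqrt (4 * e N)" if "k \<ge> N" "j \<ge> N" for k j N
  proof -
    have "has_trace (\<lambda>x. u k x - u j x) (\<lambda>i x. G k i x - G j i x) (\<lambda>x. 0)"
      using has_trace_diff[OF tr tr, of k j] by simp
    from Poincare_trace_0[OF this] show ?thesis
      using dist[OF that] by (meson order_trans mult_left_mono real_sqrt_le_mono zero_le_numeral)
  qed
  have P': "L2_norm vol (\<lambda>x. G k i x - G j i x) \<le> 2 * sqrt (4 * e N)" if "k \<ge> N" "j \<ge> N" "i \<in> Basis" for k j N i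
  proof -
    have "L2_norm vol (\<lambda>x. G k i x - G j i x) \<le> sqrt (energy (\<lambda>i x. G k i x - G j i x))"
      using L2_norm_le_energy[OF that(3), of "\<lambda>i x. G k i x - G j i x"] .
    also have "\<dots> \<le> sqrt (4 * e N)" using dist[OF that(1,2)] by simp
    also have "\<dots> \<le> 2 * sqrt (4 * e N)" using e[of N] by simp
    finally show ?thesis .
  qed
  have "\<exists>U. square_integrable vol U \<and> L2_lim vol u U"
  proof (rule L2_complete[OF si(1)])
    fix r :: real assume "r > 0"
    then show "\<exists>N. \<forall>m\<ge>N. \<forall>n\<ge>N. L2_norm vol (\<lambda>x. u m x - u n x) < r"
      using small P by (meson order.strict_trans1)
  qed
  then obtain U where U: "square_integrable vol U" "L2_lim vol u U" by blast
  have "\<forall>i\<in>Basis. \<exists>W. square_integrable vol W \<and> L2_lim vol (\<lambda>k. G k i) W"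
  proof (intro ballI L2_complete[OF si(2)])
    fix i :: 'a and r :: real assume "i \<in> Basis" "r > 0"
    then show "\<exists>N. \<forall>m\<ge>N. \<forall>n\<ge>N. L2_norm vol (\<lambda>x. G m i x - G n i x) < r"
      using small P' by (meson order.strict_trans1)
  qed
  then obtain W where W: "\<And>i. i \<in> Basis \<Longrightarrow> square_integrable vol (W i)"
      "\<And>i. i \<in> Basis \<Longrightarrow> L2_lim vol (\<lambda>k. G k i) (W i)" by metis
  have trU: "has_trace U W f" by (rule has_trace_closed[OF tr U(2,1) W(2,1)])
  have "(\<lambda>k. energy (G k)) \<longlonglongrightarrow> energy W"
    unfolding energy_def by (intro tendsto_sum tendsto_power L2_lim_norm W si(2))
  moreover have "(\<lambda>k. m + e k) \<longlonglongrightarrow> m + 0"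
    unfolding e_def by (intro tendsto_intros LIMSEQ_inverse_real_of_nat)
  ultimately have min: "energy W \<le> m"
    using en by (intro LIMSEQ_le[of "\<lambda>k. energy (G k)" _ "\<lambda>k. m + e k"]) (auto intro: less_imp_le)
  have orth: "(\<Sum>i\<in>Basis. LINT x|vol. W i x * H i x) = 0" if v: "has_trace v H (\<lambda>_. 0)" for v H
  proof -
    define I where "I = (\<Sum>i\<in>Basis. LINT x|vol. W i x * H i x)"
    have v': "has_trace (\<lambda>x. cnj (v x)) (\<lambda>i x. cnj (H i x)) (\<lambda>_. 0)"
      using has_trace_cnj[OF v] by simp
    define E where "E = energy (\<lambda>i x. cnj (H i x))"
    have E: "E \<ge> 0" by (simp add: E_def)
    have ineq: "2 * (cmod I)\<^sup>2 \<le> s * ((cmod I)\<^sup>2 * E)" if s: "s > 0" for s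
    proof -
      \<comment> \<open>The energy is Hermitian while the claim is bilinear, so the variation is
        along the conjugate of \<open>v\<close>. The coefficient makes the linear term real and
        equal to -2 s |I|^2.\<close>
      define c where "c = - of_real s * I"
      have "has_trace (\<lambda>x. U x + c * cnj (v x)) (\<lambda>i x. W i x + c * cnj (H i x)) (\<lambda>x. f x + c * 0)"
        by (rule has_trace_add[OF trU has_trace_cmult[OF v']])
      then have "has_trace (\<lambda>x. U x + c * cnj (v x)) (\<lambda>i x. W i x + c * cnj (H i x)) f" by simp
      from m[OF this] have "energy W \<le> energy (\<lambda>i x. W i x + c * cnj (H i x))" using min by simp
      also have "\<dots> = energy W + 2 * Re (cnj c * I) + (cmod c)\<^sup>2 * E"
        using energy_add[of W "\<lambda>i x. cnj (H i x)" c, OF W(1) has_traceD(2)[OF v']] by (simp add: I_def E_def)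
      also have "cnj c * I = - of_real (s * (cmod I)\<^sup>2)"
        using complex_norm_square[of I] by (simp add: c_def mult_ac)
      finally have "2 * (s * (cmod I)\<^sup>2) \<le> s\<^sup>2 * (cmod I)\<^sup>2 * E"
        by (simp add: c_def norm_mult power_mult_distrib)
      then have "s * (2 * (cmod I)\<^sup>2) \<le> s * (s * ((cmod I)\<^sup>2 * E))" by (simp add: power2_eq_square mult_ac)
      then show ?thesis using s by simp
    qed
    \<comment> \<open>This \<open>s\<close> makes s E <= 1 and covers E = 0 as well.\<close>
    have "2 * (cmod I)\<^sup>2 \<le> (1 / (E + 1)) * ((cmod I)\<^sup>2 * E)" using E by (intro ineq) simp
    also have "\<dots> = (cmod I)\<^sup>2 * (E / (E + 1))" by simp
    also have "\<dots> \<le> (cmod I)\<^sup>2 * 1" using E by (intro mult_left_mono) auto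
    finally have "(cmod I)\<^sup>2 \<le> 0" by simp
    then show ?thesis by (simp add: I_def)
  qed
  show thesis by (rule that[OF trU orth])
qed

section \<open>The Dirichlet-to-Neumann form is well defined\<close>

definition grad_form :: "('a::euclidean_space \<Rightarrow> 'a \<Rightarrow> complex) \<Rightarrow> ('a \<Rightarrow> 'a \<Rightarrow> complex) \<Rightarrow> complex" where
  "grad_form G H = (\<Sum>i\<in>Basis. LINT x|vol. G i x * H i x)"

text \<open>The potential is controlled on the closed ball only. Its smooth extension
  \<open>q'\<close> supplies measurability and bounds, and the integrals do not see the
  difference.\<close>

lemma schroedinger_form_integrable:
  assumes "\<And>x. norm x \<le> 1 \<Longrightarrow> q x = q' x" "smooth q'"
    "square_integrable vol u" "\<And>i. i \<in> Basis \<Longrightarrow> square_integrable vol (G i)"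
    "square_integrable vol v" "\<And>i. i \<in> Basis \<Longrightarrow> square_integrable vol (H i)"
  shows "integrable vol (\<lambda>x. (\<Sum>i\<in>Basis. G i x * H i x) + of_real (q x) * u x * v x)"
    "schroedinger_form q u G v H = grad_form G H + (LINT x|vol. of_real (q' x) * u x * v x)"
proof -
  have q': "smooth (\<lambda>x. complex_of_real (q' x))" by (rule smooth_of_real[OF assms(2)])
  have int: "integrable vol (\<lambda>x. G i x * H i x)" if "i \<in> Basis" for i
    by (intro square_integrable_imp_integrable assms that)
  have int2: "integrable vol (\<lambda>x. of_real (q' x) * u x * v x)"
    by (intro square_integrable_imp_integrable square_integrable_smooth_mult q' assms)
  show "integrable vol (\<lambda>x. (\<Sum>i\<in>Basis. G i x * H i x) + of_real (q x) * u x * v x)"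
    using int int2 by (subst Bochner_Integration.integrable_cong[OF refl, of _ _ "\<lambda>x. (\<Sum>i\<in>Basis. G i x * H i x) + of_real (q' x) * u x * v x"])
      (auto simp: assms(1))
  have "schroedinger_form q u G v H = (LINT x|vol. (\<Sum>i\<in>Basis. G i x * H i x) + of_real (q' x) * u x * v x)"
    unfolding schroedinger_form_def
    by (rule Bochner_Integration.integral_cong) (auto simp: assms(1))
  also have "\<dots> = grad_form G H + (LINT x|vol. of_real (q' x) * u x * v x)"
    using int int2 by (simp add: grad_form_def)
  finally show "schroedinger_form q u G v H = grad_form G H + (LINT x|vol. of_real (q' x) * u x * v x)" .
qed

text \<open>Two choices of \<open>v\<close> differ by a function of zero trace, which a solution
  annihilates. Two solutions differ by some \<open>w\<close> of zero trace; tested against its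
  conjugate, it yields almost everywhere a vanishing gradient and q |w|^2 = 0 since \<open>q\<close>
  is nonnegative. Hence both terms of the form vanish.\<close>

lemma DN_eq:
  fixes q :: "'a::euclidean_space \<Rightarrow> real"
  assumes q: "\<And>x. norm x \<le> 1 \<Longrightarrow> q x = q' x" "smooth q'" "\<And>x. norm x \<le> 1 \<Longrightarrow> 0 \<le> q x"
    and u: "dirichlet_solution q f u G" and v: "has_trace v H g"
  shows "DN q f g = schroedinger_form q u G v H"
  unfolding DN_def
proof (rule the_equality)
  show "\<exists>u' G' v' H'. dirichlet_solution q f u' G' \<and> has_trace v' H' g \<and>
     schroedinger_form q u G v H = schroedinger_form q u' G' v' H'"
    using u v by blast
next
  fix c
  assume "\<exists>u' G' v' H'. dirichlet_solution q f u' G' \<and> has_trace v' H' g \<and> c = schroedinger_form q u' G' v' H'"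
  then obtain u' G' v' H' where u': "dirichlet_solution q f u' G'" and v': "has_trace v' H' g"
    and c: "c = schroedinger_form q u' G' v' H'" by blast
  have tu: "has_trace u G f" "has_trace u' G' f" using u u' by (auto simp: dirichlet_solution_def)
  have int: "integrable vol (\<lambda>x. (\<Sum>i\<in>Basis. A i x * B i x) + of_real (q x) * a x * b x)"
    if "has_trace a A k" "has_trace b B l" for a A k b B l
    by (rule schroedinger_form_integrable(1)[where q' = q'])
       (auto intro: q has_traceD[OF that(1)] has_traceD[OF that(2)])
  have tv0: "has_trace (\<lambda>x. v' x - v x) (\<lambda>i x. H' i x - H i x) (\<lambda>_. 0)"
    using has_trace_diff[OF v' v] by simp
  have "schroedinger_form q u' G' v' H' - schroedinger_form q u' G' v H
      = schroedinger_form q u' G' (\<lambda>x. v' x - v x) (\<lambda>i x. H' i x - H i x)"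
    unfolding schroedinger_form_def
      Bochner_Integration.integral_diff[OF int[OF tu(2) v'] int[OF tu(2) v], symmetric]
    by (rule Bochner_Integration.integral_cong) (simp_all add: algebra_simps sum_subtractf)
  also have "\<dots> = 0" using u' tv0 by (auto simp: dirichlet_solution_def)
  finally have 1: "c = schroedinger_form q u' G' v H" using c by simp
  define w where "w = (\<lambda>x. u' x - u x)"
  define D where "D = (\<lambda>i x. G' i x - G i x)"
  have tw: "has_trace w D (\<lambda>_. 0)"
    using has_trace_diff[OF tu(2,1)] by (simp add: w_def D_def)
  have diff: "schroedinger_form q u' G' z Z - schroedinger_form q u G z Z = schroedinger_form q w D z Z"
    if "has_trace z Z k" for z Z k
    unfolding schroedinger_form_def w_def D_def
      Bochner_Integration.integral_diff[OF int[OF tu(2) that] int[OF tu(1) that], symmetric]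
    by (rule Bochner_Integration.integral_cong) (simp_all add: algebra_simps sum_subtractf)
  have tz: "has_trace (\<lambda>x. cnj (w x)) (\<lambda>i x. cnj (D i x)) (\<lambda>_. 0)"
    using has_trace_cnj[OF tw] by simp
  then have "schroedinger_form q w D (\<lambda>x. cnj (w x)) (\<lambda>i x. cnj (D i x)) = 0"
    using diff[OF tz] u u' by (auto simp: dirichlet_solution_def)
  then have z: "(LINT x|vol. of_real ((\<Sum>i\<in>Basis. (cmod (D i x))\<^sup>2) + q x * (cmod (w x))\<^sup>2) :: complex) = 0"
    unfolding schroedinger_form_def
    by (simp add: complex_norm_square mult.assoc del: of_real_power)
  have i: "integrable vol (\<lambda>x. complex_of_real ((\<Sum>i\<in>Basis. (cmod (D i x))\<^sup>2) + q x * (cmod (w x))\<^sup>2))"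
    using int[OF tw tz]
    by (simp add: complex_norm_square mult.assoc del: of_real_power)
  then have i': "integrable vol (\<lambda>x. (\<Sum>i\<in>Basis. (cmod (D i x))\<^sup>2) + q x * (cmod (w x))\<^sup>2)"
    by (simp only: complex_of_real_integrable_eq)
  have z': "(LINT x|vol. (\<Sum>i\<in>Basis. (cmod (D i x))\<^sup>2) + q x * (cmod (w x))\<^sup>2) = 0"
    using z unfolding integral_complex_of_real by simp
  have nn: "0 \<le> (\<Sum>i\<in>Basis. (cmod (D i x))\<^sup>2)" "0 \<le> q x * (cmod (w x))\<^sup>2" if "norm x < 1" for x
    using q(3)[of x] that by (auto intro: sum_nonneg)
  have "AE x in vol. (\<Sum>i\<in>Basis. (cmod (D i x))\<^sup>2) + q x * (cmod (w x))\<^sup>2 = 0"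
    by (subst integral_nonneg_eq_0_iff_AE[OF i', symmetric]) (auto intro!: AE_I2 add_nonneg_nonneg nn z')
  then have "AE x in vol. (\<Sum>i\<in>Basis. D i x * H i x) + of_real (q x) * w x * v x = 0"
    using AE_space
  proof eventually_elim
    case (elim x)
    then have x: "norm x < 1" by simp
    have "(\<Sum>i\<in>Basis. (cmod (D i x))\<^sup>2) = 0" "q x * (cmod (w x))\<^sup>2 = 0" using elim(1) nn[OF x] by linarith+
    then have "\<forall>i\<in>Basis. D i x = 0" "q x = 0 \<or> w x = 0" by (auto simp: sum_nonneg_eq_0_iff)
    then show ?case by auto
  qed
  then have "schroedinger_form q w D v H = 0"
    unfolding schroedinger_form_def by (rule integral_eq_zero_AE)
  then show "c = schroedinger_form q u G v H" using 1 diff[OF v] by simp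
qed

section \<open>Averages over dilations\<close>

text \<open>The solution operator of x . grad h + (m + 1) h = f. In the application m = w_0 - 1/2 =
  3.\<close>

definition dil_avg :: "nat \<Rightarrow> ('a::euclidean_space \<Rightarrow> complex) \<Rightarrow> 'a \<Rightarrow> complex" where
  "dil_avg m f x = integral {0..1} (\<lambda>s::real. s ^ m *\<^sub>R f (s *\<^sub>R x))"

lemma smooth_dil_avg: "smooth f \<Longrightarrow> smooth (dil_avg m f)"
  unfolding dil_avg_def[abs_def] by (rule smooth_integral_dilate)

lemma partial_deriv_dil_avg:
  "smooth f \<Longrightarrow> partial_deriv i (dil_avg m f) = dil_avg (Suc m) (partial_deriv i f)"
  unfolding dil_avg_def[abs_def] by (rule ext) (rule partial_deriv_integral_dilate)

lemma dil_avg_integrable: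
  fixes f :: "'a::euclidean_space \<Rightarrow> complex"
  assumes "smooth f" shows "(\<lambda>s::real. s ^ m *\<^sub>R f (s *\<^sub>R x)) integrable_on {0..1}"
proof -
  have "continuous_on {0..1} (\<lambda>s. f (s *\<^sub>R x))"
    by (rule continuous_on_compose2[OF smooth_continuous_on[OF assms, of UNIV]]) (auto intro!: continuous_intros)
  then have "continuous_on {0..1} (\<lambda>s. s ^ m *\<^sub>R f (s *\<^sub>R x))"
    by (intro continuous_on_scaleR continuous_on_power continuous_on_id)
  then show ?thesis by (rule integrable_continuous_interval)
qed

lemma dil_avg_diff:
  "smooth f \<Longrightarrow> smooth g \<Longrightarrow> dil_avg m (\<lambda>x. f x - g x) = (\<lambda>x. dil_avg m f x - dil_avg m g x)"
  by (rule ext) (simp add: dil_avg_def scaleR_diff_right Henstock_Kurzweil_Integration.integral_diff dil_avg_integrable)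

text \<open>Integrate the s-derivative of \<open>s ^ Suc m *\<^sub>R f (s *\<^sub>R x)\<close> over
  [0, 1]; the lower limit contributes nothing because of the positive power of s.\<close>

lemma radial_deriv_dil_avg:
  assumes f: "smooth f"
  shows "radial_deriv (dil_avg m f) x + of_real (real (Suc m)) * dil_avg m f x = f x"
proof -
  define D where "D s = frechet_derivative f (at (s *\<^sub>R x)) x" for s :: real
  have Rh: "radial_deriv (dil_avg m f) x = integral {0..1} (\<lambda>s::real. s ^ Suc m *\<^sub>R D s)"
    using partial_deriv_integral_dilate[OF f, of x m x] unfolding radial_deriv_def partial_deriv_def dil_avg_def[abs_def] D_def .
  have d: "((\<lambda>s. s ^ Suc m *\<^sub>R f (s *\<^sub>R x)) has_vector_derivative
      (s ^ Suc m *\<^sub>R D s + (real (Suc m) * s ^ m) *\<^sub>R f (s *\<^sub>R x))) (at s within {0..1})" for s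
  proof -
    have l: "linear (frechet_derivative f (at (s *\<^sub>R x)))"
      by (rule linear_frechet_derivative[OF smooth_differentiable[OF f]])
    have "((\<lambda>s. s *\<^sub>R x) has_derivative (\<lambda>k. k *\<^sub>R x)) (at s within {0..1})"
      by (auto intro!: derivative_eq_intros)
    from has_derivative_compose[OF this smooth_has_derivative[OF f]]
    have "((\<lambda>s. f (s *\<^sub>R x)) has_vector_derivative D s) (at s within {0..1})"
      by (simp add: has_vector_derivative_def linear_scale[OF l] D_def)
    moreover have "((\<lambda>s. s ^ Suc m) has_vector_derivative (real (Suc m) * s ^ m)) (at s within {0..1})"
    proof -
      have "((\<lambda>s. s ^ Suc m) has_real_derivative (real (Suc m) * s ^ m)) (at s within {0..1})"
        using DERIV_pow[of "Suc m" s "{0..1}"] by (simp del: power_Suc)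
      then show ?thesis by (simp only: has_real_derivative_iff_has_vector_derivative)
    qed
    ultimately show ?thesis
      using has_vector_derivative_scaleR[of "\<lambda>s. s ^ Suc m" "real (Suc m) * s ^ m" s "{0..1}" "\<lambda>s. f (s *\<^sub>R x)" "D s"]
      by (simp add: has_real_derivative_iff_has_vector_derivative)
  qed
  have "((\<lambda>s. s ^ Suc m *\<^sub>R D s + (real (Suc m) * s ^ m) *\<^sub>R f (s *\<^sub>R x)) has_integral
      (1 ^ Suc m *\<^sub>R f (1 *\<^sub>R x) - 0 ^ Suc m *\<^sub>R f (0 *\<^sub>R x))) {0..1}"
    by (rule fundamental_theorem_of_calculus) (use d in auto)
  then have "((\<lambda>s. s ^ Suc m *\<^sub>R D s + (real (Suc m) * s ^ m) *\<^sub>R f (s *\<^sub>R x)) has_integral f x) {0..1}"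
    by simp
  from has_integral_diff[OF this] have *: "((\<lambda>s. s ^ Suc m *\<^sub>R D s + (real (Suc m) * s ^ m) *\<^sub>R f (s *\<^sub>R x) - g s) has_integral f x - I) {0..1}"
    if "(g has_integral I) {0..1}" for g I using that by blast
  have "((\<lambda>s. (real (Suc m) * s ^ m) *\<^sub>R f (s *\<^sub>R x)) has_integral real (Suc m) *\<^sub>R dil_avg m f x) {0..1}"
    using has_integral_cmul[OF integrable_integral[OF dil_avg_integrable[OF f, of m x]], of "real (Suc m)"]
    by (simp add: dil_avg_def scaleR_scaleR del: of_nat_Suc)
  from *[OF this] have "((\<lambda>s. s ^ Suc m *\<^sub>R D s) has_integral (f x - real (Suc m) *\<^sub>R dil_avg m f x)) {0..1}"
    by (simp only: add_diff_cancel_right')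
  then have "radial_deriv (dil_avg m f) x = f x - real (Suc m) *\<^sub>R dil_avg m f x"
    unfolding Rh by (rule integral_unique)
  then show ?thesis by (simp add: scaleR_conv_of_real del: of_nat_Suc)
qed

text \<open>By \<open>radial_equation_bound\<close> with c = m + 1, the average is bounded on L^2 as
  soon as 2 (m + 1) > n, so Cauchy sequences go to Cauchy sequences.\<close>

lemma L2_lim_dil_avg:
  fixes \<Phi> :: "nat \<Rightarrow> 'a::euclidean_space \<Rightarrow> complex"
  assumes \<Phi>: "\<And>k. smooth (\<Phi> k)" and F: "L2_lim vol \<Phi> F" "square_integrable vol F"
    and m: "2 * Suc m > DIM('a)"
  shows "\<exists>h. square_integrable vol h \<and> L2_lim vol (\<lambda>k. dil_avg m (\<Phi> k)) h"
proof (rule L2_complete)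
  show "square_integrable vol (dil_avg m (\<Phi> k))" for k
    by (intro smooth_square_integrable_ball smooth_dil_avg \<Phi>)
  fix e :: real assume e: "e > 0"
  define b where "b = 2 * real (Suc m) - real DIM('a)"
  have b: "b > 0" using m unfolding b_def by linarith
  have le: "b * L2_norm vol (\<lambda>x. dil_avg m (\<Phi> k) x - dil_avg m (\<Phi> j) x) \<le> 2 * L2_norm vol (\<lambda>x. \<Phi> k x - \<Phi> j x)" for k j
  proof -
    have s: "smooth (\<lambda>x. \<Phi> k x - \<Phi> j x)" by (intro smooth_diff \<Phi>)
    show ?thesis
      using radial_equation_bound[OF smooth_dil_avg[OF s] s radial_deriv_dil_avg[OF s], of m]
      by (simp add: b_def dil_avg_diff[OF \<Phi> \<Phi>])
  qed
  obtain N where N: "\<forall>k\<ge>N. \<forall>j\<ge>N. L2_norm vol (\<lambda>x. \<Phi> k x - \<Phi> j x) < b * e / 2"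
    using L2_lim_Cauchy[OF F(1) smooth_square_integrable_ball[OF \<Phi>] F(2), of "b * e / 2"] b e by auto
  have "L2_norm vol (\<lambda>x. dil_avg m (\<Phi> k) x - dil_avg m (\<Phi> j) x) < e" if "k \<ge> N" "j \<ge> N" for k j
  proof -
    have "b * L2_norm vol (\<lambda>x. dil_avg m (\<Phi> k) x - dil_avg m (\<Phi> j) x) < b * e"
      using le[of k j] N that by fastforce
    then show ?thesis using b by simp
  qed
  then show "\<exists>N. \<forall>k\<ge>N. \<forall>j\<ge>N. L2_norm vol (\<lambda>x. dil_avg m (\<Phi> k) x - dil_avg m (\<Phi> j) x) < e" by blast
qed

text \<open>A partial derivative of an average is the average of the partial derivative with
  \<open>Suc m\<close> for \<open>m\<close>, so the same L^2 bound handles the gradient.\<close>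

lemma H1_lim_dil_avg:
  fixes \<Phi> :: "nat \<Rightarrow> 'a::euclidean_space \<Rightarrow> complex"
  assumes \<Phi>: "H1_lim \<Phi> F G" and m: "2 * Suc m > DIM('a)"
  obtains h P where "H1_lim (\<lambda>k. dil_avg m (\<Phi> k)) h P"
proof -
  note l = H1_limD[OF \<Phi>]
  obtain h where h: "square_integrable vol h" "L2_lim vol (\<lambda>k. dil_avg m (\<Phi> k)) h"
    using L2_lim_dil_avg[OF l(1) l(3) l(2) m] by blast
  have "\<exists>p. square_integrable vol p \<and> L2_lim vol (\<lambda>k. dil_avg (Suc m) (partial_deriv i (\<Phi> k))) p" if i: "i \<in> Basis" for i
    by (rule L2_lim_dil_avg[OF smooth_partial_deriv[OF l(1) i] l(5)[OF i] l(4)[OF i]]) (use m in simp)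
  then have "\<forall>i\<in>Basis. \<exists>p. square_integrable vol p \<and> L2_lim vol (\<lambda>k. dil_avg (Suc m) (partial_deriv i (\<Phi> k))) p"
    by blast
  then obtain P where "\<forall>i\<in>Basis. square_integrable vol (P i) \<and> L2_lim vol (\<lambda>k. dil_avg (Suc m) (partial_deriv i (\<Phi> k))) (P i)"
    by (rule bchoice[THEN exE])
  then have "H1_lim (\<lambda>k. dil_avg m (\<Phi> k)) h P"
    unfolding H1_lim_def using h l(1) by (simp add: partial_deriv_dil_avg smooth_dil_avg)
  then show thesis by (rule that)
qed

text \<open>Passes between the Lebesgue integral over the ball, that over the whole space, where
  dilations act, and the gauge integral over a box, where \<open>integral_swap_continuous\<close>
  exchanges it with the integral in \<open>dil_avg\<close>.\<close>

lemma integral_ball_measure_UNIV: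
  fixes g :: "'a::euclidean_space \<Rightarrow> complex"
  assumes "continuous_on UNIV g" "\<And>x. norm x \<ge> 1 \<Longrightarrow> g x = 0"
  shows "(LINT x|vol. g x) = (LINT x|lborel. g x)"
    "integrable lborel g"
    "(LINT x|vol. g x) = integral (cbox (- One) One) g"
proof -
  have b: "g \<in> borel_measurable borel" by (rule borel_measurable_continuous_onI[OF assms(1)])
  have eq: "(\<lambda>x. indicator (ball 0 1) x *\<^sub>R g x) = g"
    using assms(2) by (auto simp: indicator_def fun_eq_iff)
  show 1: "(LINT x|vol. g x) = (LINT x|lborel. g x)"
    using integral_ball_measure[OF b] eq by simp
  show 2: "integrable lborel g"
    using integrable_ball_continuous[OF assms(1)] integrable_ball_measure_iff[OF b] eq by simp
  have "(g has_integral (LINT x|lborel. g x)) UNIV" by (rule has_integral_integral_lborel[OF 2])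
  moreover have "(\<lambda>x. if x \<in> cbox (- One) One then g x else 0) = g"
  proof (rule ext)
    fix x :: 'a
    have "x \<in> cbox (- One) One" if "norm x < 1"
      unfolding mem_box
    proof
      fix i :: 'a assume i: "i \<in> Basis"
      show "- One \<bullet> i \<le> x \<bullet> i \<and> x \<bullet> i \<le> One \<bullet> i"
        using Basis_le_norm[OF i, of x] that i by (simp add: abs_le_iff)
    qed
    then show "(if x \<in> cbox (- One) One then g x else 0) = g x"
      using assms(2)[of x] by (cases "norm x < 1") auto
  qed
  ultimately have "(g has_integral (LINT x|lborel. g x)) (cbox (- One) One)"
    using has_integral_restrict_UNIV[of "cbox (- One) One" g] by metis
  then show "(LINT x|vol. g x) = integral (cbox (- One) One) g"
    using 1 integral_unique by metis
qed

text \<open>In the open exterior the function is locally 0; points of the sphere are limits of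
  exterior points and follow by continuity.\<close>

lemma partial_deriv_eq_0_outside:
  fixes \<xi> :: "'a::euclidean_space \<Rightarrow> complex"
  assumes \<xi>: "smooth \<xi>" "\<And>x. norm x \<ge> 1 \<Longrightarrow> \<xi> x = 0" and i: "i \<in> Basis" and x: "norm x \<ge> 1"
  shows "partial_deriv i \<xi> x = 0"
proof -
  have "partial_deriv i \<xi> y = 0" if "norm y > 1" for y
  proof -
    have "(\<xi> has_derivative (\<lambda>h. 0)) (at y)"
      by (rule has_derivative_transform_within_open[OF has_derivative_const, of "- cball 0 1"])
         (use \<xi>(2) that in auto)
    then show ?thesis by (rule partial_deriv_eq)
  qed
  then have "closure (- cball 0 1) \<subseteq> {y. partial_deriv i \<xi> y = 0}"
    by (intro closure_minimal closed_Collect_eq smooth_continuous_on smooth_partial_deriv[OF \<xi>(1) i] continuous_on_const) auto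
  moreover have "x \<in> closure (- cball 0 1)"
    using x by (simp add: closure_complement interior_cball)
  ultimately show ?thesis by blast
qed

lemma L2_norm_ball_le:
  fixes u :: "'a::euclidean_space \<Rightarrow> complex"
  assumes "square_integrable vol u" "\<And>x. norm x < 1 \<Longrightarrow> cmod (u x) \<le> C" "C \<ge> 0"
  shows "L2_norm vol u \<le> C * sqrt (measure vol (ball (0::'a) 1))"
proof -
  interpret finite_measure "vol :: 'a measure" by (rule finite_ball_measure)
  have "(LINT x|vol. (cmod (u x))\<^sup>2) \<le> (LINT x|(vol :: 'a measure). C\<^sup>2)"
    using assms by (intro integral_mono power_mono) (auto simp: square_integrable_def)
  then have "L2_norm vol u \<le> sqrt (measure vol (ball (0::'a) 1) * C\<^sup>2)"
    unfolding L2_norm_def by (intro real_sqrt_le_mono) simp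
  then show ?thesis using assms(3) by (simp add: real_sqrt_mult mult.commute)
qed

text \<open>Rescaling by \<open>s\<close> turns the dilated integrand into the pairing of \<open>\<nabla>\<phi>\<close> with the gradient of
  \<open>\<xi> (y / s)\<close>, which has zero trace; weak harmonicity of the limit \<open>F\<close> makes it small.\<close>

lemma dil_avg_pairing_bound:
  fixes \<phi> \<xi> :: "'a::euclidean_space \<Rightarrow> complex"
  assumes \<phi>: "smooth \<phi>" and G: "\<And>i. i \<in> Basis \<Longrightarrow> square_integrable vol (G i)"
    and harm: "\<And>v H. has_trace v H (\<lambda>_. 0) \<Longrightarrow> (\<Sum>i\<in>Basis. LINT x|vol. G i x * H i x) = 0"
    and \<xi>: "smooth \<xi>" "\<And>x. norm x \<ge> 1 \<Longrightarrow> \<xi> x = 0"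
    and C: "\<And>i x. i \<in> Basis \<Longrightarrow> cmod (partial_deriv i \<xi> x) \<le> C" "C \<ge> 0"
    and m: "m + 1 \<ge> DIM('a)"
  shows "cmod (\<Sum>i\<in>Basis. LINT x|vol. dil_avg (Suc m) (partial_deriv i \<phi>) x * partial_deriv i \<xi> x)
    \<le> (\<Sum>i\<in>Basis. L2_norm vol (\<lambda>x. partial_deriv i \<phi> x - G i x)) * (C * sqrt (measure vol (ball (0::'a) 1)))"
    (is "cmod ?L \<le> ?B")
proof -
  define V where "V = sqrt (measure vol (ball (0::'a) 1))"
  have V: "V \<ge> 0" by (simp add: V_def)
  have D\<phi>: "smooth (partial_deriv i \<phi>)" and D\<xi>: "smooth (partial_deriv i \<xi>)" if "i \<in> Basis" for i
    using \<phi> \<xi> that by auto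
  have D0: "partial_deriv i \<xi> x = 0" if "i \<in> Basis" "norm x \<ge> 1" for i x
    by (rule partial_deriv_eq_0_outside[OF \<xi> that])
  define K where "K s x = (\<Sum>i\<in>Basis. (s ^ Suc m *\<^sub>R partial_deriv i \<phi> (s *\<^sub>R x)) * partial_deriv i \<xi> x)" for s x
  have contK: "continuous_on UNIV (\<lambda>(s, x). K s x)"
    unfolding K_def case_prod_beta
    by (intro continuous_intros continuous_on_compose2[OF smooth_continuous_on[OF D\<phi>, of _ UNIV]]
        continuous_on_compose2[OF smooth_continuous_on[OF D\<xi>, of _ UNIV]]) auto
  have contK1: "continuous_on UNIV (K s)" for s
    using continuous_on_compose2[OF contK continuous_on_Pair[OF continuous_on_const[of _ s] continuous_on_id]] by simp
  have K0: "K s x = 0" if "norm x \<ge> 1" for s x using D0 that by (simp add: K_def)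
  have inner: "integral {0..1} (\<lambda>s. K s x) = (\<Sum>i\<in>Basis. dil_avg (Suc m) (partial_deriv i \<phi>) x * partial_deriv i \<xi> x)" for x
    unfolding K_def dil_avg_def
    by (subst Henstock_Kurzweil_Integration.integral_sum)
       (auto intro!: integrable_on_mult_left dil_avg_integrable D\<phi> simp del: power_Suc mult_scaleR_left)
  have contL: "continuous_on UNIV (\<lambda>x. \<Sum>i\<in>Basis. dil_avg (Suc m) (partial_deriv i \<phi>) x * partial_deriv i \<xi> x)"
    by (intro continuous_intros smooth_continuous_on smooth_dil_avg D\<phi> D\<xi>)
  have "?L = (LINT x|vol. (\<Sum>i\<in>Basis. dil_avg (Suc m) (partial_deriv i \<phi>) x * partial_deriv i \<xi> x))"
    by (subst Bochner_Integration.integral_sum) (auto intro!: smooth_integrable_ball smooth_mult smooth_dil_avg D\<phi> D\<xi>)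
  also have "\<dots> = integral (cbox (- One) One) (\<lambda>x. integral (cbox 0 1) (\<lambda>s. K s x))"
    by (subst integral_ball_measure_UNIV(3)[OF contL]) (auto simp: D0 inner)
  also have "\<dots> = integral (cbox 0 1) (\<lambda>s. integral (cbox (- One) One) (K s))"
    by (rule integral_swap_continuous[symmetric]) (rule continuous_on_subset[OF contK], simp)
  also have "\<dots> = integral (cbox 0 1) (\<lambda>s. LINT x|vol. K s x)"
    by (simp add: integral_ball_measure_UNIV(3)[OF contK1 K0])
  finally have L: "?L = integral (cbox 0 1) (\<lambda>s. LINT x|vol. K s x)" .
  have bound: "cmod (LINT x|vol. K s x) \<le> ?B" if s: "0 \<le> s" "s \<le> 1" for s :: real
  proof (cases "s = 0")
    case True
    then show ?thesis using C(2) by (auto simp: K_def intro!: mult_nonneg_nonneg sum_nonneg)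
  next
    case False
    then have s0: "s > 0" using s by simp
    define \<xi>s where "\<xi>s y = \<xi> (inverse s *\<^sub>R y)" for y
    have s\<xi>: "smooth \<xi>s" unfolding \<xi>s_def[abs_def] by (rule smooth_dilate[OF \<xi>(1)])
    have pd: "partial_deriv i \<xi>s y = inverse s *\<^sub>R partial_deriv i \<xi> (inverse s *\<^sub>R y)" for i y
      unfolding \<xi>s_def[abs_def] by (rule partial_deriv_dilate[OF smooth_differentiable[OF \<xi>(1)]])
    \<comment> \<open>For s <= 1 the function \<open>\<xi>s\<close> vanishes off the ball of radius
      s, hence on the unit sphere, which makes it admissible in \<open>harm\<close>.\<close>
    have out: "norm (inverse s *\<^sub>R y) \<ge> 1" if "norm y \<ge> 1" for y :: 'a
    proof -
      have "s * 1 \<le> 1 * norm y" using s that by (intro mult_mono) auto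
      then show ?thesis using s0 by (simp add: field_simps)
    qed
    have "has_trace \<xi>s (\<lambda>i. partial_deriv i \<xi>s) (\<lambda>_. 0)"
    proof (rule has_trace_0_if_eq_0_on_sphere[OF s\<xi>])
      fix x :: 'a assume "norm x = 1"
      then show "\<xi>s x = 0" unfolding \<xi>s_def by (intro \<xi>(2) out) simp
    qed
    then have h0: "(\<Sum>i\<in>Basis. LINT x|vol. G i x * partial_deriv i \<xi>s x) = 0" by (rule harm)
    have si: "square_integrable vol (partial_deriv i \<xi>s)" if "i \<in> Basis" for i
      using s\<xi> that by (auto intro: smooth_square_integrable_ball)
    have si\<phi>: "square_integrable vol (partial_deriv i \<phi>)" if "i \<in> Basis" for i
      using D\<phi> that by (auto intro: smooth_square_integrable_ball)
    \<comment> \<open>Substitute y = s x: the Jacobian gives n inverse powers of s, and the gradient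
      of \<open>\<xi>\<close> at y / s is s times the gradient of \<open>\<xi>s\<close> at y, which
      adds one power to the weight.\<close>
    have term_i: "(LINT x|vol. (s ^ Suc m *\<^sub>R partial_deriv i \<phi> (s *\<^sub>R x)) * partial_deriv i \<xi> x)
        = (s ^ Suc (Suc m) * inverse s ^ DIM('a)) *\<^sub>R (LINT x|vol. partial_deriv i \<phi> x * partial_deriv i \<xi>s x)"
      if i: "i \<in> Basis" for i
    proof -
      define g where "g x = (s ^ Suc m *\<^sub>R partial_deriv i \<phi> (s *\<^sub>R x)) * partial_deriv i \<xi> x" for x
      have cg: "continuous_on UNIV g"
        unfolding g_def
        by (intro continuous_intros continuous_on_compose2[OF smooth_continuous_on[OF D\<phi>[OF i], of UNIV]] smooth_continuous_on D\<xi> i) auto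
      have "(LINT x|vol. g x) = (LINT x|lborel. g x)"
        by (rule integral_ball_measure_UNIV(1)[OF cg]) (simp add: g_def D0 i)
      also have "\<dots> = inverse s ^ DIM('a) *\<^sub>R (LINT x|lborel. g (inverse s *\<^sub>R x))"
        using s0 by (intro integral_lborel_scale borel_measurable_continuous_onI cg) simp
      also have "(LINT x|lborel. g (inverse s *\<^sub>R x)) = (LINT x|lborel. s ^ Suc (Suc m) *\<^sub>R (partial_deriv i \<phi> x * partial_deriv i \<xi>s x))"
        using s0 by (intro Bochner_Integration.integral_cong) (simp_all add: g_def pd)
      also have "\<dots> = s ^ Suc (Suc m) *\<^sub>R (LINT x|lborel. partial_deriv i \<phi> x * partial_deriv i \<xi>s x)"
        by (rule integral_scaleR_right)
      also have "(LINT x|lborel. partial_deriv i \<phi> x * partial_deriv i \<xi>s x) = (LINT x|vol. partial_deriv i \<phi> x * partial_deriv i \<xi>s x)"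
      proof (rule integral_ball_measure_UNIV(1)[symmetric])
        show "continuous_on UNIV (\<lambda>x. partial_deriv i \<phi> x * partial_deriv i \<xi>s x)"
          by (intro continuous_on_mult smooth_continuous_on D\<phi> smooth_partial_deriv s\<xi> i)
      qed (simp add: pd D0[OF i out])
      finally show ?thesis by (simp add: g_def mult.commute)
    qed
    have "(LINT x|vol. K s x) = (\<Sum>i\<in>Basis. LINT x|vol. (s ^ Suc m *\<^sub>R partial_deriv i \<phi> (s *\<^sub>R x)) * partial_deriv i \<xi> x)"
      unfolding K_def
    proof (rule Bochner_Integration.integral_sum)
      fix i :: 'a assume i: "i \<in> Basis"
      show "integrable vol (\<lambda>x. (s ^ Suc m *\<^sub>R partial_deriv i \<phi> (s *\<^sub>R x)) * partial_deriv i \<xi> x)"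
        by (intro integrable_ball_continuous continuous_intros continuous_on_compose2[OF smooth_continuous_on[OF D\<phi>[OF i], of UNIV]] smooth_continuous_on D\<xi> i) auto
    qed
    also have "\<dots> = (s ^ Suc (Suc m) * inverse s ^ DIM('a)) *\<^sub>R (\<Sum>i\<in>Basis. LINT x|vol. partial_deriv i \<phi> x * partial_deriv i \<xi>s x)"
      unfolding scaleR_sum_right by (rule sum.cong[OF refl term_i])
    also have "(\<Sum>i\<in>Basis. LINT x|vol. partial_deriv i \<phi> x * partial_deriv i \<xi>s x)
       = (\<Sum>i\<in>Basis. LINT x|vol. partial_deriv i \<phi> x * partial_deriv i \<xi>s x) - (\<Sum>i\<in>Basis. LINT x|vol. G i x * partial_deriv i \<xi>s x)"
      using h0 by simp
    also have "\<dots> = (\<Sum>i\<in>Basis. LINT x|vol. (partial_deriv i \<phi> x - G i x) * partial_deriv i \<xi>s x)"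
      unfolding sum_subtractf[symmetric]
    proof (rule sum.cong[OF refl])
      fix i :: 'a assume i: "i \<in> Basis"
      show "(LINT x|vol. partial_deriv i \<phi> x * partial_deriv i \<xi>s x) - (LINT x|vol. G i x * partial_deriv i \<xi>s x)
        = (LINT x|vol. (partial_deriv i \<phi> x - G i x) * partial_deriv i \<xi>s x)"
        unfolding left_diff_distrib
        by (rule Bochner_Integration.integral_diff[symmetric]) (intro square_integrable_imp_integrable si si\<phi> G i)+
    qed
    finally have "cmod (LINT x|vol. K s x) = (s ^ Suc (Suc m) * inverse s ^ DIM('a)) * cmod (\<Sum>i\<in>Basis. LINT x|vol. (partial_deriv i \<phi> x - G i x) * partial_deriv i \<xi>s x)"
      using s0 by simp
    also have "cmod (\<Sum>i\<in>Basis. LINT x|vol. (partial_deriv i \<phi> x - G i x) * partial_deriv i \<xi>s x)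
      \<le> (\<Sum>i\<in>Basis. L2_norm vol (\<lambda>x. partial_deriv i \<phi> x - G i x) * (inverse s * C * V))"
    proof (rule sum_norm_le)
      fix i :: 'a assume i: "i \<in> Basis"
      have "L2_norm vol (partial_deriv i \<xi>s) \<le> (inverse s * C) * V"
        unfolding V_def using s0 C i by (intro L2_norm_ball_le si i) (auto simp: pd mult_left_mono)
      then have "L2_norm vol (\<lambda>x. partial_deriv i \<phi> x - G i x) * L2_norm vol (partial_deriv i \<xi>s)
        \<le> L2_norm vol (\<lambda>x. partial_deriv i \<phi> x - G i x) * (inverse s * C * V)"
        by (rule mult_left_mono) simp
      then show "cmod (LINT x|vol. (partial_deriv i \<phi> x - G i x) * partial_deriv i \<xi>s x)
        \<le> L2_norm vol (\<lambda>x. partial_deriv i \<phi> x - G i x) * (inverse s * C * V)"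
        using L2_Cauchy_Schwarz(2)[OF square_integrable_diff[OF si\<phi>[OF i] G[OF i]] si[OF i]] by simp
    qed
    also have "(s ^ Suc (Suc m) * inverse s ^ DIM('a)) * \<dots> = (s ^ Suc m * inverse s ^ DIM('a)) * ?B"
      using s0 by (simp add: sum_distrib_right[symmetric] V_def)
    also have "\<dots> \<le> 1 * ?B"
    proof (rule mult_right_mono)
      \<comment> \<open>One factor of s was spent on the gradient of \<open>\<xi>s\<close>. The
        remaining exponent m + 1 - n is nonnegative by \<open>m\<close>, so the estimate is uniform
        in s.\<close>
      have "s ^ Suc m * inverse s ^ DIM('a) = s ^ (Suc m - DIM('a)) * (s ^ DIM('a) * inverse s ^ DIM('a))"
        unfolding mult.assoc[symmetric] power_add[symmetric] using m by simp
      also have "\<dots> = s ^ (Suc m - DIM('a))" using s0 by (simp flip: power_mult_distrib)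
      also have "\<dots> \<le> 1" using s by (simp add: power_le_one)
      finally show "s ^ Suc m * inverse s ^ DIM('a) \<le> 1" .
    qed (use C(2) in \<open>auto intro!: mult_nonneg_nonneg sum_nonneg\<close>)
    finally show ?thesis using s0 by (simp add: mult_left_mono)
  qed
  have "cmod (integral (cbox 0 1) (\<lambda>s. LINT x|vol. K s x)) \<le> ?B * measure lborel (cbox 0 (1::real))"
  proof (rule has_integral_bound)
    show "0 \<le> ?B" using C(2) by (auto intro!: mult_nonneg_nonneg sum_nonneg)
    have "continuous_on (cbox 0 1) (\<lambda>s. integral (cbox (- One) One) (K s))"
      by (rule integral_continuous_on_param) (rule continuous_on_subset[OF contK], simp)
    then have "(\<lambda>s. integral (cbox (- One) One) (K s)) integrable_on cbox 0 1" by (rule integrable_continuous)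
    then show "((\<lambda>s. LINT x|vol. K s x) has_integral integral (cbox 0 1) (\<lambda>s. LINT x|vol. K s x)) (cbox 0 1)"
      by (simp add: integral_ball_measure_UNIV(3)[OF contK1 K0] integrable_integral)
  qed (use bound in auto)
  then show ?thesis using L by simp
qed

text \<open>By \<open>orthogonal_trace_0\<close> it suffices to test against smooth functions
  vanishing off the ball. For these \<open>dil_avg_pairing_bound\<close> measures the defect by the
  gradient error of the approximants, which tends to 0.\<close>

lemma dil_avg_harmonic:
  fixes \<Phi> :: "nat \<Rightarrow> 'a::euclidean_space \<Rightarrow> complex"
  assumes \<Phi>: "H1_lim \<Phi> F G"
    and harm: "\<And>v H. has_trace v H (\<lambda>_. 0) \<Longrightarrow> (\<Sum>i\<in>Basis. LINT x|vol. G i x * H i x) = 0"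
    and h: "H1_lim (\<lambda>k. dil_avg m (\<Phi> k)) h P" and m: "m + 1 \<ge> DIM('a)"
    and v: "has_trace v H (\<lambda>_. 0)"
  shows "(\<Sum>i\<in>Basis. LINT x|vol. P i x * H i x) = 0"
proof (rule orthogonal_trace_0[OF H1_limD(4)[OF h] _ v])
  fix \<xi> :: "'a \<Rightarrow> complex"
  assume \<xi>: "smooth \<xi>" "\<And>x. norm x \<ge> 1 \<Longrightarrow> \<xi> x = 0"
  note l = H1_limD[OF \<Phi>] and lh = H1_limD[OF h]
  have "\<forall>i\<in>Basis. \<exists>C>0. \<forall>x. norm x \<le> 1 \<longrightarrow> cmod (partial_deriv i \<xi> x) \<le> C"
    using continuous_bounded_cball[OF smooth_continuous_on[OF smooth_partial_deriv[OF \<xi>(1)]]] by metis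
  then obtain c where c: "\<And>i. i \<in> Basis \<Longrightarrow> c i > 0" "\<And>i x. i \<in> Basis \<Longrightarrow> norm x \<le> 1 \<Longrightarrow> cmod (partial_deriv i \<xi> x) \<le> c i"
    by metis
  define C where "C = (\<Sum>i\<in>(Basis::'a set). c i)"
  have C0: "C \<ge> 0" unfolding C_def by (intro sum_nonneg less_imp_le c)
  have C: "cmod (partial_deriv i \<xi> x) \<le> C" if i: "i \<in> Basis" for i x
  proof (cases "norm x \<le> 1")
    case True
    have "c i \<le> C" unfolding C_def using c(1) i by (intro member_le_sum) (auto intro: less_imp_le)
    with c(2)[OF i True] show ?thesis by simp
  qed (use C0 partial_deriv_eq_0_outside[OF \<xi> i, of x] in simp)
  have "(\<lambda>k. \<Sum>i\<in>Basis. LINT x|vol. dil_avg (Suc m) (partial_deriv i (\<Phi> k)) x * partial_deriv i \<xi> x) \<longlonglongrightarrow> 0"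
  proof (rule Lim_null_comparison)
    show "\<forall>\<^sub>F k in sequentially. cmod (\<Sum>i\<in>Basis. LINT x|vol. dil_avg (Suc m) (partial_deriv i (\<Phi> k)) x * partial_deriv i \<xi> x)
      \<le> (\<Sum>i\<in>Basis. L2_norm vol (\<lambda>x. partial_deriv i (\<Phi> k) x - G i x)) * (C * sqrt (measure vol (ball (0::'a) 1)))"
      using dil_avg_pairing_bound[OF l(1) l(4) harm \<xi> C C0 m] by (intro always_eventually allI)
    have "(\<lambda>k. \<Sum>i\<in>Basis. L2_norm vol (\<lambda>x. partial_deriv i (\<Phi> k) x - G i x)) \<longlonglongrightarrow> (\<Sum>i\<in>(Basis::'a set). 0)"
      using l(5) by (intro tendsto_sum) (simp add: L2_lim_def)
    then show "(\<lambda>k. (\<Sum>i\<in>Basis. L2_norm vol (\<lambda>x. partial_deriv i (\<Phi> k) x - G i x)) * (C * sqrt (measure vol (ball (0::'a) 1)))) \<longlonglongrightarrow> 0"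
      by (intro tendsto_mult_left_zero) simp
  qed
  moreover have "(\<lambda>k. \<Sum>i\<in>Basis. LINT x|vol. partial_deriv i (dil_avg m (\<Phi> k)) x * partial_deriv i \<xi> x) \<longlonglongrightarrow>
      (\<Sum>i\<in>Basis. LINT x|vol. P i x * partial_deriv i \<xi> x)"
    by (intro tendsto_sum L2_lim_integral_mult L2_lim_const lh smooth_square_integrable_ball smooth_partial_deriv \<xi>(1))
  ultimately show "(\<Sum>i\<in>Basis. LINT x|vol. P i x * partial_deriv i \<xi> x) = 0"
    by (simp add: partial_deriv_dil_avg[OF l(1)] LIMSEQ_unique)
qed

section \<open>Darboux transforms\<close>

text \<open>The radial divergence theorem writes the boundary pairing as a sum of ball integrals of
  products, each continuous in H^1. Thus it converges although \<open>H1_lim\<close> says nothing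
  about the sphere.\<close>

lemma sphere_integral_lim:
  fixes u v :: "'a::euclidean_space \<Rightarrow> complex"
  assumes \<Phi>: "H1_lim \<Phi> u G" and \<Psi>: "H1_lim \<Psi> v H"
  obtains l where "(\<lambda>k. LINT x|sphere_measure. \<Phi> k x * \<Psi> k x) \<longlonglongrightarrow> l"
proof -
  note a = H1_limD[OF \<Phi>] and b = H1_limD[OF \<Psi>]
  have x: "smooth (\<lambda>x::'a. complex_of_real (x \<bullet> i))" for i by (intro smooth_of_real smooth_inner_left)
  have "(LINT x|sphere_measure. \<Phi> k x * \<Psi> k x) = of_nat DIM('a) * (LINT x|vol. \<Phi> k x * \<Psi> k x)
      + ((\<Sum>i\<in>Basis. LINT x|vol. (of_real (x \<bullet> i) * \<Phi> k x) * partial_deriv i (\<Psi> k) x)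
       + (\<Sum>i\<in>Basis. LINT x|vol. (of_real (x \<bullet> i) * partial_deriv i (\<Phi> k) x) * \<Psi> k x))" for k
  proof -
    have s: "smooth (\<lambda>x. (of_real (x \<bullet> i) * \<Phi> k x) * partial_deriv i (\<Psi> k) x)"
      "smooth (\<lambda>x. (of_real (x \<bullet> i) * partial_deriv i (\<Phi> k) x) * \<Psi> k x)" if "i \<in> Basis" for i
      by (intro smooth_mult x a b smooth_partial_deriv that)+
    have "(LINT x|sphere_measure. \<Phi> k x * \<Psi> k x) =
      (LINT x|vol. of_nat DIM('a) * (\<Phi> k x * \<Psi> k x) + ((\<Sum>i\<in>Basis. (of_real (x \<bullet> i) * \<Phi> k x) * partial_deriv i (\<Psi> k) x)
        + (\<Sum>i\<in>Basis. (of_real (x \<bullet> i) * partial_deriv i (\<Phi> k) x) * \<Psi> k x)))"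
      unfolding sphere_integral_mult[OF a(1) b(1)] radial_deriv_eq[OF a(1)] radial_deriv_eq[OF b(1)]
      by (simp add: sum_distrib_left sum_distrib_right scaleR_conv_of_real mult_ac)
    also have "\<dots> = of_nat DIM('a) * (LINT x|vol. \<Phi> k x * \<Psi> k x)
      + ((LINT x|vol. (\<Sum>i\<in>Basis. (of_real (x \<bullet> i) * \<Phi> k x) * partial_deriv i (\<Psi> k) x))
       + (LINT x|vol. (\<Sum>i\<in>Basis. (of_real (x \<bullet> i) * partial_deriv i (\<Phi> k) x) * \<Psi> k x)))"
      using smooth_integrable_ball[OF smooth_mult[OF a(1) b(1)], of k k] smooth_integrable_ball[OF s(1)] smooth_integrable_ball[OF s(2)]
      by (simp add: mult.assoc)
    finally show ?thesis
      using smooth_integrable_ball[OF s(1)] smooth_integrable_ball[OF s(2)] by simp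
  qed
  moreover have "(\<lambda>k. of_nat DIM('a) * (LINT x|vol. \<Phi> k x * \<Psi> k x)
      + ((\<Sum>i\<in>Basis. LINT x|vol. (of_real (x \<bullet> i) * \<Phi> k x) * partial_deriv i (\<Psi> k) x)
       + (\<Sum>i\<in>Basis. LINT x|vol. (of_real (x \<bullet> i) * partial_deriv i (\<Phi> k) x) * \<Psi> k x)))
     \<longlonglongrightarrow> of_nat DIM('a) * (LINT x|vol. u x * v x)
      + ((\<Sum>i\<in>Basis. LINT x|vol. (of_real (x \<bullet> i) * u x) * H i x)
       + (\<Sum>i\<in>Basis. LINT x|vol. (of_real (x \<bullet> i) * G i x) * v x))"
    by (intro tendsto_add tendsto_mult_left tendsto_sum L2_lim_integral_mult L2_lim_smooth_mult square_integrable_smooth_mult a b x)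
  ultimately show thesis using that by simp
qed

text \<open>Pairing \<open>\<Phi>\<close> with its conjugate in \<open>sphere_integral_lim\<close>
  shows that its boundary norms converge, hence stay bounded. Cauchy-Schwarz on the sphere does the
  rest.\<close>

lemma sphere_integral_lim_trace_0:
  fixes u v :: "'a::euclidean_space \<Rightarrow> complex"
  assumes \<Phi>: "H1_lim \<Phi> u G" and \<Psi>: "\<And>k. smooth (\<Psi> k)" "L2_lim sphere_measure \<Psi> (\<lambda>_. 0)"
  shows "(\<lambda>k. LINT x|sphere_measure. \<Phi> k x * \<Psi> k x) \<longlonglongrightarrow> 0"
proof -
  note a = H1_limD[OF \<Phi>]
  obtain l where l: "(\<lambda>k. LINT x|sphere_measure. \<Phi> k x * cnj (\<Phi> k x)) \<longlonglongrightarrow> l"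
    using sphere_integral_lim[OF \<Phi> H1_lim_cnj[OF \<Phi>]] by blast
  then have "(\<lambda>k. sqrt (Re (LINT x|sphere_measure. \<Phi> k x * cnj (\<Phi> k x)))) \<longlonglongrightarrow> sqrt (Re l)"
    by (intro tendsto_intros)
  then have n: "(\<lambda>k. L2_norm sphere_measure (\<Phi> k)) \<longlonglongrightarrow> sqrt (Re l)"
    unfolding L2_norm_sq_complex[symmetric] by simp
  show ?thesis
  proof (rule Lim_null_comparison)
    show "\<forall>\<^sub>F k in sequentially. norm (LINT x|sphere_measure. \<Phi> k x * \<Psi> k x) \<le> L2_norm sphere_measure (\<Phi> k) * L2_norm sphere_measure (\<Psi> k)"
      by (intro always_eventually allI L2_Cauchy_Schwarz smooth_square_integrable_sphere a \<Psi>)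
    show "(\<lambda>k. L2_norm sphere_measure (\<Phi> k) * L2_norm sphere_measure (\<Psi> k)) \<longlonglongrightarrow> 0"
      using tendsto_mult[OF n, of "\<lambda>k. L2_norm sphere_measure (\<Psi> k)" 0] \<Psi>(2) by (simp add: L2_lim_def)
  qed
qed

text \<open>With \<open>r = |x|\<close>, \<open>t = - ln r\<close> and \<open>q = V (t) / r\<^sup>2\<close>, a solution \<open>w\<close> of \<open>w' + w\<^sup>2 = a\<^sup>2\<close> with
  \<open>V = - 2 w'\<close> gives \<open>\<beta> = w - w(0)\<close>, \<open>c = w(0) + (n - 2) / 2\<close> and \<open>\<kappa> = w(0)\<^sup>2 - a\<^sup>2\<close>.
  If \<open>h\<close> is harmonic and \<open>F = radial_deriv h + c h\<close>, then \<open>F + \<beta> h\<close> solves the equation with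
  potential \<open>q\<close> and has the boundary values of \<open>F\<close>.\<close>

definition darboux :: "real \<Rightarrow> ('a::euclidean_space \<Rightarrow> real) \<Rightarrow> ('a \<Rightarrow> real) \<Rightarrow> real \<Rightarrow> bool" where
  "darboux c q \<beta> \<kappa> \<longleftrightarrow> smooth q \<and> smooth \<beta> \<and>
    (\<forall>x. norm x < 1 \<longrightarrow> (\<forall>i\<in>Basis. partial_deriv i \<beta> x = q x / 2 * (x \<bullet> i)) \<and>
      real DIM('a) * q x + radial_deriv q x = 2 * q x * (c + \<beta> x)) \<and>
    (\<forall>x. norm x = 1 \<longrightarrow> \<beta> x = 0 \<and> q x = 2 * \<kappa>)"

text \<open>Here \<open>h\<close> is an arbitrary smooth function, as it must be for approximants
  that are not harmonic. With z = q h / 2 the two integrands differ by n z v + x . grad (z v), the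
  divergence of the field z v x. Its flux through the sphere is the term with
  \<open>\<kappa>\<close>, as q = 2 \<open>\<kappa>\<close> there.\<close>

lemma darboux_identity:
  fixes h F v :: "'a::euclidean_space \<Rightarrow> complex"
  assumes d: "darboux c q \<beta> \<kappa>" and h: "smooth h" and F: "smooth F" and v: "smooth v"
    and eq: "\<And>x. radial_deriv h x + of_real c * h x = F x"
  shows "grad_form (\<lambda>i. partial_deriv i (\<lambda>x. F x + of_real (\<beta> x) * h x)) (\<lambda>i. partial_deriv i v)
      + (LINT x|vol. of_real (q x) * (F x + of_real (\<beta> x) * h x) * v x)
    = grad_form (\<lambda>i. partial_deriv i F) (\<lambda>i. partial_deriv i v)
      + grad_form (\<lambda>i. partial_deriv i h) (\<lambda>i. partial_deriv i (\<lambda>x. of_real (\<beta> x) * v x))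
      + of_real \<kappa> * (LINT x|sphere_measure. h x * v x)"
proof -
  have q: "smooth q" and \<beta>: "smooth \<beta>"
    and d\<beta>: "\<And>x i. norm x < 1 \<Longrightarrow> i \<in> Basis \<Longrightarrow> partial_deriv i \<beta> x = q x / 2 * (x \<bullet> i)"
    and dq: "\<And>x. norm x < 1 \<Longrightarrow> real DIM('a) * q x + radial_deriv q x = 2 * q x * (c + \<beta> x)"
    and bd: "\<And>x. norm x = 1 \<Longrightarrow> q x = 2 * \<kappa>"
    using d unfolding darboux_def by blast+
  have cq: "smooth (\<lambda>x. complex_of_real (q x / 2))" 
    unfolding divide_inverse by (intro smooth_of_real smooth_mult q smooth_const)
  have cq1: "smooth (\<lambda>x. complex_of_real (q x))" and c\<beta>: "smooth (\<lambda>x. complex_of_real (\<beta> x))"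
    by (intro smooth_of_real q \<beta>)+
  define z where "z x = complex_of_real (q x / 2) * h x" for x
  have z: "smooth z" unfolding z_def[abs_def] by (intro smooth_mult cq h)
  have u: "smooth (\<lambda>x. F x + complex_of_real (\<beta> x) * h x)" "smooth (\<lambda>x. complex_of_real (\<beta> x) * v x)"
    by (intro smooth_add smooth_mult c\<beta> F h v)+
  have S: "of_real \<kappa> * (LINT x|sphere_measure. h x * v x) = (LINT x|sphere_measure. z x * v x)"
  proof -
    have "of_real \<kappa> * (LINT x|sphere_measure. h x * v x) = (LINT x|sphere_measure. of_real \<kappa> * (h x * v x))"
      by simp
    also have "\<dots> = (LINT x|sphere_measure. z x * v x)"
    proof (rule integral_cong_AE)
      show "AE x in sphere_measure. of_real \<kappa> * (h x * v x) = z x * v x"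
        using AE_sphere_measure by eventually_elim (simp add: z_def bd)
    qed (simp_all only: measurable_cong_sets[OF sets_sphere_measure refl],
         (intro smooth_borel_measurable smooth_mult smooth_const h v z)+)
    finally show ?thesis .
  qed
  have R: "radial_deriv f x = (\<Sum>i\<in>Basis. of_real (x \<bullet> i) * partial_deriv i f x)" if "smooth f" for f :: "'a \<Rightarrow> complex" and x
    using radial_deriv_eq[OF that] by (simp add: scaleR_conv_of_real)
  have pw: "(\<Sum>i\<in>Basis. partial_deriv i (\<lambda>x. F x + of_real (\<beta> x) * h x) x * partial_deriv i v x)
      + of_real (q x) * (F x + of_real (\<beta> x) * h x) * v x
    = (\<Sum>i\<in>Basis. partial_deriv i F x * partial_deriv i v x)
      + (\<Sum>i\<in>Basis. partial_deriv i h x * partial_deriv i (\<lambda>x. of_real (\<beta> x) * v x) x)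
      + (of_nat DIM('a) * (z x * v x) + (z x * radial_deriv v x + radial_deriv z x * v x))" if x: "norm x < 1" for x
  proof -
    define Q B where "Q = complex_of_real (q x / 2)" and "B = complex_of_real (\<beta> x)"
    have pb: "partial_deriv i (\<lambda>x. complex_of_real (\<beta> x)) x = Q * of_real (x \<bullet> i)" if "i \<in> Basis" for i
      using partial_deriv_of_real[OF \<beta>, of i x, where 'b = complex] d\<beta>[OF x that] by (simp add: Q_def)
    have p1: "partial_deriv i (\<lambda>x. F x + of_real (\<beta> x) * h x) x = partial_deriv i F x + (B * partial_deriv i h x + Q * of_real (x \<bullet> i) * h x)" if "i \<in> Basis" for i
      using partial_deriv_add[OF F smooth_mult[OF c\<beta> h], of i x] partial_deriv_mult[OF c\<beta> h, of i x] pb[OF that]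
      by (simp add: B_def)
    have p2: "partial_deriv i (\<lambda>x. of_real (\<beta> x) * v x) x = B * partial_deriv i v x + Q * of_real (x \<bullet> i) * v x" if "i \<in> Basis" for i
      using partial_deriv_mult[OF c\<beta> v, of i x] pb[OF that] by (simp add: B_def)
    \<comment> \<open>Moving \<open>\<beta>\<close> from \<open>h\<close> to \<open>v\<close>
      cancels the products of the gradients of \<open>h\<close> and \<open>v\<close>. The gradient
      of \<open>\<beta>\<close> points along x, so what is left are radial derivatives.\<close>
    have "(\<Sum>i\<in>Basis. partial_deriv i (\<lambda>x. F x + of_real (\<beta> x) * h x) x * partial_deriv i v x)
       - (\<Sum>i\<in>Basis. partial_deriv i h x * partial_deriv i (\<lambda>x. of_real (\<beta> x) * v x) x)
      = (\<Sum>i\<in>Basis. partial_deriv i F x * partial_deriv i v x + (Q * h x) * (of_real (x \<bullet> i) * partial_deriv i v x)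
           - (Q * v x) * (of_real (x \<bullet> i) * partial_deriv i h x))"
      unfolding sum_subtractf[symmetric]
    proof (rule sum.cong[OF refl])
      fix i :: 'a assume i: "i \<in> Basis"
      show "partial_deriv i (\<lambda>x. F x + of_real (\<beta> x) * h x) x * partial_deriv i v x - partial_deriv i h x * partial_deriv i (\<lambda>x. of_real (\<beta> x) * v x) x
        = partial_deriv i F x * partial_deriv i v x + (Q * h x) * (of_real (x \<bullet> i) * partial_deriv i v x)
           - (Q * v x) * (of_real (x \<bullet> i) * partial_deriv i h x)"
        unfolding p1[OF i] p2[OF i] by (simp add: algebra_simps)
    qed
    also have "\<dots> = (\<Sum>i\<in>Basis. partial_deriv i F x * partial_deriv i v x) + Q * h x * radial_deriv v x - Q * v x * radial_deriv h x"
      by (simp add: sum_subtractf sum.distrib sum_distrib_left R[OF h] R[OF v])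
    finally have A: "(\<Sum>i\<in>Basis. partial_deriv i (\<lambda>x. F x + of_real (\<beta> x) * h x) x * partial_deriv i v x)
      = (\<Sum>i\<in>Basis. partial_deriv i h x * partial_deriv i (\<lambda>x. of_real (\<beta> x) * v x) x)
       + (\<Sum>i\<in>Basis. partial_deriv i F x * partial_deriv i v x) + Q * h x * radial_deriv v x - Q * v x * radial_deriv h x"
      by (simp add: algebra_simps)
    have Rq: "radial_deriv (\<lambda>x. complex_of_real (q x / 2)) x = of_real (radial_deriv q x / 2)"
    proof -
      have bl: "bounded_linear (\<lambda>r. complex_of_real (r / 2))"
        by (intro bounded_linear_of_real[THEN bounded_linear_compose] bounded_linear_divide)
      show ?thesis using partial_deriv_bounded_linear[OF bl q, of x x] by (simp add: radial_deriv_def partial_deriv_def)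
    qed
    have Rz: "radial_deriv z x = Q * radial_deriv h x + of_real (radial_deriv q x / 2) * h x"
      unfolding z_def[abs_def] radial_deriv_mult[OF cq h] Rq Q_def by (rule refl)
    \<comment> \<open>The condition on \<open>q\<close> in \<open>darboux\<close>, halved: it makes
      the zeroth-order terms in h v balance.\<close>
    have qe: "of_real (radial_deriv q x / 2) = 2 * Q * (of_real c + B) - of_nat DIM('a) * Q"
    proof -
      have "radial_deriv q x / 2 = 2 * (q x / 2) * (c + \<beta> x) - real DIM('a) * (q x / 2)"
        using dq[OF x] by (simp add: field_simps)
      then show ?thesis by (simp add: Q_def B_def)
    qed
    have q2: "complex_of_real (q x) = 2 * Q" by (simp add: Q_def)
    have z2: "z x = Q * h x" by (simp add: z_def Q_def)
    have Fx: "F x = radial_deriv h x + of_real c * h x" by (simp add: eq)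
    show ?thesis
      unfolding A Rz qe z2 q2 B_def[symmetric] by (simp add: Fx algebra_simps)
  qed
  have i1: "integrable vol (\<lambda>x. partial_deriv i f x * partial_deriv i g x)" if "smooth f" "smooth g" "i \<in> Basis"
    for i and f g :: "'a \<Rightarrow> complex"
    by (intro smooth_integrable_ball smooth_mult smooth_partial_deriv that)
  have i2: "integrable vol (\<lambda>x. of_real (q x) * (F x + of_real (\<beta> x) * h x) * v x)"
    by (intro smooth_integrable_ball smooth_mult cq1 u v)
  have gf: "grad_form (\<lambda>i. partial_deriv i f) (\<lambda>i. partial_deriv i g) = (LINT x|vol. (\<Sum>i\<in>Basis. partial_deriv i f x * partial_deriv i g x))"
    and gi: "integrable vol (\<lambda>x. \<Sum>i\<in>Basis. partial_deriv i f x * partial_deriv i g x)"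
    if "smooth f" "smooth g" for f g :: "'a \<Rightarrow> complex"
    unfolding grad_form_def using i1[OF that] by simp_all
  have i3: "integrable vol (\<lambda>x. of_nat DIM('a) * (z x * v x) + (z x * radial_deriv v x + radial_deriv z x * v x))"
    by (intro smooth_integrable_ball smooth_add smooth_mult smooth_const smooth_radial_deriv z v)
  have "grad_form (\<lambda>i. partial_deriv i (\<lambda>x. F x + of_real (\<beta> x) * h x)) (\<lambda>i. partial_deriv i v)
      + (LINT x|vol. of_real (q x) * (F x + of_real (\<beta> x) * h x) * v x)
    = (LINT x|vol. (\<Sum>i\<in>Basis. partial_deriv i (\<lambda>x. F x + of_real (\<beta> x) * h x) x * partial_deriv i v x)
      + of_real (q x) * (F x + of_real (\<beta> x) * h x) * v x)"
    unfolding gf[OF u(1) v] by (rule Bochner_Integration.integral_add[symmetric, OF gi[OF u(1) v] i2])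
  also have "\<dots> = (LINT x|vol. (\<Sum>i\<in>Basis. partial_deriv i F x * partial_deriv i v x)
      + (\<Sum>i\<in>Basis. partial_deriv i h x * partial_deriv i (\<lambda>x. of_real (\<beta> x) * v x) x)
      + (of_nat DIM('a) * (z x * v x) + (z x * radial_deriv v x + radial_deriv z x * v x)))"
    by (rule Bochner_Integration.integral_cong[OF refl]) (rule pw, simp)
  also have "\<dots> = (LINT x|vol. (\<Sum>i\<in>Basis. partial_deriv i F x * partial_deriv i v x))
      + (LINT x|vol. (\<Sum>i\<in>Basis. partial_deriv i h x * partial_deriv i (\<lambda>x. of_real (\<beta> x) * v x) x))
      + (LINT x|vol. of_nat DIM('a) * (z x * v x) + (z x * radial_deriv v x + radial_deriv z x * v x))"
    by (intro trans[OF Bochner_Integration.integral_add] arg_cong2[where f = "(+)"] refl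
        Bochner_Integration.integral_add Bochner_Integration.integrable_add gi i3 F h v u(2))
  finally show ?thesis
    unfolding S gf[OF F v] gf[OF h u(2)] sphere_integral_mult[OF z v] .
qed

lemma grad_form_lim:
  assumes "H1_lim \<Phi> u G" "H1_lim \<Psi> v H"
  shows "(\<lambda>k. grad_form (\<lambda>i. partial_deriv i (\<Phi> k)) (\<lambda>i. partial_deriv i (\<Psi> k))) \<longlonglongrightarrow> grad_form G H"
  unfolding grad_form_def using H1_limD[OF assms(1)] H1_limD[OF assms(2)]
  by (intro tendsto_sum L2_lim_integral_mult)

text \<open>The point is the order of the quantifiers: \<open>a\<close> and \<open>l\<close> depend
  on \<open>f\<close>, \<open>g\<close> and \<open>m\<close> but not on the potential. They are the
  Dirichlet form of F against v, and the limiting boundary pairing of h with v.\<close>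

lemma DN_affine:
  fixes f g :: "'a::euclidean_space \<Rightarrow> complex"
  assumes f: "f \<in> H_half" and g: "g \<in> H_half" and m: "m + 1 \<ge> DIM('a)"
  obtains a l where "\<And>q q' \<beta> \<kappa>. darboux (real (Suc m)) q' \<beta> \<kappa> \<Longrightarrow> (\<And>x. norm x \<le> 1 \<Longrightarrow> q x = q' x) \<Longrightarrow>
    (\<And>x. norm x \<le> 1 \<Longrightarrow> 0 \<le> q x) \<Longrightarrow> DN q f g = a + of_real \<kappa> * l"
proof -
  obtain F G where F: "has_trace F G f"
    and harm: "\<And>v H. has_trace v H (\<lambda>_. 0) \<Longrightarrow> (\<Sum>i\<in>Basis. LINT x|vol. G i x * H i x) = 0"
    using harmonic_extension_exists[OF f] by blast
  obtain \<Phi> where \<Phi>: "H1_lim \<Phi> F G" using F by (auto simp: has_trace_iff)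
  have m': "2 * Suc m > DIM('a)" using m by simp
  obtain h P where h: "H1_lim (\<lambda>k. dil_avg m (\<Phi> k)) h P" by (rule H1_lim_dil_avg[OF \<Phi> m'])
  note l\<Phi> = H1_limD[OF \<Phi>] and lh = H1_limD[OF h]
  obtain v H where v: "has_trace v H g" using g by (auto simp: H_half_def)
  obtain \<Psi> where \<Psi>: "H1_lim \<Psi> v H" using v by (auto simp: has_trace_iff)
  obtain l where l: "(\<lambda>k. LINT x|sphere_measure. dil_avg m (\<Phi> k) x * \<Psi> k x) \<longlonglongrightarrow> l"
    using sphere_integral_lim[OF h \<Psi>] by blast
  show thesis
  proof (rule that)
    fix q q' \<beta> :: "'a \<Rightarrow> real" and \<kappa> :: real
    assume d: "darboux (real (Suc m)) q' \<beta> \<kappa>" and qq: "\<And>x. norm x \<le> 1 \<Longrightarrow> q x = q' x" and q0: "\<And>x. norm x \<le> 1 \<Longrightarrow> 0 \<le> q x"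
    have q': "smooth q'" and \<beta>: "smooth \<beta>" and bd: "\<And>x. norm x = 1 \<Longrightarrow> \<beta> x = 0"
      using d unfolding darboux_def by blast+
    have c\<beta>: "smooth (\<lambda>x. complex_of_real (\<beta> x))" and cq: "smooth (\<lambda>x. complex_of_real (q' x))"
      by (intro smooth_of_real \<beta> q')+
    have b0: "complex_of_real (\<beta> x) = 0" if "norm x = 1" for x using bd[OF that] by simp
    define U where "U x = F x + of_real (\<beta> x) * h x" for x
    define W where "W i x = G i x + (of_real (\<beta> x) * P i x + partial_deriv i (\<lambda>x. complex_of_real (\<beta> x)) x * h x)" for i x
    have trU: "has_trace U W f"
      using has_trace_add[OF F H1_lim_mult_trace_0[OF c\<beta> b0 h]] by (simp add: U_def[abs_def] W_def[abs_def])
    define \<Upsilon> where "\<Upsilon> k x = \<Phi> k x + of_real (\<beta> x) * dil_avg m (\<Phi> k) x" for k x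
    have \<Upsilon>: "H1_lim \<Upsilon> U W"
      using H1_lim_add[OF \<Phi> H1_lim_mult[OF c\<beta> h]] by (simp add: U_def[abs_def] W_def[abs_def] \<Upsilon>_def[abs_def])
    \<comment> \<open>Kept general in the test function because it is used twice: with zero trace,
      where \<open>l\<close> is 0, it shows that \<open>U\<close> is the solution, and with trace
      \<open>g\<close> it evaluates the form.\<close>
    have form: "schroedinger_form q U W v H = grad_form G H + of_real \<kappa> * l"
      if \<Psi>: "H1_lim \<Psi> v H" and l: "(\<lambda>k. LINT x|sphere_measure. dil_avg m (\<Phi> k) x * \<Psi> k x) \<longlonglongrightarrow> l" for \<Psi> v H l
    proof -
      note l\<Upsilon> = H1_limD[OF \<Upsilon>] and l\<Psi> = H1_limD[OF \<Psi>]
      have "(\<lambda>k. grad_form (\<lambda>i. partial_deriv i (\<Upsilon> k)) (\<lambda>i. partial_deriv i (\<Psi> k)) + (LINT x|vol. of_real (q' x) * \<Upsilon> k x * \<Psi> k x))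
          \<longlonglongrightarrow> grad_form W H + (LINT x|vol. of_real (q' x) * U x * v x)"
        by (intro tendsto_add grad_form_lim[OF \<Upsilon> \<Psi>] L2_lim_integral_mult L2_lim_smooth_mult square_integrable_smooth_mult cq l\<Upsilon> l\<Psi>)
      moreover have "grad_form W H + (LINT x|vol. of_real (q' x) * U x * v x) = schroedinger_form q U W v H"
        using schroedinger_form_integrable(2)[OF qq q' l\<Upsilon>(2) l\<Upsilon>(4) l\<Psi>(2) l\<Psi>(4)] by simp
      moreover have "grad_form (\<lambda>i. partial_deriv i (\<Upsilon> k)) (\<lambda>i. partial_deriv i (\<Psi> k)) + (LINT x|vol. of_real (q' x) * \<Upsilon> k x * \<Psi> k x)
        = grad_form (\<lambda>i. partial_deriv i (\<Phi> k)) (\<lambda>i. partial_deriv i (\<Psi> k))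
          + grad_form (\<lambda>i. partial_deriv i (dil_avg m (\<Phi> k))) (\<lambda>i. partial_deriv i (\<lambda>x. of_real (\<beta> x) * \<Psi> k x))
          + of_real \<kappa> * (LINT x|sphere_measure. dil_avg m (\<Phi> k) x * \<Psi> k x)" for k
        unfolding \<Upsilon>_def[abs_def]
        by (rule darboux_identity[OF d smooth_dil_avg[OF l\<Phi>(1)] l\<Phi>(1) l\<Psi>(1) radial_deriv_dil_avg[OF l\<Phi>(1)]])
      moreover have "(\<lambda>k. grad_form (\<lambda>i. partial_deriv i (\<Phi> k)) (\<lambda>i. partial_deriv i (\<Psi> k))
          + grad_form (\<lambda>i. partial_deriv i (dil_avg m (\<Phi> k))) (\<lambda>i. partial_deriv i (\<lambda>x. of_real (\<beta> x) * \<Psi> k x))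
          + of_real \<kappa> * (LINT x|sphere_measure. dil_avg m (\<Phi> k) x * \<Psi> k x))
        \<longlonglongrightarrow> grad_form G H + grad_form P (\<lambda>i x. of_real (\<beta> x) * H i x + partial_deriv i (\<lambda>x. complex_of_real (\<beta> x)) x * v x) + of_real \<kappa> * l"
        by (intro tendsto_add grad_form_lim[OF \<Phi> \<Psi>] grad_form_lim[OF h H1_lim_mult[OF c\<beta> \<Psi>]] tendsto_mult_left l)
      \<comment> \<open>Here harmonicity of h enters: \<open>\<beta>\<close> vanishes on the sphere,
        so the product of \<open>\<beta>\<close> and v has zero trace even when v has not.\<close>
      moreover have "grad_form P (\<lambda>i x. of_real (\<beta> x) * H i x + partial_deriv i (\<lambda>x. complex_of_real (\<beta> x)) x * v x) = 0"
        unfolding grad_form_def by (rule dil_avg_harmonic[OF \<Phi> harm h m H1_lim_mult_trace_0[OF c\<beta> b0 \<Psi>]])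
      ultimately show ?thesis by (simp add: LIMSEQ_unique)
    qed
    have sol: "dirichlet_solution q f U W"
      unfolding dirichlet_solution_def
    proof (intro conjI allI impI trU)
      fix w :: "'a \<Rightarrow> complex" and K assume w: "has_trace w K (\<lambda>_. 0)"
      then obtain \<Psi>0 where \<Psi>0: "H1_lim \<Psi>0 w K" "L2_lim sphere_measure \<Psi>0 (\<lambda>_. 0)"
        by (auto simp: has_trace_iff)
      have "schroedinger_form q U W w K = grad_form G K + of_real \<kappa> * 0"
        by (rule form[OF \<Psi>0(1) sphere_integral_lim_trace_0[OF h H1_limD(1)[OF \<Psi>0(1)] \<Psi>0(2)]])
      then show "schroedinger_form q U W w K = 0" using harm[OF w] by (simp add: grad_form_def)
    qed
    show "DN q f g = grad_form G H + of_real \<kappa> * l"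
      using DN_eq[OF qq q' q0 sol v] form[OF \<Psi> l] by simp
  qed
qed

section \<open>Bargmann potentials\<close>

text \<open>The solution D of a (D + 1) / (D - 1) = 7/2. It exceeds 1 exactly when 0 < 2 a <
  7.\<close>

definition pole :: "nat \<Rightarrow> real" where
  "pole a = (7 + 2 * real a) / (7 - 2 * real a)"

text \<open>This is 2 (w^2 - a^2) / r^2, since (D + s)^2 - (D - s)^2 = 4 D s for s = r^(2a). The
  division by r^2 lowers the exponent to 2a - 2, an even natural number for a >= 1.\<close>

definition bargmann :: "nat \<Rightarrow> 'a::euclidean_space \<Rightarrow> real" where
  "bargmann a x = 8 * (real a)\<^sup>2 * pole a * (x \<bullet> x) ^ (a - 1) * (recip_ext (pole a) ((x \<bullet> x) ^ a))\<^sup>2"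

text \<open>Here \<open>w = a (D + r\<^bsup>2a\<^esup>) / (D - r\<^bsup>2a\<^esup>)\<close>, that is \<open>a coth (a t + b)\<close> with \<open>t = - ln r\<close>, and the
  constant \<open>D = pole a\<close> is chosen so that \<open>w = 7/2\<close> on the sphere for every \<open>a\<close>.\<close>

lemma darboux_bargmann:
  assumes a: "0 < a" "a \<le> 3"
  shows "darboux 4 (bargmann a :: real^3 \<Rightarrow> real)
    (\<lambda>x. real a * (pole a + (x \<bullet> x) ^ a) * recip_ext (pole a) ((x \<bullet> x) ^ a) - 7 / 2) (49 / 4 - (real a)\<^sup>2)"
proof -
  define D where "D = pole a"
  have lt: "2 * real a < 7" using a(2) by simp
  have D: "D > 1" using a(1) lt by (simp add: D_def pole_def)
  have D1: "D - 1 = 4 * real a / (7 - 2 * real a)" using lt by (simp add: D_def pole_def field_simps)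
  define E :: "real^3 \<Rightarrow> real" where "E x = recip_ext D ((x \<bullet> x) ^ a)" for x
  define \<beta> :: "real^3 \<Rightarrow> real" where "\<beta> x = real a * (D + (x \<bullet> x) ^ a) * E x - 7 / 2" for x
  define q :: "real^3 \<Rightarrow> real" where "q x = 8 * (real a)\<^sup>2 * D * (x \<bullet> x) ^ (a - 1) * (E x)\<^sup>2" for x
  have E: "smooth E" unfolding E_def[abs_def] by (rule smooth_recip_ext_norm_sq[OF D])
  have sq: "smooth q" and s\<beta>: "smooth \<beta>"
    unfolding q_def[abs_def] \<beta>_def[abs_def]
    by (intro smooth_mult smooth_add smooth_diff smooth_const smooth_power smooth_norm_sq E)+
  have ball: "(\<forall>i\<in>Basis. partial_deriv i \<beta> x = q x / 2 * (x \<bullet> i)) \<and>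
      real DIM(real^3) * q x + radial_deriv q x = 2 * q x * (4 + \<beta> x)" if x: "norm x < 1" for x :: "real^3"
  proof -
    define p where "p = x \<bullet> x"
    have p: "0 \<le> p" "p < 1" using norm_sq_less_1[OF x] by (auto simp: p_def)
    have pa: "p ^ a < 1" using p a(1) by (simp add: power_less_one_iff)
    have Ee: "(D - p ^ a) * E x = 1" using pa D by (simp add: E_def p_def recip_ext_eq)
    have dE: "(E has_derivative (\<lambda>v. (E x)\<^sup>2 * (2 * real a * p ^ (a - 1) * (x \<bullet> v)))) (at x)"
      using has_derivative_recip_ext_norm_sq[OF D x a(1)] unfolding E_def[abs_def] p_def .
    have dp: "((\<lambda>x::real^3. (x \<bullet> x) ^ k) has_derivative (\<lambda>v. real k * p ^ (k - 1) * (2 * (x \<bullet> v)))) (at x)" for k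
      by (auto intro!: derivative_eq_intros simp: p_def inner_commute algebra_simps)
    have d\<beta>: "(\<beta> has_derivative (\<lambda>v. real a * (D + p ^ a) * ((E x)\<^sup>2 * (2 * real a * p ^ (a - 1) * (x \<bullet> v)))
        + real a * (real a * p ^ (a - 1) * (2 * (x \<bullet> v))) * E x)) (at x)"
      unfolding \<beta>_def[abs_def] 
      by (rule has_derivative_eq_rhs, (rule derivative_intros dp dE)+) (simp add: p_def fun_eq_iff algebra_simps)
    \<comment> \<open>From 1 = (D - p^a) E the lone \<open>E x\<close> becomes (D - p^a) E^2 and the
      powers of p cancel. This is the Riccati equation for w in terms of E.\<close>
    have key: "(D + p ^ a) * (E x)\<^sup>2 + E x = 2 * D * (E x)\<^sup>2"
    proof -
      have "E x = (D - p ^ a) * (E x)\<^sup>2" using Ee by (metis mult.assoc mult_1 power2_eq_square)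
      then show ?thesis by (simp add: algebra_simps)
    qed
    have 1: "partial_deriv i \<beta> x = q x / 2 * (x \<bullet> i)" for i
    proof -
      have "partial_deriv i \<beta> x = 2 * (real a)\<^sup>2 * p ^ (a - 1) * (x \<bullet> i) * ((D + p ^ a) * (E x)\<^sup>2 + E x)"
        unfolding partial_deriv_eq[OF d\<beta>] by (simp add: algebra_simps power2_eq_square)
      also have "\<dots> = q x / 2 * (x \<bullet> i)" unfolding key by (simp add: q_def p_def)
      finally show ?thesis .
    qed
    have dq: "(q has_derivative (\<lambda>v. 8 * (real a)\<^sup>2 * D * p ^ (a - 1) * (2 * E x * ((E x)\<^sup>2 * (2 * real a * p ^ (a - 1) * (x \<bullet> v))))
        + 8 * (real a)\<^sup>2 * D * (real (a - 1) * p ^ (a - 1 - 1) * (2 * (x \<bullet> v))) * (E x)\<^sup>2)) (at x)"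
      unfolding q_def[abs_def] power2_eq_square[of "E _"]
      by (rule has_derivative_eq_rhs, (rule derivative_intros dp dE)+) (simp add: p_def fun_eq_iff algebra_simps power2_eq_square)
    have "radial_deriv q x = q x * (2 * real (a - 1) + 4 * real a * p ^ a * E x)"
    proof -
      \<comment> \<open>For a = 1 the truncated exponent \<open>a - 1 - 1\<close> is 0 instead of
        -1, but then the coefficient \<open>real (a - 1)\<close> is 0.\<close>
      have "real (a - 1) * p ^ (a - 1 - 1) * p = real (a - 1) * p ^ (a - 1)"
        by (cases "a - 1") simp_all
      moreover have "p ^ (a - 1) * p = p ^ a" using a(1) by (cases a) simp_all
      moreover have "radial_deriv q x = 8 * (real a)\<^sup>2 * D * p ^ (a - 1) * (E x)\<^sup>2 * (4 * real a * (p ^ (a - 1) * p) * E x)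
         + 16 * (real a)\<^sup>2 * D * (real (a - 1) * p ^ (a - 1 - 1) * p) * (E x)\<^sup>2"
        using partial_deriv_eq[OF dq, of x] unfolding radial_deriv_def partial_deriv_def
        by (simp add: p_def[symmetric] algebra_simps power2_eq_square)
      ultimately have "radial_deriv q x = 8 * (real a)\<^sup>2 * D * p ^ (a - 1) * (E x)\<^sup>2 * (4 * real a * p ^ a * E x)
         + 16 * (real a)\<^sup>2 * D * (real (a - 1) * p ^ (a - 1)) * (E x)\<^sup>2"
        by (simp only:)
      then show ?thesis by (simp add: q_def p_def[symmetric] algebra_simps)
    qed
    moreover have "real DIM(real^3) = 3" by simp
    moreover have "real (a - 1) = real a - 1" using a(1) by simp
    \<comment> \<open>Writing D + p^a as (D - p^a) + 2 p^a gives w = a + 2 a p^a E. The constants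
      then agree because 2 * 4 - 7 = 3 - 2, which is c = w_0 + 1/2 in dimension three.\<close>
    moreover have "real a * (D - p ^ a) * E x = real a" using Ee by (simp add: mult.assoc)
    then have "2 * (real a * (D + p ^ a) * E x) = 2 * real a + 4 * real a * p ^ a * E x"
      by (simp add: algebra_simps)
    then have "2 * (4 + \<beta> x) = 3 + (2 * (real a - 1) + 4 * real a * p ^ a * E x)"
      by (simp add: \<beta>_def p_def[symmetric])
    then have "2 * q x * (4 + \<beta> x) = q x * (3 + (2 * (real a - 1) + 4 * real a * p ^ a * E x))"
      by (metis mult.assoc mult.commute)
    ultimately have "real DIM(real^3) * q x + radial_deriv q x = 2 * q x * (4 + \<beta> x)"
      by (simp add: algebra_simps)
    with 1 show ?thesis by blast
  qed
  have sphere: "\<beta> x = 0 \<and> q x = 2 * (49 / 4 - (real a)\<^sup>2)" if x: "norm x = 1" for x :: "real^3"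
  proof -
    have xx: "x \<bullet> x = 1" using x by (simp add: norm_eq_1)
    have Ex: "E x = (7 - 2 * real a) / (4 * real a)" by (simp add: E_def xx recip_ext_eq D1)
    have DD: "D + 1 = 14 / (7 - 2 * real a)" using lt by (simp add: D_def pole_def field_simps)
    have "\<beta> x = 0" using lt a(1) by (simp add: \<beta>_def xx Ex DD)
    have "q x = 8 * (real a)\<^sup>2 * ((7 + 2 * real a) / (7 - 2 * real a)) * ((7 - 2 * real a) / (4 * real a))\<^sup>2"
      by (simp add: q_def xx Ex) (simp add: D_def pole_def)
    moreover have "8 * \<alpha>\<^sup>2 * (v / u) * (u / (4 * \<alpha>))\<^sup>2 = v * u / 2" if "\<alpha> \<noteq> 0" "u \<noteq> 0" for \<alpha> u v :: real
      using that by (simp add: field_simps power2_eq_square)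
    ultimately have "q x = (7 + 2 * real a) * (7 - 2 * real a) / 2" using lt a(1) by simp
    then have "q x = 2 * (49 / 4 - (real a)\<^sup>2)"
      by (simp add: algebra_simps power2_eq_square)
    with \<open>\<beta> x = 0\<close> show ?thesis ..
  qed
  have "darboux 4 q \<beta> (49 / 4 - (real a)\<^sup>2)"
    unfolding darboux_def using sq s\<beta> ball sphere by blast
  moreover have "q = bargmann a" by (simp add: q_def[abs_def] bargmann_def[abs_def] E_def D_def)
  ultimately show ?thesis by (simp add: \<beta>_def[abs_def] E_def D_def)
qed

lemma bargmann_nonneg: "a \<le> 3 \<Longrightarrow> 0 \<le> bargmann a x"
  by (simp add: bargmann_def pole_def)

lemma smooth_bargmann: "0 < a \<Longrightarrow> a \<le> 3 \<Longrightarrow> smooth (bargmann a :: real^3 \<Rightarrow> real)"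
  using darboux_bargmann[of a] by (simp add: darboux_def)

theorem corollary3p3:
  shows "\<exists>(Q :: (real^3 \<Rightarrow> real) pmf) (qs :: real^3 \<Rightarrow> real).
    set_pmf Q \<subseteq> potentials \<and> card (set_pmf Q) = 2 \<and> qs \<in> potentials \<and>
    (\<forall>f\<in>H_half. \<forall>g\<in>H_half. mean_DN Q f g = DN qs f g) \<and>
    qs \<noteq> mean_potential Q"
proof -
  have cl: "closure (unit_ball :: (real^3) set) = cball 0 1" by simp
  \<comment> \<open>Restricted because members of \<open>potentials\<close> are extensional on the
    closed ball; the unrestricted \<open>bargmann a\<close> is the smooth extension.\<close>
  define q :: "nat \<Rightarrow> real^3 \<Rightarrow> real" where "q a = restrict (bargmann a) (closure unit_ball)" for a
  have q_eq: "q a x = bargmann a x" if "norm x \<le> 1" for a x using that by (simp add: q_def cl)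
  have pot: "q a \<in> potentials" if "0 < a" "a \<le> 3" for a
    unfolding potentials_def smooth_upto_boundary_def
    using smooth_bargmann[OF that] bargmann_nonneg[OF that(2)] by (auto simp: q_def)
  define Q where "Q = map_pmf (\<lambda>b. if b then q 1 else q 3) (bernoulli_pmf (5 / 8))"
  \<comment> \<open>At the origin the factor \<open>(x \<bullet> x) ^ (a - 1)\<close> is 1 for a = 1
    and 0 otherwise. This one point separates \<open>q 1\<close> from \<open>q 3\<close> and
    \<open>q 2\<close> from the mean.\<close>
  have at0: "q 1 0 > 0" "q 2 0 = 0" "q 3 0 = 0"
    by (simp_all add: q_eq bargmann_def pole_def recip_ext_eq)
  have set_Q: "set_pmf Q = {q 1, q 3}"
    by (auto simp: Q_def set_pmf_bernoulli)
  have exp: "measure_pmf.expectation Q F = (5 / 8) *\<^sub>R F (q 1) + (3 / 8) *\<^sub>R F (q 3)"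
    for F :: "(real^3 \<Rightarrow> real) \<Rightarrow> 'c::{banach, second_countable_topology}"
    unfolding Q_def integral_map_pmf by (subst integral_measure_pmf[of UNIV]) (auto simp: UNIV_bool)
  have DN: "mean_DN Q f g = DN (q 2) f g" if f: "f \<in> H_half" and g: "g \<in> H_half" for f g
  proof -
    \<comment> \<open>The choice m = 3 makes \<open>Suc m\<close> the constant c = 4 of
      \<open>darboux_bargmann\<close>.\<close>
    have "DIM(real^3) \<le> 3 + 1" by simp
    from DN_affine[OF f g this] obtain A l where
      *: "\<forall>q q' \<beta> \<kappa>. darboux (real (Suc 3)) q' \<beta> \<kappa> \<longrightarrow> (\<forall>x. norm x \<le> 1 \<longrightarrow> q x = q' x) \<longrightarrow>
        (\<forall>x. norm x \<le> 1 \<longrightarrow> 0 \<le> q x) \<longrightarrow> DN q f g = A + of_real \<kappa> * l"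
      by metis
    have "DN (q a) f g = A + of_real (49 / 4 - (real a)\<^sup>2) * l" if "0 < a" "a \<le> 3" for a
    proof (rule *[rule_format])
      show "darboux (real (Suc 3)) (bargmann a) (\<lambda>x :: real^3. real a * (pole a + (x \<bullet> x) ^ a) * recip_ext (pole a) ((x \<bullet> x) ^ a) - 7 / 2) (49 / 4 - (real a)\<^sup>2)"
        using darboux_bargmann[OF that] by simp
    qed (use that in \<open>auto simp: q_eq bargmann_nonneg\<close>)
    \<comment> \<open>The three values of 49/4 - a^2 are 45/4, 33/4 and 13/4, and the weights 5/8
      and 3/8 average the outer two to the middle one.\<close>
    from this[of 1] this[of 2] this[of 3] show ?thesis
      by (simp add: mean_DN_def exp scaleR_conv_of_real algebra_simps)
  qed
  have "mean_potential Q 0 = 5 / 8 * q 1 0 + 3 / 8 * q 3 0"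
    by (simp add: mean_potential_def exp)
  then have ne: "q 2 \<noteq> mean_potential Q" using at0 by auto
  have "card (set_pmf Q) = 2"
  proof -
    have "q 1 \<noteq> q 3" using at0 by auto
    then show ?thesis by (simp add: set_Q)
  qed
  with set_Q pot DN ne show ?thesis
    by (intro exI[of _ Q] exI[of _ "q 2"]) auto
qed

end
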